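(* Let $(\Omega,\mathcal{F},\mathbb{P})$ be a Wiener space, let $f:\Omega\to[0,\infty)$ be a non-negative, convex, symmetric, measurable function, and let $A\in\mathcal{F}$ be a symmetric convex set with $\mathbb{P}(A)>0$. Then $$\mathbb{E}[f\mid A]\le\mathbb{E}[f].$$
   Context: Wiener space here means an abstract Wiener space: $\Omega$ is a separable Banach space, $\mathbb{P}$ is a centered Gaussian measure on $\Omega$, and $\mathcal{F}$ is the $\sigma$-algebra of $\mathbb{P}$-measurable sets. A set $A$ is symmetric if $A=-A$; a function $f$ is symmetric if $f(-\omega)=f(\omega)$ for all $\omega\in\Omega$. $\mathbb{E}[f\mid A]=\mathbb{E}[f\mathbf{1}_A]/\mathbb{P}(A)$. The expectation $\mathbb{E}[f]$ may be $+\infty$. *)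

theory Defs
  imports "HOL-Probability.Probability"
begin

text \<open>
  The variance may vanish, so the point mass at \<open>0\<close> counts as a centered Gaussian law on the line;
  it is listed separately because \<^const>\<open>normal_density\<close> is not meaningful for \<open>\<sigma> = 0\<close>.
\<close>

definition centered_gaussian_law :: "real measure \<Rightarrow> bool" where
  "centered_gaussian_law \<mu> \<longleftrightarrow>
     \<mu> = return borel 0 \<or>
     (\<exists>\<sigma>>0. \<mu> = density lborel (\<lambda>x. ennreal (normal_density 0 \<sigma> x)))"

definition centered_gaussian_measure :: "'a::{banach, second_countable_topology} measure \<Rightarrow> bool" where
  "centered_gaussian_measure M \<longleftrightarrow>
     prob_space M \<and> sets M = sets borel \<and>
     (\<forall>l :: 'a \<Rightarrow> real. bounded_linear l \<longrightarrow> centered_gaussian_law (distr M borel l))"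

text \<open>
  The sigma-algebra \<open>\<F>\<close> of a Wiener space consists of the \<open>\<P>\<close>-measurable sets, i.e. it is the
  completion of the Borel sigma-algebra with respect to the Gaussian measure.
\<close>

definition wiener_space :: "'a::{banach, second_countable_topology} measure \<Rightarrow> bool" where
  "wiener_space P \<longleftrightarrow> (\<exists>M. centered_gaussian_measure M \<and> P = completion M)"

definition symmetric_set :: "'a::uminus set \<Rightarrow> bool" where
  "symmetric_set A \<longleftrightarrow> A = uminus ` A"

definition symmetric_function :: "('a::uminus \<Rightarrow> 'b) \<Rightarrow> bool" where
  "symmetric_function f \<longleftrightarrow> (\<forall>\<omega>. f (- \<omega>) = f \<omega>)"

text \<open>
  For the non-negative functions considered here, expectations are Lebesgue integrals with values
  in \<open>[0, \<infinity>]\<close>; \<^const>\<open>ennreal\<close> truncates negative values to \<open>0\<close>.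
\<close>

definition expect :: "'a measure \<Rightarrow> ('a \<Rightarrow> real) \<Rightarrow> ennreal" where
  "expect P f = (\<integral>\<^sup>+ \<omega>. ennreal (f \<omega>) \<partial>P)"

definition cond_expect :: "'a measure \<Rightarrow> ('a \<Rightarrow> real) \<Rightarrow> 'a set \<Rightarrow> ennreal" where
  "cond_expect P f A = expect P (\<lambda>\<omega>. f \<omega> * indicator A \<omega>) / emeasure P A"

end

theory Submission
  imports Defs
begin

text \<open>
  Let \<open>g\<close> be an even log-concave weight, for instance the indicator of \<open>A\<close>. Two independent samples
  \<open>x, y\<close> weighted by \<open>g\<close> are rotated to \<open>u = (x + y) / \<surd>2\<close> and \<open>v = (x - y) / \<surd>2\<close>. Given \<open>u\<close>, the
  weight of \<open>v\<close> is again even and log-concave, and so is the marginal weight of \<open>u\<close>, by the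
  Prekopa-Leindler inequality. Replacing first \<open>v\<close> and then \<open>u\<close> by unweighted samples bounds the excess
  of \<open>E[g f(s x + w)]\<close> over \<open>E[g] E[f(s x + w)]\<close> by twice the largest excess at scale \<open>s / \<surd>2\<close>.

  Exponentials of functionals have no excess: by the Cameron-Martin formula this is Anderson's
  inequality. Therefore the excess of a log-sum-exp of affine functionals at scale \<open>s\<close> is \<open>O(s^4)\<close>, and
  after \<open>n\<close> doublings at most \<open>O(2^n / 4^n)\<close>, so it vanishes. Maxima of affine functionals are limits of
  such functions, and continuous convex functions are suprema of affine ones. A general convex \<open>f\<close> is
  approximated in \<open>L^1\<close> by averaging over all but finitely many Gaussian coordinates.
\<close>

section \<open>Subgradients of convex functions and norming functionals\<close>

text \<open>The order of the error decides everything: a doubling step multiplies the excess by 2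
  and undoes one halving of the square of the scale, so an excess of order s^2 would only break
  even, while any higher order vanishes. For a log-sum-exp the linear term integrates to zero
  against an even weight, and the terms of order s^2 sit inside exponentials of functionals, where
  the comparison is exact. Only the passage between ln (1 + D) and D costs something. Infinite
  dimension removes Lebesgue densities. Laws are therefore identified by characteristic functionals,
  and one-dimensional inequalities are transported along independent coordinates obtained by
  Gram-Schmidt in the covariance form. Finitely many coordinates determine a function only up to an
  L^1 error. A second obstacle is the completed sigma-algebra: neither \<open>A\<close> nor
  \<open>f\<close> need be Borel, and convexity may be lost in a Borel version. Hence a weight is
  carried together with a second function equal to it almost everywhere, and convex functions are
  averaged by upper integrals.\<close>

lemma convex_linear_subgradient:
  fixes f :: "'a::real_vector \<Rightarrow> real"
  assumes f: "convex_on UNIV f"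
  obtains l where "linear l" "\<And>x. f x0 + l (x - x0) \<le> f x"
proof -
  define p where "p v = f (x0 + v) - f x0" for v
  have p0: "p 0 = 0" by (simp add: p_def)
  have p_conv: "p ((1 - t) *\<^sub>R u + t *\<^sub>R v) \<le> (1 - t) * p u + t * p v" if "0 \<le> t" "t \<le> 1" for t u v
  proof -
    have "x0 + ((1 - t) *\<^sub>R u + t *\<^sub>R v) = (1 - t) *\<^sub>R (x0 + u) + t *\<^sub>R (x0 + v)"
      by (simp add: algebra_simps)
    then show ?thesis
      using convex_onD[OF f that, of "x0 + u" "x0 + v"] by (simp add: p_def algebra_simps)
  qed
  \<comment> \<open>Linear minorants of \<open>p\<close> on subspaces are ordered as graphs, without
    requiring them to be single-valued: a vertical vector in such a subspace could be scaled to
    \<open>(0, 1)\<close>, contradicting \<open>p 0 = 0\<close>. A maximal element turns out to be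
    the graph of the desired functional.\<close>
  define \<A> where "\<A> = {G :: ('a \<times> real) set. subspace G \<and> (\<forall>(v, r) \<in> G. r \<le> p v)}"
  have "\<exists>M\<in>\<A>. \<forall>X\<in>\<A>. M \<subseteq> X \<longrightarrow> X = M"
  proof (rule subset_Zorn)
    fix C assume C: "subset.chain \<A> C"
    show "\<exists>U\<in>\<A>. \<forall>X\<in>C. X \<subseteq> U"
    proof (cases "C = {}")
      case True
      have "{0} \<in> \<A>"
        using p0 by (auto simp: \<A>_def subspace_def zero_prod_def)
      then show ?thesis using True by auto
    next
      case False
      have sub: "subspace G" "\<And>v r. (v, r) \<in> G \<Longrightarrow> r \<le> p v" if "G \<in> C" for G
        using C that by (auto simp: subset.chain_def \<A>_def)
      have "subspace (\<Union>C)"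
      proof (rule subspaceI)
        show "0 \<in> \<Union>C" using False sub(1) subspace_0 by blast
      next
        fix x y assume "x \<in> \<Union>C" "y \<in> \<Union>C"
        then obtain G H where GH: "G \<in> C" "H \<in> C" "x \<in> G" "y \<in> H" by auto
        then have "G \<subseteq> H \<or> H \<subseteq> G"
          using C by (auto simp: subset.chain_def)
        then show "x + y \<in> \<Union>C"
          using GH sub(1) subspace_add by blast
      next
        fix c :: real and x assume "x \<in> \<Union>C"
        then show "c *\<^sub>R x \<in> \<Union>C" using sub(1) subspace_scale by blast
      qed
      then have "\<Union>C \<in> \<A>" using sub(2) by (auto simp: \<A>_def)
      then show ?thesis by blast
    qed
  qed
  then obtain G where G: "G \<in> \<A>" and max: "\<And>X. X \<in> \<A> \<Longrightarrow> G \<subseteq> X \<Longrightarrow> X = G" by blast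
  have sG: "subspace G" and Gp: "\<And>v r. (v, r) \<in> G \<Longrightarrow> r \<le> p v" using G by (auto simp: \<A>_def)
  have uniq: "r = s" if "(v, r) \<in> G" "(v, s) \<in> G" for v r s
  proof (rule ccontr)
    assume "r \<noteq> s"
    have "(v, r) - (v, s) \<in> G" using that sG subspace_diff by blast
    then have "(0, r - s) \<in> G" by simp
    then have "(1 / (r - s)) *\<^sub>R (0, r - s) \<in> G" using sG subspace_scale by blast
    then have "(0, 1) \<in> G" using \<open>r \<noteq> s\<close> by simp
    then have "1 \<le> p 0" by (rule Gp)
    then show False using p0 by simp
  qed
  have total: "\<exists>r. (v, r) \<in> G" for v
  proof -
    \<comment> \<open>The one-dimensional extension step: every slope on the left is at most every
      slope on the right, so the supremum of the left slopes is an admissible value at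
      \<open>v\<close>.\<close>
    have key: "(r' - p (u' - s *\<^sub>R v)) / s \<le> (p (u + t *\<^sub>R v) - r) / t"
      if "(u, r) \<in> G" "(u', r') \<in> G" "s > 0" "t > 0" for u r u' r' s t
    proof -
      \<comment> \<open>With this weight the \<open>v\<close>-components of the two points cancel,
        so their convex combination is the base point of a vector of \<open>G\<close>.\<close>
      define a where "a = s / (s + t)"
      have a: "0 \<le> a" "a \<le> 1" "1 - a = t / (s + t)" using that by (auto simp: a_def field_simps)
      have "(1 - a) *\<^sub>R (u', r') + a *\<^sub>R (u, r) \<in> G"
        using that sG subspace_add subspace_scale by blast
      then have 1: "(1 - a) * r' + a * r \<le> p ((1 - a) *\<^sub>R u' + a *\<^sub>R u)" using Gp by simp
      have e: "(1 - a) * s = a * t" using a that by (simp add: a_def)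
      have "(1 - a) *\<^sub>R (u' - s *\<^sub>R v) + a *\<^sub>R (u + t *\<^sub>R v) = (1 - a) *\<^sub>R u' + a *\<^sub>R u + (a * t - (1 - a) * s) *\<^sub>R v"
        by (simp add: algebra_simps)
      also have "\<dots> = (1 - a) *\<^sub>R u' + a *\<^sub>R u" using e by simp
      finally have "(1 - a) * r' + a * r \<le> (1 - a) * p (u' - s *\<^sub>R v) + a * p (u + t *\<^sub>R v)"
        using 1 p_conv[OF a(1,2), of "u' - s *\<^sub>R v" "u + t *\<^sub>R v"] by simp
      then have "t * r' + s * r \<le> t * p (u' - s *\<^sub>R v) + s * p (u + t *\<^sub>R v)"
        unfolding a(3) using that by (simp add: a_def divide_simps)
      then show ?thesis using that by (simp add: divide_simps) (simp add: algebra_simps)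
    qed
    define S where "S = {(r' - p (u' - s *\<^sub>R v)) / s | u' r' s. (u', r') \<in> G \<and> s > 0}"
    have 00: "(0, 0) \<in> G" using subspace_0[OF sG] by (simp add: zero_prod_def)
    have Sne: "S \<noteq> {}" unfolding S_def using 00 zero_less_one by blast
    have Sup_le: "Sup S \<le> (p (u + t *\<^sub>R v) - r) / t" if "(u, r) \<in> G" "t > 0" for u r t
      using Sne key that by (intro cSup_least) (auto simp: S_def)
    have bdd: "bdd_above S"
      using key[OF 00, where t = 1] by (intro bdd_aboveI[where M = "p v"]) (auto simp: S_def)
    have le_Sup: "(r' - p (u' - s *\<^sub>R v)) / s \<le> Sup S" if "(u', r') \<in> G" "s > 0" for u' r' s
      using that by (intro cSup_upper bdd) (auto simp: S_def)
    define \<alpha> where "\<alpha> = Sup S"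
    have main: "r + t * \<alpha> \<le> p (u + t *\<^sub>R v)" if "(u, r) \<in> G" for u r t
    proof -
      consider "t = 0" | "t > 0" | "t < 0" by linarith
      then show ?thesis
      proof cases
        case 1 then show ?thesis using Gp[OF that] by simp
      next
        case 2 then show ?thesis using Sup_le[OF that 2] by (simp add: \<alpha>_def field_simps)
      next
        case 3
        then show ?thesis using le_Sup[OF that, of "-t"]
          by (simp add: \<alpha>_def field_simps)
      qed
    qed
    define H where "H = {g + t *\<^sub>R (v, \<alpha>) | g t. g \<in> G}"
    have "subspace H"
    proof (rule subspaceI)
      show "0 \<in> H" unfolding H_def
        by (intro CollectI exI[of _ 0] exI[of _ "0::real"] conjI subspace_0[OF sG]) (metis add_0 scaleR_zero_left)
    next
      fix x y assume "x \<in> H" "y \<in> H"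
      then obtain g t g' t' where "x = g + t *\<^sub>R (v, \<alpha>)" "y = g' + t' *\<^sub>R (v, \<alpha>)" "g \<in> G" "g' \<in> G"
        by (auto simp: H_def)
      then have "x + y = (g + g') + (t + t') *\<^sub>R (v, \<alpha>)" "g + g' \<in> G"
        using sG subspace_add by (auto simp: algebra_simps)
      then show "x + y \<in> H" unfolding H_def by blast
    next
      fix c x assume "x \<in> H"
      then obtain g t where "x = g + t *\<^sub>R (v, \<alpha>)" "g \<in> G" by (auto simp: H_def)
      then have "c *\<^sub>R x = c *\<^sub>R g + (c * t) *\<^sub>R (v, \<alpha>)" "c *\<^sub>R g \<in> G"
        using sG subspace_scale by (auto simp: algebra_simps)
      then show "c *\<^sub>R x \<in> H" unfolding H_def by blast
    qed
    moreover have "r \<le> p u" if "(u, r) \<in> H" for u r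
      using that main by (auto simp: H_def)
    ultimately have "H \<in> \<A>" by (auto simp: \<A>_def)
    moreover have "G \<subseteq> H"
    proof
      fix g assume "g \<in> G" then show "g \<in> H" unfolding H_def by (intro CollectI exI[of _ g] exI[of _ "0::real"]) (auto simp: zero_prod_def)
    qed
    ultimately have "H = G" using max by blast
    moreover have "(0, 0) + 1 *\<^sub>R (v, \<alpha>) \<in> H" unfolding H_def using 00 by blast
    ultimately show ?thesis by auto
  qed
  define l where "l v = (THE r. (v, r) \<in> G)" for v
  have lG: "(v, l v) \<in> G" for v
    unfolding l_def using total[of v] uniq by (metis theI)
  have l_eq: "l v = r" if "(v, r) \<in> G" for v r using lG uniq that by blast
  have "linear l"
  proof (rule linearI)
    show "l (x + y) = l x + l y" for x y
      using subspace_add[OF sG lG lG, of x y] by (simp add: l_eq)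
    show "l (c *\<^sub>R x) = c *\<^sub>R l x" for c x
      using subspace_scale[OF sG lG, of c x] by (simp add: l_eq)
  qed
  moreover have "f x0 + l (x - x0) \<le> f x" for x
    using Gp[OF lG, of "x - x0"] by (simp add: p_def)
  ultimately show ?thesis by (rule that)
qed

text \<open>A subgradient of the norm at \<open>x0\<close> does this: testing it at \<open>0\<close>
  and at \<open>2 *\<^sub>R x0\<close> forces \<open>l x0 = norm x0\<close>, after which the
  subgradient inequality says that \<open>l\<close> is dominated by the norm.\<close>

lemma norming_functional:
  fixes x0 :: "'a::real_normed_vector"
  obtains l where "bounded_linear l" "l x0 = norm x0" "\<And>x. l x \<le> norm x"
proof -
  have "convex_on UNIV (norm :: 'a \<Rightarrow> real)"
    by (intro convex_onI) (auto intro: norm_triangle_le)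
  then obtain l where l: "linear l" "\<And>x. norm x0 + l (x - x0) \<le> norm x"
    using convex_linear_subgradient[of norm x0] by blast
  interpret linear l by fact
  have "l x0 = norm x0"
    using l(2)[of 0] l(2)[of "2 *\<^sub>R x0"] by (simp add: diff scale neg)
  then have le: "l x \<le> norm x" for x using l(2)[of x] by (simp add: diff)
  moreover have "\<bar>l x\<bar> \<le> norm x" for x using le[of x] le[of "-x"] by (simp add: neg)
  then have "bounded_linear l"
    using l(1) by (intro bounded_linear_intro[where K = 1]) (auto simp: add scale)
  ultimately show ?thesis using \<open>l x0 = norm x0\<close> that by blast
qed

text \<open>Norming functionals at the points of a countable dense set recover the norm as their
  supremum, so closed balls are countable intersections of half-spaces. By the Lindelof property
  open sets are countable unions of closed balls.\<close>

lemma functionals_generate_borel: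
  obtains l :: "nat \<Rightarrow> 'a::{banach, second_countable_topology} \<Rightarrow> real"
  where "\<And>i. bounded_linear (l i)" "sets (borel :: 'a measure) = sigma_sets UNIV {{x. l i x \<le> r} | i r. True}"
proof -
  obtain D :: "'a set" where D: "countable D" "\<And>X. open X \<Longrightarrow> X \<noteq> {} \<Longrightarrow> \<exists>d\<in>D. d \<in> X"
    using countable_dense_setE by blast
  have Dne: "D \<noteq> {}" using D(2)[of UNIV] by auto
  define d where "d = from_nat_into D"
  have d: "range d = D" unfolding d_def using D(1) Dne by (simp add: range_from_nat_into)
  have "\<exists>l. bounded_linear l \<and> l (d i) = norm (d i) \<and> (\<forall>x. l x \<le> norm x)" for i
    using norming_functional[of "d i"] by metis
  then obtain l where l: "\<And>i. bounded_linear (l i)" "\<And>i. l i (d i) = norm (d i)" "\<And>i x. l i x \<le> norm x"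
    by metis
  have norm_le: "norm x \<le> r" if "\<And>i. l i x \<le> r" for x r
  proof (rule field_le_epsilon)
    fix e :: real assume "e > 0"
    then obtain i where i: "dist (d i) x < e / 2"
      using D(2)[of "ball x (e/2)"] d by (auto simp: dist_commute)
    have "norm x \<le> norm (d i) + e / 2" using i by norm
    also have "norm (d i) = l i x + l i (d i - x)"
      using l(2)[of i] linear_simps(1)[OF l(1)] linear_simps(2)[OF l(1)] by simp
    also have "\<dots> \<le> r + e / 2" using that[of i] l(3)[of i "d i - x"] i by (simp add: dist_norm)
    finally show "norm x \<le> r + e" by simp
  qed
  let ?G = "{{x. l i x \<le> r} | i r. True}"
  interpret S: sigma_algebra UNIV "sigma_sets UNIV ?G" by (rule sigma_algebra_sigma_sets) auto
  have cb: "cball c r \<in> sigma_sets UNIV ?G" for c r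
  proof -
    have eq: "cball c r = (\<Inter>i. {x. l i x \<le> r + l i c})"
    proof (intro set_eqI iffI)
      fix x assume "x \<in> cball c r"
      then have "norm (x - c) \<le> r" by (simp add: dist_norm norm_minus_commute)
      then have "l i (x - c) \<le> r" for i using l(3)[of i "x - c"] by linarith
      then show "x \<in> (\<Inter>i. {x. l i x \<le> r + l i c})"
        using linear_simps(2)[OF l(1)] by (auto simp: algebra_simps)
    next
      fix x assume "x \<in> (\<Inter>i. {x. l i x \<le> r + l i c})"
      then have "l i (x - c) \<le> r" for i
        using linear_simps(2)[OF l(1), of i x c] by (auto simp: diff_le_eq)
      then have "norm (x - c) \<le> r" by (rule norm_le)
      then show "x \<in> cball c r" by (simp add: dist_norm norm_minus_commute)
    qed
    have hs: "{x. l i x \<le> r + l i c} \<in> sigma_sets UNIV ?G" for i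
      by (rule sigma_sets.Basic) blast
    have "(\<Inter>i. {x. l i x \<le> r + l i c}) \<in> sigma_sets UNIV ?G"
      by (rule S.countable_INT''[OF S.top _ hs]) simp
    then show ?thesis unfolding eq .
  qed
  have op: "U \<in> sigma_sets UNIV ?G" if "open U" for U
  proof -
    define \<B> where "\<B> = {ball x r | x r. cball x r \<subseteq> U}"
    obtain \<F>' where F: "\<F>' \<subseteq> \<B>" "countable \<F>'" "\<Union>\<F>' = \<Union>\<B>"
      using Lindelof[of \<B>] by (auto simp: \<B>_def)
    have "\<forall>B\<in>\<F>'. \<exists>x r. B = ball x r \<and> cball x r \<subseteq> U" using F(1) by (auto simp: \<B>_def)
    then obtain c r where cr: "\<And>B. B \<in> \<F>' \<Longrightarrow> B = ball (c B) (r B) \<and> cball (c B) (r B) \<subseteq> U" by metis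
    have "U = (\<Union>B\<in>\<F>'. cball (c B) (r B))"
    proof
      show "(\<Union>B\<in>\<F>'. cball (c B) (r B)) \<subseteq> U" using cr by blast
      have "U \<subseteq> \<Union>\<B>"
      proof
        fix x assume "x \<in> U"
        then obtain e where "e > 0" "cball x e \<subseteq> U" using \<open>open U\<close> open_contains_cball by blast
        then have "ball x e \<in> \<B>" "x \<in> ball x e" unfolding \<B>_def by auto
        then show "x \<in> \<Union>\<B>" by (rule UnionI)
      qed
      also have "\<dots> = \<Union>\<F>'" using F by simp
      also have "\<dots> \<subseteq> (\<Union>B\<in>\<F>'. cball (c B) (r B))"
        by (rule Union_least) (use cr ball_subset_cball in \<open>metis (no_types, lifting) UN_upper order.trans\<close>)
      finally show "U \<subseteq> (\<Union>B\<in>\<F>'. cball (c B) (r B))" .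
    qed
    moreover have "(\<Union>B\<in>\<F>'. cball (c B) (r B)) \<in> sigma_sets UNIV ?G"
      using F(2) cb by (rule S.countable_UN'')
    ultimately show ?thesis by simp
  qed
  have "sets (borel :: 'a measure) = sigma_sets UNIV ?G"
  proof
    show "sets (borel :: 'a measure) \<subseteq> sigma_sets UNIV ?G"
      unfolding borel_def using op by (auto intro!: sigma_sets_mono)
    have m: "l i \<in> borel_measurable borel" for i
      by (rule borel_measurable_continuous_onI) (rule linear_continuous_on[OF l(1)])
    have "{x. l i x \<le> r} \<in> sets borel" for i r
      using measurable_sets[OF m[of i], of "{..r}"] by (simp add: vimage_def)
    then show "sigma_sets UNIV ?G \<subseteq> sets (borel :: 'a measure)"
      using sets.sigma_sets_subset[of ?G "borel :: 'a measure"] by (auto simp: space_borel)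
  qed
  then show ?thesis using l(1) that by blast
qed

section \<open>Characteristic functionals\<close>

text \<open>Dividing by the common total mass, which is read off at \<open>t = 0\<close>, reduces
  this to Levy's theorem for probability laws; mass zero is treated apart.\<close>

lemma Levy_uniqueness_finite:
  fixes \<mu> \<nu> :: "real measure"
  assumes fin: "finite_measure \<mu>" "finite_measure \<nu>" and s: "sets \<mu> = sets borel" "sets \<nu> = sets borel"
    and eq: "\<And>t. (CLINT x|\<mu>. iexp (t * x)) = (CLINT x|\<nu>. iexp (t * x))"
  shows "\<mu> = \<nu>"
proof -
  interpret m: finite_measure \<mu> by fact
  interpret n: finite_measure \<nu> by fact
  have sp: "space \<mu> = UNIV" "space \<nu> = UNIV"
    using sets_eq_imp_space_eq[OF s(1)] sets_eq_imp_space_eq[OF s(2)] by simp_all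
  have mass: "measure \<mu> UNIV = measure \<nu> UNIV"
    using eq[of 0] sp by (simp add: lebesgue_integral_const)
  show ?thesis
  proof (cases "measure \<mu> UNIV = 0")
    case True
    have "emeasure \<mu> A = emeasure \<nu> A" for A
    proof -
      have "emeasure \<mu> A \<le> emeasure \<mu> (space \<mu>)" "emeasure \<nu> A \<le> emeasure \<nu> (space \<nu>)"
        by (rule emeasure_space)+
      then show ?thesis using True mass sp
        by (simp add: m.emeasure_eq_measure n.emeasure_eq_measure measure_le_0_iff)
    qed
    then show ?thesis using s by (intro measure_eqI) auto
  next
    case False
    define c where "c = measure \<mu> UNIV"
    have c: "c > 0" using False by (simp add: c_def zero_less_measure_iff)
    have emu: "emeasure \<mu> UNIV = ennreal c" "emeasure \<nu> UNIV = ennreal c"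
      using mass by (simp_all add: m.emeasure_eq_measure n.emeasure_eq_measure c_def)
    have cc: "ennreal (1 / c) * ennreal c = 1" using c by (simp flip: ennreal_mult)
    have rd: "real_distribution (density \<rho> (\<lambda>_. ennreal (1/c)))"
      if "sets \<rho> = sets borel" "emeasure \<rho> UNIV = ennreal c" "space \<rho> = UNIV" for \<rho> :: "real measure"
    proof -
      have "emeasure (density \<rho> (\<lambda>_. ennreal (1/c))) (space \<rho>) = ennreal (1/c) * emeasure \<rho> (space \<rho>)"
        by (rule emeasure_density_const) simp
      then have "prob_space (density \<rho> (\<lambda>_. ennreal (1/c)))"
        using that(2,3) cc by (intro prob_spaceI) simp
      then show ?thesis using that(1,3)
        by (simp add: real_distribution_def real_distribution_axioms_def)
    qed
    have ch: "char (density \<rho> (\<lambda>_. ennreal (1/c))) t = (1/c) *\<^sub>R (CLINT x|\<rho>. iexp (t * x))"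
      if "sets \<rho> = sets borel" for \<rho> :: "real measure" and t
    proof -
      have "(\<lambda>x. iexp (t * x)) \<in> borel_measurable \<rho>"
        using that by (subst measurable_cong_sets[OF that refl]) measurable
      then show ?thesis
      using that c unfolding char_def
      by (subst integral_density) auto
    qed
    have "density \<mu> (\<lambda>_. ennreal (1/c)) = density \<nu> (\<lambda>_. ennreal (1/c))"
    proof (intro Levy_uniqueness ext)
      fix t
      show "char (density \<mu> (\<lambda>_. ennreal (1/c))) t = char (density \<nu> (\<lambda>_. ennreal (1/c))) t"
        unfolding ch[OF s(1)] ch[OF s(2)] eq ..
    qed (fact rd[OF s(1) emu(1) sp(1)] rd[OF s(2) emu(2) sp(2)])+
    then have 1: "ennreal (1/c) * emeasure \<mu> A = ennreal (1/c) * emeasure \<nu> A" if "A \<in> sets borel" for A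

      using s that emeasure_density_const[of A \<mu> "ennreal (1/c)"] emeasure_density_const[of A \<nu> "ennreal (1/c)"] by simp
    have "emeasure \<mu> A = emeasure \<nu> A" if "A \<in> sets borel" for A
    proof -
      have "ennreal c * (ennreal (1/c) * emeasure \<mu> A) = ennreal c * (ennreal (1/c) * emeasure \<nu> A)"
        using 1[OF that] by simp
      then show ?thesis using cc by (simp add: mult.assoc[symmetric] mult.commute[of "ennreal c"])
    qed
    then show ?thesis using s by (intro measure_eqI) auto
  qed
qed

lemma bounded_linear_measurable:
  fixes T :: "'a::real_normed_vector \<Rightarrow> 'b::real_normed_vector"
  assumes "bounded_linear T"
  shows "T \<in> borel_measurable borel"
  by (rule borel_measurable_continuous_onI) (rule linear_continuous_on[OF assms])

text \<open>The inductive step towards uniqueness: the indicator of an event in \<open>l' x\<close>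
  can be inserted under the integral while equality persists for all functionals. For fixed
  \<open>l\<close>, nonnegative weights built from \<open>cos (l x)\<close> and
  \<open>sin (l x)\<close> give finite measures on the line after projection by \<open>l'\<close>.
  Their characteristic functions agree, hence so do the measures, and the complex weight is
  recombined from them.\<close>

lemma integral_indicator_functional_eq:
  fixes M N :: "'a::{banach, second_countable_topology} measure"
  assumes "prob_space M" "prob_space N" and s: "sets M = sets borel" "sets N = sets borel"
    and w: "w \<in> borel_measurable borel" "\<And>x. 0 \<le> w x" "\<And>x. w x \<le> (1::real)"
    and eq: "\<And>l. bounded_linear l \<Longrightarrow> (CLINT x|M. w x *\<^sub>R iexp (l x)) = (CLINT x|N. w x *\<^sub>R iexp (l x))"
    and l: "bounded_linear l" and l': "bounded_linear (l' :: 'a \<Rightarrow> real)" and B: "B \<in> sets borel"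
  shows "(CLINT x|M. (indicator B (l' x) * w x) *\<^sub>R iexp (l x)) = (CLINT x|N. (indicator B (l' x) * w x) *\<^sub>R iexp (l x))"
proof -
  interpret M: prob_space M by fact
  interpret N: prob_space N by fact
  note [measurable] = w(1) B bounded_linear_measurable[OF l] bounded_linear_measurable[OF l']
  have push: "finite_measure (distr (density K v) borel l') \<and>
     (\<forall>\<phi> \<in> borel_measurable borel. (CLINT y|distr (density K v) borel l'. \<phi> y) = (CLINT x|K. v x *\<^sub>R (\<phi> (l' x) :: complex)))"
    if K: "prob_space K" "sets K = sets borel" and v: "v \<in> borel_measurable borel" "\<And>x. 0 \<le> v x" "\<And>x. v x \<le> (2::real)"
    for K :: "'a measure" and v
  proof -
    interpret K: prob_space K by fact
    have [measurable]: "v \<in> borel_measurable K"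
      using v(1) by (simp add: measurable_cong_sets[OF K(2) refl])
    have [measurable]: "l' \<in> borel_measurable K"
      using bounded_linear_measurable[OF l'] unfolding measurable_cong_sets[OF K(2) refl] .
    have "emeasure (distr (density K v) borel l') UNIV = (\<integral>\<^sup>+ x. ennreal (v x) \<partial>K)"
      by (auto simp: emeasure_distr emeasure_density intro!: nn_integral_cong)
    also have "\<dots> \<le> (\<integral>\<^sup>+ x. 2 \<partial>K)" using ennreal_leI[OF v(3)] by (intro nn_integral_mono) simp
    also have "\<dots> < \<infinity>" by (simp add: K.emeasure_space_1)
    finally have "finite_measure (distr (density K v) borel l')" by (intro finite_measureI) auto
    moreover have "(CLINT y|distr (density K v) borel l'. \<phi> y) = (CLINT x|K. v x *\<^sub>R (\<phi> (l' x) :: complex))"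
      if [measurable]: "\<phi> \<in> borel_measurable borel" for \<phi>
      using v(2) by (subst integral_distr; simp?) (subst integral_density; simp)
    ultimately show ?thesis by blast
  qed
  have bd: "integrable K (\<lambda>x. w x *\<^sub>R iexp (a x))"
    if K: "prob_space K" "sets K = sets borel" and a: "a \<in> borel_measurable borel" for K and a :: "'a \<Rightarrow> real"
  proof -
    interpret K: prob_space K by fact
    have "(\<lambda>x. w x *\<^sub>R iexp (a x)) \<in> borel_measurable borel"
      using w(1) a by measurable
    then show ?thesis
      using w(2,3) measurable_cong_sets[OF K(2) refl]
      by (intro K.integrable_const_bound[where B = 1]) auto
  qed
  have lc: "bounded_linear (\<lambda>x. t * l' x + c * l x)" for t c
    using l l' by (intro bounded_linear_add bounded_linear_const_mult)
  have key: "(CLINT x|M. v x *\<^sub>R \<phi> (l' x)) = (CLINT x|N. v x *\<^sub>R (\<phi> (l' x) :: complex))"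
    if v: "v \<in> borel_measurable borel" "\<And>x. 0 \<le> v x" "\<And>x. v x \<le> (2::real)"
    and e: "\<And>t. (CLINT x|M. v x *\<^sub>R iexp (t * l' x)) = (CLINT x|N. v x *\<^sub>R iexp (t * l' x))"
    and p: "\<phi> \<in> borel_measurable borel" for v \<phi>
  proof -
    have "distr (density M v) borel l' = distr (density N v) borel l'"
    proof (rule Levy_uniqueness_finite)
      fix t
      have "(\<lambda>y. iexp (t * y)) \<in> borel_measurable borel" by measurable
      then show "(CLINT y|distr (density M v) borel l'. iexp (t * y)) = (CLINT y|distr (density N v) borel l'. iexp (t * y))"
        using push[OF assms(1) s(1) v] push[OF assms(2) s(2) v] e[of t] by simp
    qed (use push[OF assms(1) s(1) v] push[OF assms(2) s(2) v] in auto)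
    then show ?thesis
      using push[OF assms(1) s(1) v] push[OF assms(2) s(2) v] p by metis
  qed
  have I: "integrable M (\<lambda>x. w x *\<^sub>R iexp (t * l' x + c * l x))" "integrable N (\<lambda>x. w x *\<^sub>R iexp (t * l' x + c * l x))" for t c
    using bd[OF assms(1) s(1)] bd[OF assms(2) s(2)] bounded_linear_measurable[OF lc] by blast+
  have E: "(CLINT x|M. w x *\<^sub>R iexp (t * l' x + c * l x)) = (CLINT x|N. w x *\<^sub>R iexp (t * l' x + c * l x))" for t c
    by (rule eq[OF lc])
  \<comment> \<open>Adding 1 makes the trigonometric weights nonnegative, as densities of measures
    must be; the price is the bound 2 instead of 1. Euler's formulas express both weights through
    characters, to which the hypothesis applies.\<close>
  define a where "a = (\<lambda>x. w x * (1 + cos (l x)))"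
  define b where "b = (\<lambda>x. w x * (1 + sin (l x)))"
  have a: "a \<in> borel_measurable borel" "\<And>x. 0 \<le> a x" "\<And>x. a x \<le> 2"
  proof -
    show "a \<in> borel_measurable borel" unfolding a_def by measurable
    show "0 \<le> a x" for x using w(2)[of x] cos_ge_minus_one[of "l x"] unfolding a_def by (intro mult_nonneg_nonneg) linarith+
    show "a x \<le> 2" for x using mult_mono[OF w(3)[of x], of "1 + cos (l x)" 2] cos_le_one[of "l x"] cos_ge_minus_one[of "l x"]
      unfolding a_def by simp
  qed
  have b: "b \<in> borel_measurable borel" "\<And>x. 0 \<le> b x" "\<And>x. b x \<le> 2"
  proof -
    show "b \<in> borel_measurable borel" unfolding b_def by measurable
    show "0 \<le> b x" for x using w(2)[of x] sin_ge_minus_one[of "l x"] unfolding b_def by (intro mult_nonneg_nonneg) linarith+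
    show "b x \<le> 2" for x using mult_mono[OF w(3)[of x], of "1 + sin (l x)" 2] sin_le_one[of "l x"] sin_ge_minus_one[of "l x"]
      unfolding b_def by simp
  qed
  have ax: "a x *\<^sub>R iexp (t * l' x) = w x *\<^sub>R iexp (t * l' x + 0 * l x) +
      ((1/2) *\<^sub>R (w x *\<^sub>R iexp (t * l' x + 1 * l x)) + (1/2) *\<^sub>R (w x *\<^sub>R iexp (t * l' x + (-1) * l x)))" for x t
    by (simp add: a_def complex_eq_iff cis_conv_exp[symmetric] Re_exp Im_exp cos_add sin_add cos_diff sin_diff algebra_simps)
  have bx: "b x *\<^sub>R iexp (t * l' x) = w x *\<^sub>R iexp (t * l' x + 0 * l x) +
      (- \<i>/2) * ((w x *\<^sub>R iexp (t * l' x + 1 * l x)) - (w x *\<^sub>R iexp (t * l' x + (-1) * l x)))" for x t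
    by (simp add: b_def complex_eq_iff cis_conv_exp[symmetric] Re_exp Im_exp cos_add sin_add cos_diff sin_diff algebra_simps) (simp add: field_simps)
  define \<phi> :: "real \<Rightarrow> complex" where "\<phi> = (\<lambda>y. of_real (indicator B y))"
  have \<phi>: "\<phi> \<in> borel_measurable borel" unfolding \<phi>_def by measurable
  have lin1: "(CLINT x|K. W x + ((1/2) *\<^sub>R X x + (1/2) *\<^sub>R Y x)) = (CLINT x|K. W x) + ((1/2) *\<^sub>R (CLINT x|K. X x) + (1/2) *\<^sub>R (CLINT x|K. Y x))"
    if "integrable K W" "integrable K X" "integrable K Y" for K :: "'a measure" and W X Y :: "'a \<Rightarrow> complex"
    using that by simp
  have lin2: "(CLINT x|K. W x + c * (X x - Y x)) = (CLINT x|K. W x) + c * ((CLINT x|K. X x) - (CLINT x|K. Y x))"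
    if "integrable K W" "integrable K X" "integrable K Y" for K :: "'a measure" and W X Y :: "'a \<Rightarrow> complex" and c
    using that by simp
  have ea: "(CLINT x|M. a x *\<^sub>R \<phi> (l' x)) = (CLINT x|N. a x *\<^sub>R \<phi> (l' x))"
    by (rule key[OF a _ \<phi>]) (simp only: ax lin1[OF I(1) I(1) I(1)] lin1[OF I(2) I(2) I(2)] E)
  have eb: "(CLINT x|M. b x *\<^sub>R \<phi> (l' x)) = (CLINT x|N. b x *\<^sub>R \<phi> (l' x))"
    by (rule key[OF b _ \<phi>]) (simp only: bx lin2[OF I(1) I(1) I(1)] lin2[OF I(2) I(2) I(2)] E)
  have w2: "\<And>x. w x \<le> 2" by (rule order.trans[OF w(3) one_le_numeral])
  have ew: "(CLINT x|M. w x *\<^sub>R \<phi> (l' x)) = (CLINT x|N. w x *\<^sub>R \<phi> (l' x))"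
    using E[of _ 0] by (intro key[OF w(1,2) w2 _ \<phi>]) simp
  have J: "integrable K (\<lambda>x. v x *\<^sub>R \<phi> (l' x))"
    if K: "prob_space K" "sets K = sets borel" and v: "v \<in> borel_measurable borel" "\<And>x. 0 \<le> v x" "\<And>x. v x \<le> (2::real)" for K v
  proof -
    interpret K: prob_space K by fact
    have "(\<lambda>x. v x *\<^sub>R \<phi> (l' x)) \<in> borel_measurable borel"
      using v(1) \<phi> by measurable
    then show ?thesis
      using v(2,3) measurable_cong_sets[OF K(2) refl]
      by (intro K.integrable_const_bound[where B = 2]) (auto simp: \<phi>_def indicator_def intro!: AE_I2 intro: order.trans[of _ "1::real" 2])
  qed
  have lin3: "(CLINT x|K. (X x - W x) + \<i> * (Y x - W x)) = ((CLINT x|K. X x) - (CLINT x|K. W x)) + \<i> * ((CLINT x|K. Y x) - (CLINT x|K. W x))"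
    if "integrable K X" "integrable K Y" "integrable K W" for K :: "'a measure" and W X Y :: "'a \<Rightarrow> complex"
    using that by simp
  \<comment> \<open>Subtracting \<open>w\<close> undoes the two additions of 1, and the imaginary
    unit reassembles the exponential.\<close>
  have dec: "(indicator B (l' x) * w x) *\<^sub>R iexp (l x) =
     (a x *\<^sub>R \<phi> (l' x) - w x *\<^sub>R \<phi> (l' x)) + \<i> * (b x *\<^sub>R \<phi> (l' x) - w x *\<^sub>R \<phi> (l' x))" for x
    by (simp add: a_def b_def \<phi>_def complex_eq_iff Re_exp Im_exp algebra_simps)
  show ?thesis
    unfolding dec
    using lin3[OF J[OF assms(1) s(1) a] J[OF assms(1) s(1) b] J[OF assms(1) s(1) w(1,2) w2]]
      lin3[OF J[OF assms(2) s(2) a] J[OF assms(2) s(2) b] J[OF assms(2) s(2) w(1,2) w2]]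
    by (simp only: ea eb ew)
qed

text \<open>Half-space indicators are inserted one after the other. Finite intersections of the
  generating half-spaces are stable under intersection, and the zero functional turns the resulting
  identities into equality of the measures on this generator.\<close>

theorem measure_eqI_characteristic_functional:
  fixes M N :: "'a::{banach, second_countable_topology} measure"
  assumes M: "prob_space M" "sets M = sets borel" and N: "prob_space N" "sets N = sets borel"
    and eq: "\<And>l. bounded_linear l \<Longrightarrow> (CLINT x|M. iexp (l x)) = (CLINT x|N. iexp (l x))"
  shows "M = N"
proof -
  interpret M: prob_space M by fact
  interpret N: prob_space N by fact
  obtain L :: "nat \<Rightarrow> 'a \<Rightarrow> real" where L: "\<And>i. bounded_linear (L i)"
    and gen: "sets (borel :: 'a measure) = sigma_sets UNIV {{x. L i x \<le> r} | i r. True}"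
    using functionals_generate_borel[where 'a = 'a] by blast
  note [measurable] = bounded_linear_measurable[OF L]
  define \<E> where "\<E> = {{x. \<forall>(i, r) \<in> S. L i x \<le> r} | S. finite S}"
  have E_borel: "\<E> \<subseteq> sets borel"
  proof
    fix X assume "X \<in> \<E>"
    then obtain S where S: "finite S" "X = {x. \<forall>(i, r) \<in> S. L i x \<le> r}" by (auto simp: \<E>_def)
    have "X = space borel \<inter> (\<Inter>p\<in>S. {x \<in> space borel. L (fst p) x \<le> snd p})" unfolding S(2) by (auto simp: split_beta)
    also have "\<dots> \<in> sets borel"
      using S(1) by (cases "S = {}") auto
    finally show "X \<in> sets borel" .
  qed
  have ind: "(CLINT x|M. indicator {x. \<forall>(i, r) \<in> S. L i x \<le> r} x *\<^sub>R iexp (l x)) =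
             (CLINT x|N. indicator {x. \<forall>(i, r) \<in> S. L i x \<le> r} x *\<^sub>R iexp (l x))"
    if "finite S" "bounded_linear l" for S l
    using that
  proof (induction S arbitrary: l rule: finite_induct)
    case empty then show ?case using eq by simp
  next
    case (insert p S)
    let ?w = "indicator {x. \<forall>(i, r) \<in> S. L i x \<le> r} :: 'a \<Rightarrow> real"
    have "{x. \<forall>(i, r) \<in> S. L i x \<le> r} \<in> sets borel" using E_borel insert(1) by (auto simp: \<E>_def)
    then have m: "?w \<in> borel_measurable borel" by simp
    have i: "indicator {x. \<forall>(i, r) \<in> insert p S. L i x \<le> r} x = (indicator {.. snd p} (L (fst p) x) * ?w x :: real)" for x
      by (auto simp: indicator_def split: prod.splits)
    show ?case unfolding i
      by (rule integral_indicator_functional_eq[OF M(1) N(1) M(2) N(2) m _ _ insert.IH insert.prems L])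
         (auto simp: indicator_def)
  qed
  show ?thesis
  proof (rule measure_eqI_generator_eq[where E = \<E> and \<Omega> = UNIV and A = "\<lambda>_. UNIV"])
    show "Int_stable \<E>"
    proof (rule Int_stableI)
      fix A B assume "A \<in> \<E>" "B \<in> \<E>"
      then obtain S T where "finite S" "finite T" "A = {x. \<forall>(i, r) \<in> S. L i x \<le> r}" "B = {x. \<forall>(i, r) \<in> T. L i x \<le> r}"
        by (auto simp: \<E>_def)
      then have "A \<inter> B = {x. \<forall>(i, r) \<in> S \<union> T. L i x \<le> r}" "finite (S \<union> T)" by auto
      then show "A \<inter> B \<in> \<E>" unfolding \<E>_def by blast
    qed
    show "emeasure M X = emeasure N X" if XE: "X \<in> \<E>" for X
    proof -
      obtain S where S: "finite S" "X = {x. \<forall>(i, r) \<in> S. L i x \<le> r}" using XE unfolding \<E>_def by blast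
      have X: "X \<in> sets M" "X \<in> sets N" using XE E_borel M N by auto
      have "(CLINT x|M. indicator X x *\<^sub>R (1::complex)) = (CLINT x|N. indicator X x *\<^sub>R 1)"
        using ind[OF S(1) bounded_linear_zero] unfolding S(2) by simp
      then have "measure M X = measure N X"
        using X sets_eq_imp_space_eq[OF M(2)] sets_eq_imp_space_eq[OF N(2)] by (simp add: scaleR_conv_of_real)
      then show ?thesis by (simp add: M.emeasure_eq_measure N.emeasure_eq_measure)
    qed
    have sub: "{{x. L i x \<le> r} | i r. True} \<subseteq> \<E>"
    proof clarify
      fix i r
      have "{x. L i x \<le> r} = {x. \<forall>(i, r) \<in> {(i, r)}. L i x \<le> r}" "finite {(i, r)}" by auto
      then show "{x. L i x \<le> r} \<in> \<E>" unfolding \<E>_def by blast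
    qed
    have "sets (borel :: 'a measure) = sigma_sets UNIV \<E>"
    proof
      show "sets (borel :: 'a measure) \<subseteq> sigma_sets UNIV \<E>"
        unfolding gen by (rule sigma_sets_mono') (rule sub)
      show "sigma_sets UNIV \<E> \<subseteq> sets (borel :: 'a measure)"
        using sets.sigma_sets_subset[OF E_borel] by (simp add: space_borel)
    qed
    then show "sets M = sigma_sets UNIV \<E>" "sets N = sigma_sets UNIV \<E>" using M N by auto
    show "range (\<lambda>_. UNIV) \<subseteq> \<E>" unfolding \<E>_def by (auto intro!: exI[of _ "{}"])
  qed (auto simp: M.emeasure_finite)
qed

section \<open>Gaussian measures\<close>

text \<open>Encoded by the characteristic functional with the variance written as an integral:
  degenerate functionals need no separate clause, and stability under linear images is mere
  substitution.\<close>

locale gaussian_measure = prob_space M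
  for M :: "'a::{banach, second_countable_topology} measure" +
  assumes sets_M [simp, measurable_cong]: "sets M = sets borel"
    and square_integrable: "bounded_linear l \<Longrightarrow> integrable M (\<lambda>x. (l x)\<^sup>2)"
    and char_functional: "bounded_linear l \<Longrightarrow>
      (CLINT x|M. iexp (l x)) = of_real (exp (- (\<integral>x. (l x)\<^sup>2 \<partial>M) / 2))"
begin

lemma space_M [simp]: "space M = UNIV"
  using sets_eq_imp_space_eq[OF sets_M] by simp

lemma measurable_M [simp]: "measurable M N = measurable borel N"
  by (rule measurable_cong_sets) simp_all

end

lemma prob_space_std_normal: "prob_space std_normal_distribution"
  using real_dist_normal_dist by (simp add: real_distribution_def)

lemma std_normal_scale_eq_density:
  assumes "\<sigma> > 0"
  shows "density lborel (\<lambda>x. ennreal (normal_density 0 \<sigma> x)) = distr std_normal_distribution borel (\<lambda>t. \<sigma> * t)"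
proof -
  interpret prob_space std_normal_distribution by (rule prob_space_std_normal)
  have "distributed std_normal_distribution lborel (\<lambda>x. x) std_normal_density"
    unfolding distributed_def by (auto simp: distr_id2)
  from normal_density_affine[OF this, of \<sigma> 0] assms
  have "distributed std_normal_distribution lborel (\<lambda>x. \<sigma> * x) (normal_density 0 \<sigma>)" by simp
  from distributed_distr_eq_density[OF this] show ?thesis
    by (metis (no_types, lifting) distr_cong sets_lborel)
qed

lemma std_normal_second_moment:
  "integrable std_normal_distribution (\<lambda>t. (\<sigma> * t)\<^sup>2)" "(\<integral>t. (\<sigma> * t)\<^sup>2 \<partial>std_normal_distribution) = \<sigma>\<^sup>2"
  using integrable_std_normal_distribution_moment[of 2] std_normal_distribution_even_moments[of 1]
  by (simp_all add: power_mult_distrib)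

lemma gaussian_measureI_centered:
  assumes "centered_gaussian_measure M"
  shows "gaussian_measure M"
proof -
  have M: "prob_space M" "sets M = sets borel"
    and law: "\<And>l :: 'a \<Rightarrow> real. bounded_linear l \<Longrightarrow> centered_gaussian_law (distr M borel l)"
    using assms by (auto simp: centered_gaussian_measure_def)
  interpret prob_space M by fact
  have *: "integrable M (\<lambda>x. (l x)\<^sup>2) \<and> (CLINT x|M. iexp (l x)) = of_real (exp (- (\<integral>x. (l x)\<^sup>2 \<partial>M) / 2))"
    if l: "bounded_linear l" for l
  proof -
    have [measurable]: "l \<in> borel_measurable M"
      using bounded_linear_measurable[OF l] measurable_cong_sets[OF M(2) refl] by auto
    have sq: "integrable M (\<lambda>x. (l x)\<^sup>2) \<longleftrightarrow> integrable (distr M borel l) (\<lambda>t. t\<^sup>2)"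
      "(\<integral>x. (l x)\<^sup>2 \<partial>M) = (\<integral>t. t\<^sup>2 \<partial>distr M borel l)"
      "(CLINT x|M. iexp (l x)) = (CLINT t|distr M borel l. iexp t)"
      by (simp_all add: integrable_distr_eq integral_distr)
    have "\<exists>\<sigma>\<ge>0. distr M borel l = distr std_normal_distribution borel (\<lambda>t. \<sigma> * t)"
    proof -
      have "return borel 0 = distr std_normal_distribution borel (\<lambda>t. 0 * t :: real)"
        using prob_space.distr_const[OF prob_space_std_normal, of "0::real" borel] by simp
      then show ?thesis
        using law[OF l] std_normal_scale_eq_density
        unfolding centered_gaussian_law_def by (metis less_imp_le order_refl)
    qed
    then obtain \<sigma> where \<sigma>: "distr M borel l = distr std_normal_distribution borel (\<lambda>t. \<sigma> * t)" by blast
    have "(CLINT t|std_normal_distribution. iexp (\<sigma> * t)) = exp (- \<sigma>\<^sup>2 / 2)"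
      using char_std_normal_distribution unfolding char_def by (metis)
    then show ?thesis unfolding sq unfolding \<sigma>
      using std_normal_second_moment[of \<sigma>]
      by (simp add: integrable_distr_eq integral_distr power_mult_distrib)
  qed
  show ?thesis
    using M * by (simp add: gaussian_measure_def gaussian_measure_axioms_def)
qed

context gaussian_measure
begin

text \<open>Characteristic functions are compared on the line, where every bounded functional is
  multiplication by a constant \<open>c\<close>; the functional \<open>c * l x\<close> supplies all
  their values.\<close>

lemma law_functional:
  assumes l: "bounded_linear l"
  shows "distr M borel l = distr std_normal_distribution borel (\<lambda>t. sqrt (\<integral>x. (l x)\<^sup>2 \<partial>M) * t)"
proof (rule measure_eqI_characteristic_functional)
  note [measurable] = bounded_linear_measurable[OF l]
  let ?\<sigma> = "sqrt (\<integral>x. (l x)\<^sup>2 \<partial>M)"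
  show "prob_space (distr M borel l)" by (rule prob_space_distr) simp
  show "prob_space (distr std_normal_distribution borel (\<lambda>t. ?\<sigma> * t))"
    by (rule prob_space.prob_space_distr[OF prob_space_std_normal]) simp
  fix a :: "real \<Rightarrow> real" assume a: "bounded_linear a"
  note [measurable] = bounded_linear_measurable[OF a]
  have "a x = a 1 * x" for x using linear_simps(5)[OF a, of x 1] by (simp add: mult.commute)
  then obtain c where c: "a = (\<lambda>x. c * x)" by blast
  have "(CLINT x|distr M borel l. iexp (a x)) = (CLINT x|M. iexp (c * l x))"
    by (subst integral_distr) (auto simp: c)
  also have "\<dots> = of_real (exp (- (\<integral>x. (c * l x)\<^sup>2 \<partial>M) / 2))"
    using l by (intro char_functional bounded_linear_const_mult)
  also have "(\<integral>x. (c * l x)\<^sup>2 \<partial>M) = (c * ?\<sigma>)\<^sup>2"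
    by (simp add: power_mult_distrib)
  also have "of_real (exp (- (c * ?\<sigma>)\<^sup>2 / 2)) = (CLINT t|std_normal_distribution. iexp ((c * ?\<sigma>) * t))"
    using char_std_normal_distribution unfolding char_def by (metis)
  also have "\<dots> = (CLINT x|distr std_normal_distribution borel (\<lambda>t. ?\<sigma> * t). iexp (a x))"
    by (subst integral_distr) (auto simp: c mult.assoc)
  finally show "(CLINT x|distr M borel l. iexp (a x)) = (CLINT x|distr std_normal_distribution borel (\<lambda>t. ?\<sigma> * t). iexp (a x))" .
qed auto

lemma integrable_functional: "bounded_linear (l :: 'a \<Rightarrow> real) \<Longrightarrow> integrable M l"
  by (rule square_integrable_imp_integrable[OF _ square_integrable]) (simp_all add: bounded_linear_measurable)

lemma integral_functional:
  assumes l: "bounded_linear (l :: 'a \<Rightarrow> real)"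
  shows "(\<integral>x. l x \<partial>M) = 0"
proof -
  note [measurable] = bounded_linear_measurable[OF l]
  have "(\<integral>x. l x \<partial>M) = (\<integral>t. t \<partial>distr M borel l)" by (subst integral_distr) auto
  also have "\<dots> = 0" unfolding law_functional[OF l]
    using integral_std_normal_distribution_moment_odd[of 1] by (subst integral_distr) auto
  finally show ?thesis .
qed

lemma integrable_functional_mult:
  assumes a: "bounded_linear (a :: 'a \<Rightarrow> real)" and b: "bounded_linear (b :: 'a \<Rightarrow> real)"
  shows "integrable M (\<lambda>x. a x * b x :: real)"
proof (rule Bochner_Integration.integrable_bound)
  show "integrable M (\<lambda>x. (a x)\<^sup>2 + (b x)\<^sup>2)" using a b by (intro Bochner_Integration.integrable_add square_integrable)
  show "(\<lambda>x. a x * b x) \<in> borel_measurable M"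
    using bounded_linear_measurable[OF a] bounded_linear_measurable[OF b] by simp
  have "\<bar>u * v\<bar> \<le> u\<^sup>2 + v\<^sup>2" for u v :: real
  proof -
    have "2 * (\<bar>u\<bar> * \<bar>v\<bar>) \<le> u\<^sup>2 + v\<^sup>2"
      using sum_squares_bound[of "\<bar>u\<bar>" "\<bar>v\<bar>"] by (simp add: mult.assoc)
    moreover have "0 \<le> \<bar>u\<bar> * \<bar>v\<bar>" by simp
    ultimately show ?thesis unfolding abs_mult by linarith
  qed
  then show "AE x in M. norm (a x * b x) \<le> norm ((a x)\<^sup>2 + (b x)\<^sup>2)"
    by (intro AE_I2) (metis abs_ge_self order.trans real_norm_def)
qed

lemma variance_sum:
  assumes a: "bounded_linear (a :: 'a \<Rightarrow> real)" and b: "bounded_linear (b :: 'a \<Rightarrow> real)"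
  shows "(\<integral>x. (a x + b x)\<^sup>2 \<partial>M) = (\<integral>x. (a x)\<^sup>2 \<partial>M) + (\<integral>x. (b x)\<^sup>2 \<partial>M) + 2 * (\<integral>x. a x * b x \<partial>M)"
  using square_integrable[OF a] square_integrable[OF b] integrable_functional_mult[OF a b]
  by (simp add: power2_sum mult.assoc)

lemma functional_eq_0_AE:
  assumes l: "bounded_linear (l :: 'a \<Rightarrow> real)" and "(\<integral>x. (l x)\<^sup>2 \<partial>M) = 0"
  shows "AE x in M. l x = 0"
  using integral_nonneg_eq_0_iff_AE[OF square_integrable[OF l]] assms(2) by simp

lemma gaussian_distr:
  fixes T :: "'a \<Rightarrow> 'b::{banach, second_countable_topology}"
  assumes T: "bounded_linear T"
  shows "gaussian_measure (distr M borel T)"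
proof -
  note [measurable] = bounded_linear_measurable[OF T]
  have "prob_space (distr M borel T)" by (rule prob_space_distr) simp
  moreover have "integrable (distr M borel T) (\<lambda>x. (l x)\<^sup>2) \<and>
     (CLINT x|distr M borel T. iexp (l x)) = of_real (exp (- (\<integral>x. (l x)\<^sup>2 \<partial>distr M borel T) / 2))"
    if l: "bounded_linear l" for l
  proof -
    note [measurable] = bounded_linear_measurable[OF l]
    show ?thesis
      using square_integrable[OF bounded_linear_compose[OF l T]] char_functional[OF bounded_linear_compose[OF l T]]
      by (simp add: integrable_distr_eq integral_distr)
  qed
  ultimately show ?thesis by (simp add: gaussian_measure_def gaussian_measure_axioms_def)
qed

lemma distr_uminus: "distr M borel uminus = M"
proof (rule measure_eqI_characteristic_functional)
  show "prob_space (distr M borel uminus)" by (rule prob_space_distr) simp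
  show "prob_space M" by unfold_locales
  fix l :: "'a \<Rightarrow> real" assume l: "bounded_linear l"
  note [measurable] = bounded_linear_measurable[OF l]
  show "(CLINT x|distr M borel uminus. iexp (l x)) = (CLINT x|M. iexp (l x))"
    using char_functional[OF bounded_linear_minus[OF l]] char_functional[OF l] linear_simps(4)[OF l]
    by (simp add: integral_distr)
qed auto

end

lemma bounded_linear_prod_split:
  assumes l: "bounded_linear (l :: 'a::real_normed_vector \<times> 'b::real_normed_vector \<Rightarrow> 'c::real_normed_vector)"
  obtains a b where "bounded_linear a" "bounded_linear b" "\<And>x y. l (x, y) = a x + b y"
proof
  show "bounded_linear (\<lambda>x. l (x, 0))" "bounded_linear (\<lambda>y. l (0, y))"
    by (rule bounded_linear_compose[OF l] bounded_linear_Pair bounded_linear_ident bounded_linear_zero)+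
  show "l (x, y) = l (x, 0) + l (0, y)" for x y
    using linear_simps(1)[OF l, of "(x, 0)" "(0, y)"] by simp
qed

locale gaussian_pair = M: gaussian_measure M + N: gaussian_measure N
  for M :: "'a::{banach, second_countable_topology} measure"
    and N :: "'b::{banach, second_countable_topology} measure"
begin

sublocale pair_prob_space M N ..

lemma sets_pair: "sets (M \<Otimes>\<^sub>M N) = sets borel"
  using sets_pair_measure_cong[OF M.sets_M N.sets_M] unfolding borel_prod .

lemma char_functional_pair:
  assumes a: "bounded_linear (a :: 'a \<Rightarrow> real)" and b: "bounded_linear (b :: 'b \<Rightarrow> real)"
  shows "(CLINT z|M \<Otimes>\<^sub>M N. iexp (a (fst z) + b (snd z))) = of_real (exp (- ((\<integral>x. (a x)\<^sup>2 \<partial>M) + (\<integral>x. (b x)\<^sup>2 \<partial>N)) / 2))"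
proof -
  note [measurable] = bounded_linear_measurable[OF a] bounded_linear_measurable[OF b]
  have "integrable (M \<Otimes>\<^sub>M N) (\<lambda>(x, y). iexp (a x) * iexp (b y))"
    by (rule P.integrable_const_bound[where B = 1]) (auto simp: norm_mult split_beta)
  from integral_fst[OF this]
  have "(CLINT z|M \<Otimes>\<^sub>M N. iexp (a (fst z)) * iexp (b (snd z))) = (CLINT x|M. CLINT y|N. iexp (a x) * iexp (b y))"
    by (simp add: case_prod_unfold)
  also have "\<dots> = (CLINT x|M. iexp (a x)) * (CLINT y|N. iexp (b y))" by simp
  also have "\<dots> = of_real (exp (- ((\<integral>x. (a x)\<^sup>2 \<partial>M) + (\<integral>x. (b x)\<^sup>2 \<partial>N)) / 2))"
    unfolding M.char_functional[OF a] N.char_functional[OF b]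
    by (simp flip: exp_add exp_of_real add: add_divide_distrib diff_divide_distrib)
  finally show ?thesis by (simp add: exp_add distrib_left)
qed

end

section \<open>Rotation invariance, and independence of uncorrelated images\<close>

context gaussian_measure
begin

text \<open>After the rotation the two samples are tested by the functionals \<open>?c\<close> and
  \<open>?d\<close>. In the sum of their variances the mixed terms of \<open>a\<close> and
  \<open>b\<close> have opposite signs and cancel.\<close>

lemma distr_rotation:
  "distr (M \<Otimes>\<^sub>M M) borel (\<lambda>(x, y). ((x + y) /\<^sub>R sqrt 2, (x - y) /\<^sub>R sqrt 2)) = M \<Otimes>\<^sub>M M"
proof -
  interpret gaussian_pair M M ..
  have m [measurable]: "(\<lambda>(x, y). ((x + y) /\<^sub>R sqrt 2, (x - y) /\<^sub>R sqrt 2)) \<in> borel_measurable (M \<Otimes>\<^sub>M M)"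
    unfolding split_beta by measurable
  show ?thesis
  proof (rule measure_eqI_characteristic_functional)
    show "prob_space (distr (M \<Otimes>\<^sub>M M) borel (\<lambda>(x, y). ((x + y) /\<^sub>R sqrt 2, (x - y) /\<^sub>R sqrt 2)))"
      by (rule P.prob_space_distr) (rule m)
    show "prob_space (M \<Otimes>\<^sub>M M)" by unfold_locales
    fix l :: "'a \<times> 'a \<Rightarrow> real" assume l: "bounded_linear l"
    obtain a b where a: "bounded_linear a" and b: "bounded_linear b" and ab: "\<And>x y. l (x, y) = a x + b y"
      using bounded_linear_prod_split[OF l] by blast
    let ?c = "\<lambda>x. a (x /\<^sub>R sqrt 2) + b (x /\<^sub>R sqrt 2)" and ?d = "\<lambda>x. a (x /\<^sub>R sqrt 2) + - b (x /\<^sub>R sqrt 2)"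
    have s: "bounded_linear (\<lambda>x. a (x /\<^sub>R sqrt 2))" "bounded_linear (\<lambda>x. - b (x /\<^sub>R sqrt 2))" "bounded_linear (\<lambda>x. b (x /\<^sub>R sqrt 2))"
      using a b by (auto intro!: bounded_linear_minus bounded_linear_compose[OF _ bounded_linear_scaleR_right])
    have cd: "bounded_linear ?c" "bounded_linear ?d"
      by (rule bounded_linear_add[OF s(1) s(3)], rule bounded_linear_add[OF s(1) s(2)])
    note [measurable] = bounded_linear_measurable[OF l]
    have "(CLINT z|distr (M \<Otimes>\<^sub>M M) borel (\<lambda>(x, y). ((x + y) /\<^sub>R sqrt 2, (x - y) /\<^sub>R sqrt 2)). iexp (l z)) =
       (CLINT z|M \<Otimes>\<^sub>M M. iexp (?c (fst z) + ?d (snd z)))"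
      by (subst integral_distr[OF m])
         (auto simp: split_beta ab linear_simps[OF a] linear_simps[OF b] algebra_simps intro!: Bochner_Integration.integral_cong)
    also have "\<dots> = of_real (exp (- ((\<integral>x. (?c x)\<^sup>2 \<partial>M) + (\<integral>x. (?d x)\<^sup>2 \<partial>M)) / 2))"
      by (rule char_functional_pair[OF cd])
    also have "(\<integral>x. (?c x)\<^sup>2 \<partial>M) + (\<integral>x. (?d x)\<^sup>2 \<partial>M) = 2 * (\<integral>x. (a (x /\<^sub>R sqrt 2))\<^sup>2 \<partial>M) + 2 * (\<integral>x. (b (x /\<^sub>R sqrt 2))\<^sup>2 \<partial>M)"
      unfolding variance_sum[OF s(1,3)] variance_sum[OF s(1,2)] by simp
    also have "\<dots> = (\<integral>x. (a x)\<^sup>2 \<partial>M) + (\<integral>x. (b x)\<^sup>2 \<partial>M)"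
      by (simp add: linear_simps(5)[OF a] linear_simps(5)[OF b] power_mult_distrib power_inverse)
    also have "of_real (exp (- ((\<integral>x. (a x)\<^sup>2 \<partial>M) + (\<integral>x. (b x)\<^sup>2 \<partial>M)) / 2)) = (CLINT z|M \<Otimes>\<^sub>M M. iexp (a (fst z) + b (snd z)))"
      by (rule char_functional_pair[OF a b, symmetric])
    also have "\<dots> = (CLINT z|M \<Otimes>\<^sub>M M. iexp (l z))"
      by (intro Bochner_Integration.integral_cong) (auto simp: ab)
    finally show "(CLINT z|distr (M \<Otimes>\<^sub>M M) borel (\<lambda>(x, y). ((x + y) /\<^sub>R sqrt 2, (x - y) /\<^sub>R sqrt 2)). iexp (l z)) =
      (CLINT z|M \<Otimes>\<^sub>M M. iexp (l z))" .
  qed (simp_all only: sets_pair sets_distr)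
qed

text \<open>For jointly Gaussian images the mixed term of the variance is the only obstruction to a
  product form of the characteristic functional, so absence of correlation is independence.\<close>

lemma distr_uncorrelated:
  fixes S :: "'a \<Rightarrow> 'b::{banach, second_countable_topology}" and T :: "'a \<Rightarrow> 'c::{banach, second_countable_topology}"
  assumes S: "bounded_linear S" and T: "bounded_linear T"
    and uncor: "\<And>(a :: 'b \<Rightarrow> real) (b :: 'c \<Rightarrow> real). bounded_linear a \<Longrightarrow> bounded_linear b \<Longrightarrow> (\<integral>x. a (S x) * b (T x) \<partial>M) = 0"
  shows "distr M borel (\<lambda>x. (S x, T x)) = distr M borel S \<Otimes>\<^sub>M distr M borel T"
proof -
  note [measurable] = bounded_linear_measurable[OF S] bounded_linear_measurable[OF T]
  have m [measurable]: "(\<lambda>x. (S x, T x)) \<in> borel_measurable M"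
    by measurable
 have ps: "prob_space (distr M borel (\<lambda>x. (S x, T x)))"
    by (rule prob_space_distr) (rule m)
  interpret gaussian_pair "distr M borel S" "distr M borel T"
    unfolding gaussian_pair_def using gaussian_distr[OF S] gaussian_distr[OF T] by simp
  show ?thesis
  proof (rule measure_eqI_characteristic_functional)
    show "prob_space (distr M borel (\<lambda>x. (S x, T x)))" by (rule ps)
    show "prob_space (distr M borel S \<Otimes>\<^sub>M distr M borel T)" by unfold_locales
    fix l :: "'b \<times> 'c \<Rightarrow> real" assume l: "bounded_linear l"
    obtain a b where a: "bounded_linear a" and b: "bounded_linear b" and ab: "\<And>x y. l (x, y) = a x + b y"
      using bounded_linear_prod_split[OF l] by blast
    note [measurable] = bounded_linear_measurable[OF l] bounded_linear_measurable[OF a] bounded_linear_measurable[OF b]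
    have s: "bounded_linear (\<lambda>x. a (S x))" "bounded_linear (\<lambda>x. b (T x))"
      using bounded_linear_compose[OF a S] bounded_linear_compose[OF b T] .
    have "(CLINT z|distr M borel (\<lambda>x. (S x, T x)). iexp (l z)) = (CLINT x|M. iexp (a (S x) + b (T x)))"
      by (subst integral_distr[OF m]) (auto simp: ab)
    also have "\<dots> = of_real (exp (- ((\<integral>x. (a (S x))\<^sup>2 \<partial>M) + (\<integral>x. (b (T x))\<^sup>2 \<partial>M)) / 2))"
      using char_functional[OF bounded_linear_add[OF s]] variance_sum[OF s] uncor[OF a b] by simp
    also have "\<dots> = (CLINT z|distr M borel S \<Otimes>\<^sub>M distr M borel T. iexp (a (fst z) + b (snd z)))"
      by (subst char_functional_pair[OF a b]) (simp add: integral_distr)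
    also have "\<dots> = (CLINT z|distr M borel S \<Otimes>\<^sub>M distr M borel T. iexp (l z))"
      by (intro Bochner_Integration.integral_cong) (auto simp: ab)
    finally show "(CLINT z|distr M borel (\<lambda>x. (S x, T x)). iexp (l z)) = (CLINT z|distr M borel S \<Otimes>\<^sub>M distr M borel T. iexp (l z))" .
  qed (simp_all only: sets_pair sets_distr)
qed

end

section \<open>Square integrability and the Cameron-Martin formula\<close>

text \<open>Completing the square: after translating the variable by \<open>\<sigma>\<close>, the
  tilted density is the standard one times \<open>exp (\<sigma>\<^sup>2 / 2)\<close>.\<close>

lemma std_normal_shift:
  fixes \<psi> :: "real \<Rightarrow> ennreal"
  assumes [measurable]: "\<psi> \<in> borel_measurable borel"
  shows "(\<integral>\<^sup>+ t. \<psi> t * ennreal (exp (\<sigma> * t)) \<partial>std_normal_distribution) =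
    ennreal (exp (\<sigma>\<^sup>2 / 2)) * (\<integral>\<^sup>+ t. \<psi> (t + \<sigma>) \<partial>std_normal_distribution)"
proof -
  have e: "std_normal_density (\<sigma> + t) * exp (\<sigma> * (\<sigma> + t)) = exp (\<sigma>\<^sup>2 / 2) * std_normal_density t" for t
  proof -
    have "exp (- (\<sigma> + t)\<^sup>2 / 2) * exp (\<sigma> * (\<sigma> + t)) = exp (\<sigma>\<^sup>2 / 2) * exp (- t\<^sup>2 / 2)"
      by (simp flip: exp_add) (simp add: power2_eq_square field_simps)
    then show ?thesis unfolding std_normal_density_def by simp
  qed
  have "(\<integral>\<^sup>+ t. \<psi> t * ennreal (exp (\<sigma> * t)) \<partial>std_normal_distribution) =
      (\<integral>\<^sup>+ t. ennreal (std_normal_density t) * (\<psi> t * ennreal (exp (\<sigma> * t))) \<partial>lborel)"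
    by (subst nn_integral_density) auto
  also have "\<dots> = ennreal \<bar>1\<bar> * (\<integral>\<^sup>+ t. ennreal (std_normal_density (\<sigma> + 1 * t)) * (\<psi> (\<sigma> + 1 * t) * ennreal (exp (\<sigma> * (\<sigma> + 1 * t)))) \<partial>lborel)"
    by (rule nn_integral_real_affine) auto
  also have "\<dots> = (\<integral>\<^sup>+ t. ennreal (exp (\<sigma>\<^sup>2 / 2)) * (ennreal (std_normal_density t) * \<psi> (t + \<sigma>)) \<partial>lborel)"
  proof -
    have "ennreal (std_normal_density (\<sigma> + t)) * (\<psi> (\<sigma> + t) * ennreal (exp (\<sigma> * (\<sigma> + t)))) =
      \<psi> (\<sigma> + t) * ennreal (std_normal_density (\<sigma> + t) * exp (\<sigma> * (\<sigma> + t)))" for t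
      by (simp add: ennreal_mult ac_simps)
    moreover have "\<psi> (\<sigma> + t) * ennreal (exp (\<sigma>\<^sup>2 / 2) * std_normal_density t) =
      ennreal (exp (\<sigma>\<^sup>2 / 2)) * (ennreal (std_normal_density t) * \<psi> (t + \<sigma>))" for t
      by (simp add: ennreal_mult ac_simps)
    ultimately show ?thesis unfolding e by simp
  qed
  also have "\<dots> = ennreal (exp (\<sigma>\<^sup>2 / 2)) * (\<integral>\<^sup>+ t. \<psi> (t + \<sigma>) \<partial>std_normal_distribution)"
    by (simp add: nn_integral_cmult nn_integral_density)
  finally show ?thesis .
qed

context gaussian_measure
begin

text \<open>Rotation invariance makes the tail of the norm decay doubly exponentially along a geometric
  sequence; this is the first half of Fernique's argument.\<close>

lemma norm_tail_rotation:
  "measure M {x. norm x \<le> s} * measure M {x. t < norm x} \<le> (measure M {x. (t - s) / sqrt 2 < norm x})\<^sup>2"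
proof -
  note Times = emeasure_pair_measure_Times and eq_measure = emeasure_eq_measure
  interpret gaussian_pair M M ..
  let ?R = "\<lambda>(x, y). ((x + y) /\<^sub>R sqrt 2, (x - y) /\<^sub>R sqrt 2) :: 'a \<times> 'a"
  let ?A = "{x. norm x \<le> s}" and ?B = "{x. t < norm x}" and ?C = "{x :: 'a. (t - s) / sqrt 2 < norm x}"
  have m [measurable]: "?R \<in> borel_measurable (M \<Otimes>\<^sub>M M)"
    unfolding split_beta by measurable
  have s: "?A \<in> sets M" "?B \<in> sets M" "?C \<in> sets M" by auto
  have BA: "?B \<times> ?A \<in> sets (M \<Otimes>\<^sub>M M)" using s by auto
  have "emeasure M ?B * emeasure M ?A = emeasure (M \<Otimes>\<^sub>M M) (?B \<times> ?A)"
    using s by (intro Times[symmetric]) auto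
  also have "\<dots> = emeasure (distr (M \<Otimes>\<^sub>M M) borel ?R) (?B \<times> ?A)"
    by (simp add: distr_rotation)
  also have "\<dots> = emeasure (M \<Otimes>\<^sub>M M) (?R -` (?B \<times> ?A) \<inter> space (M \<Otimes>\<^sub>M M))"
    using BA by (intro emeasure_distr m) (simp only: sets_pair)
  also have "\<dots> \<le> emeasure (M \<Otimes>\<^sub>M M) (?C \<times> ?C)"
  proof (rule emeasure_mono)
    show "?R -` (?B \<times> ?A) \<inter> space (M \<Otimes>\<^sub>M M) \<subseteq> ?C \<times> ?C"
    proof
      fix p :: "'a \<times> 'a"
      assume p: "p \<in> ?R -` (?B \<times> ?A) \<inter> space (M \<Otimes>\<^sub>M M)"
      obtain x y where xy: "p = (x, y)" by (cases p)
      have A: "t < norm ((x + y) /\<^sub>R sqrt 2)" "norm ((x - y) /\<^sub>R sqrt 2) \<le> s"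
        using p unfolding xy by simp_all
      \<comment> \<open>Writing \<open>x + y\<close> as \<open>(x - y) + 2 *\<^sub>R y\<close>, and
        likewise with the roles exchanged, bounds the norms of both \<open>x\<close> and
        \<open>y\<close> from below; this puts the preimage into a square.\<close>
      have "norm (x + y) \<le> norm (x - y) + 2 * norm y"
      proof -
        have "(x - y) + 2 *\<^sub>R y = x + y" by (simp add: scaleR_2)
        then show ?thesis using norm_triangle_ineq[of "x - y" "2 *\<^sub>R y"] by (simp only: norm_scaleR abs_numeral)
      qed
      moreover have "norm (x + y) \<le> norm (y - x) + 2 * norm x"
      proof -
        have "(y - x) + 2 *\<^sub>R x = x + y" by (simp add: scaleR_2)
        then show ?thesis using norm_triangle_ineq[of "y - x" "2 *\<^sub>R x"] by (simp only: norm_scaleR abs_numeral)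
      qed
      moreover have "sqrt 2 * t < norm (x + y)" "norm (x - y) \<le> sqrt 2 * s"
      proof -
        have "t < norm (x + y) / sqrt 2" "norm (x - y) / sqrt 2 \<le> s"
          using A by (simp_all add: divide_inverse mult.commute)
        then show "sqrt 2 * t < norm (x + y)" "norm (x - y) \<le> sqrt 2 * s"
          by (simp_all add: field_simps)
      qed
      ultimately have "sqrt 2 * (t - s) < 2 * norm x" "sqrt 2 * (t - s) < 2 * norm y"
        by (auto simp: norm_minus_commute algebra_simps)
      moreover have "(t - s) / sqrt 2 = sqrt 2 * (t - s) / 2"
        by (simp add: field_simps)
      ultimately have "(t - s) / sqrt 2 < norm x" "(t - s) / sqrt 2 < norm y" by linarith+
      then show "p \<in> ?C \<times> ?C" by (simp add: xy)
    qed
    show "?C \<times> ?C \<in> sets (M \<Otimes>\<^sub>M M)" using s by auto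
  qed
  also have "\<dots> = emeasure M ?C * emeasure M ?C"
    using s by (intro Times) auto
  finally show ?thesis
    by (simp add: eq_measure power2_eq_square mult.commute flip: ennreal_mult)
qed

text \<open>The second half of Fernique's argument. Thresholds growing like powers of sqrt 2 have
  tails that are essentially squared at each step, so the shells between them contribute a
  convergent series to the second moment.\<close>

lemma integrable_norm_square: "integrable M (\<lambda>x. (norm x)\<^sup>2)"
proof -
  define p where "p t = measure M {x. t < norm x}" for t
  obtain s where s: "s \<ge> 1" "measure M {x. norm x \<le> s} \<ge> 4 / 5"
  proof -
    have "(\<lambda>n. measure M {x :: 'a. norm x \<le> real n}) \<longlonglongrightarrow> measure M (\<Union>n. {x :: 'a. norm x \<le> real n})"
      by (intro finite_Lim_measure_incseq) (auto simp: incseq_def intro: order.trans)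
    moreover have "(\<Union>n. {x :: 'a. norm x \<le> real n}) = space M" using real_arch_simple by auto
    ultimately have "(\<lambda>n. measure M {x :: 'a. norm x \<le> real n}) \<longlonglongrightarrow> 1"
      using prob_space by simp
    then have "eventually (\<lambda>n. 4/5 < measure M {x :: 'a. norm x \<le> real n}) sequentially"
      by (rule order_tendstoD) simp
    then have "eventually (\<lambda>n. 4/5 < measure M {x :: 'a. norm x \<le> real n} \<and> n \<ge> 1) sequentially"
      using eventually_ge_at_top by (rule eventually_conj)
    then obtain n :: nat where "4/5 < measure M {x :: 'a. norm x \<le> real n}" "n \<ge> 1"
      by (auto dest: eventually_happens)
    then show ?thesis using that[of "real n"] by simp
  qed
  \<comment> \<open>The recursion inverts the map from \<open>u\<close> to
    \<open>(u - s) / sqrt 2\<close> that occurs in the tail estimate.\<close>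
  define t where "t = rec_nat s (\<lambda>_ u. s + sqrt 2 * u)"
  have t: "t 0 = s" "t (Suc k) = s + sqrt 2 * t k" for k by (simp_all add: t_def)
  have sqrt2: "1 \<le> sqrt 2" "5 \<le> 4 * sqrt 2"
    by (simp_all add: real_le_rsqrt power2_eq_square) (rule power2_le_imp_le, auto simp: power_mult_distrib)
  have t_ge: "real k + 1 \<le> t k" for k
  proof (induction k)
    case (Suc k)
    have "t k \<le> sqrt 2 * t k" using Suc sqrt2 mult_right_mono[of 1 "sqrt 2" "t k"] by simp
    then show ?case using Suc s(1) unfolding t(2) of_nat_Suc by linarith
  qed (use s in \<open>simp add: t\<close>)
  \<comment> \<open>At \<open>k = 0\<close> the bound equals \<open>s\<close>; the induction closes
    because \<open>5 \<le> 4 * sqrt 2\<close>.\<close>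
  have t_le: "t k \<le> s * (5 * sqrt 2 ^ k - 4)" for k
  proof (induction k)
    case (Suc k)
    have "s + sqrt 2 * t k \<le> s + sqrt 2 * (s * (5 * sqrt 2 ^ k - 4))"
      using Suc by (intro add_left_mono mult_left_mono) auto
    also have "\<dots> = s * (5 * sqrt 2 ^ Suc k) + s * (1 - 4 * sqrt 2)" by (simp add: algebra_simps)
    also have "\<dots> \<le> s * (5 * sqrt 2 ^ Suc k) + s * (-4)"
      using s(1) sqrt2 by (intro add_left_mono mult_left_mono) auto
    finally show ?case by (simp add: t algebra_simps)
  qed (simp add: t)
  have t_sq: "(t k)\<^sup>2 \<le> 25 * s\<^sup>2 * 2 ^ k" for k
  proof -
    have "t k \<le> 5 * s * sqrt 2 ^ k" using t_le[of k] s(1) by (simp add: algebra_simps)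
    then have "(t k)\<^sup>2 \<le> (5 * s * sqrt 2 ^ k)\<^sup>2" using t_ge[of k] by (intro power_mono) auto
    also have "\<dots> = 25 * s\<^sup>2 * (sqrt 2 ^ k)\<^sup>2" by (simp add: power_mult_distrib)
    also have "(sqrt 2 ^ k)\<^sup>2 = (sqrt 2 ^ 2) ^ k" by (simp only: power_mult[symmetric] mult.commute)
    finally show ?thesis by simp
  qed
  have p0: "0 \<le> p u" for u by (simp add: p_def)
  \<comment> \<open>The factor 5/4 is the reciprocal of the mass guaranteed for the ball of radius
    \<open>s\<close>. With it the recursion is pure squaring, and the starting value is at most 5/4
    times 1/5.\<close>
  have q: "5/4 * p (t k) \<le> (1/4) ^ (2 ^ k)" for k
  proof (induction k)
    case 0
    have "p s = 1 - measure M {x. norm x \<le> s}"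
      using prob_compl[of "{x. norm x \<le> s}"] by (auto simp: p_def Compl_eq_Diff_UNIV[symmetric] Collect_neg_eq[symmetric] not_le)
    then show ?case using s by (simp add: t)
  next
    case (Suc k)
    have "4/5 * p (t (Suc k)) \<le> measure M {x. norm x \<le> s} * p (t (Suc k))"
      using s(2) p0 by (intro mult_right_mono) auto
    also have "\<dots> \<le> (p ((t (Suc k) - s) / sqrt 2))\<^sup>2"
      unfolding p_def by (rule norm_tail_rotation)
    also have "(t (Suc k) - s) / sqrt 2 = t k" by (simp add: t)
    finally have "5/4 * p (t (Suc k)) \<le> (5/4 * p (t k))\<^sup>2" by (simp add: power_mult_distrib power2_eq_square)
    also have "\<dots> \<le> ((1/4) ^ (2 ^ k))\<^sup>2" using Suc p0 by (intro power_mono) auto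
    also have "\<dots> = (1/4) ^ (2 ^ Suc k)" by (simp flip: power_mult add: mult.commute)
    finally show ?case .
  qed
  have pt: "p (t k) \<le> (1/4) ^ Suc k" for k
  proof -
    have "Suc k \<le> 2 ^ k" by (induction k) auto
    then have "(1/4) ^ (2 ^ k) \<le> (1/4 :: real) ^ Suc k" by (intro power_decreasing) auto
    then show ?thesis using q[of k] p0[of "t k"] by linarith
  qed
  have trm: "(t (Suc k))\<^sup>2 * p (t k) \<le> (25 * s\<^sup>2) * (1/2) ^ Suc k" for k
  proof -
    have "(t (Suc k))\<^sup>2 * p (t k) \<le> (25 * s\<^sup>2 * 2 ^ Suc k) * (1/4) ^ Suc k"
      by (intro mult_mono[OF t_sq pt]) (use p0 in auto)
    also have "\<dots> = (25 * s\<^sup>2) * (2 * (1/4)) ^ Suc k" by (simp only: power_mult_distrib mult.assoc)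
    finally show ?thesis by simp
  qed
  \<comment> \<open>A point outside the ball of radius \<open>s\<close> has a first threshold that
    reaches its norm, and the term of the preceding index already dominates the square of the
    norm.\<close>
  have "(\<integral>\<^sup>+ x. ennreal ((norm x)\<^sup>2) \<partial>M) \<le> (\<integral>\<^sup>+ x. ennreal (s\<^sup>2) + (\<Sum>k. ennreal ((t (Suc k))\<^sup>2) * indicator {x. t k < norm x} x) \<partial>M)"
  proof (rule nn_integral_mono)
    fix x :: 'a
    show "ennreal ((norm x)\<^sup>2) \<le> ennreal (s\<^sup>2) + (\<Sum>k. ennreal ((t (Suc k))\<^sup>2) * indicator {x. t k < norm x} x)"
    proof (cases "norm x \<le> s")
      case True
      then have "ennreal ((norm x)\<^sup>2) \<le> ennreal (s\<^sup>2)" by (intro ennreal_leI power_mono) auto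
      then show ?thesis by (simp add: add_increasing2)
    next
      case False
      obtain n :: nat where "norm x \<le> real n" using real_arch_simple by blast
      then have ex: "\<exists>n. norm x \<le> t n" using t_ge[of n] by (intro exI[of _ n]) simp
      define n where "n = (LEAST n. norm x \<le> t n)"
      have n: "norm x \<le> t n" unfolding n_def using ex by (rule LeastI_ex)
      then obtain k where k: "n = Suc k" using False t(1) by (cases n) auto
      have "t k < norm x" using not_less_Least[of k "\<lambda>n. norm x \<le> t n"] k n_def by (simp add: not_le)
      then have "ennreal ((norm x)\<^sup>2) \<le> ennreal ((t (Suc k))\<^sup>2) * indicator {x. t k < norm x} x"
        using n k by (auto intro!: ennreal_leI power_mono)
      also have "\<dots> \<le> (\<Sum>k. ennreal ((t (Suc k))\<^sup>2) * indicator {x. t k < norm x} x)"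
      proof -
        define a where "a k = ennreal ((t (Suc k))\<^sup>2) * indicator {x. t k < norm x} x" for k
        have "sum a {k} \<le> suminf a" by (rule sum_le_suminf) auto
        then have "a k \<le> suminf a" by simp
        then show ?thesis unfolding a_def .
      qed
      finally show ?thesis by (simp add: add_increasing)
    qed
  qed
  also have "\<dots> = ennreal (s\<^sup>2) + (\<Sum>k. ennreal ((t (Suc k))\<^sup>2) * ennreal (p (t k)))"
    by (subst nn_integral_add) (auto simp: nn_integral_suminf nn_integral_cmult prob_space[simplified] emeasure_eq_measure p_def)
  also have "\<dots> \<le> ennreal (s\<^sup>2) + (\<Sum>k. ennreal ((25 * s\<^sup>2) * (1/2) ^ Suc k))"
    using trm p0 by (intro add_left_mono suminf_le) (auto intro!: ennreal_leI simp flip: ennreal_mult simp del: power_Suc)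
  also have "(\<Sum>k. ennreal ((25 * s\<^sup>2) * (1/2) ^ Suc k)) = ennreal (\<Sum>k. (25 * s\<^sup>2) * (1/2) ^ Suc k)"
    by (intro suminf_ennreal2 summable_mult) (auto simp: summable_Suc_iff intro!: summable_geometric simp del: power_Suc)
  finally have "(\<integral>\<^sup>+ x. ennreal ((norm x)\<^sup>2) \<partial>M) < \<infinity>"
    by (metis ennreal_add_eq_top ennreal_neq_top infinity_ennreal_def less_top_ennreal neq_top_trans top.not_eq_extremum)
  then show ?thesis by (intro integrableI_nonneg) auto
qed

section \<open>Covariance vectors and admissible shifts\<close>

lemma integrable_functional_scaleR:
  assumes l: "bounded_linear (l :: 'a \<Rightarrow> real)"
  shows "integrable M (\<lambda>x. l x *\<^sub>R x)"
proof -
  note [measurable] = bounded_linear_measurable[OF l]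
  obtain K where K: "\<And>x. norm (l x) \<le> norm x * K" using bounded_linear.bounded[OF l] by blast
  show ?thesis
  proof (rule Bochner_Integration.integrable_bound)
    show "integrable M (\<lambda>x. K * (norm x)\<^sup>2)" using integrable_norm_square by simp
    have "\<bar>l x\<bar> * norm x \<le> K * (norm x)\<^sup>2" for x
      using mult_right_mono[OF K norm_ge_zero, of x x] by (simp add: power2_eq_square mult.commute mult.left_commute)
    then show "AE x in M. norm (l x *\<^sub>R x) \<le> norm (K * (norm x)\<^sup>2)"
      by (intro AE_I2) (metis abs_ge_self norm_scaleR order.trans real_norm_def)
  qed simp
qed

text \<open>The covariance operator applied to \<open>l\<close>, an element of the Cameron-Martin
  space; the second moment of the norm makes the Bochner integral converge.\<close>

definition cov_vector :: "('a \<Rightarrow> real) \<Rightarrow> 'a" where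
  "cov_vector l = (\<integral>x. l x *\<^sub>R x \<partial>M)"

lemma functional_cov_vector:
  assumes l: "bounded_linear (l :: 'a \<Rightarrow> real)" and b: "bounded_linear (b :: 'a \<Rightarrow> real)"
  shows "b (cov_vector l) = (\<integral>x. l x * b x \<partial>M)"
  using integral_bounded_linear[OF b integrable_functional_scaleR[OF l]] linear_simps(5)[OF b]
  by (simp add: cov_vector_def)

text \<open>\<open>c\<close> is the regression coefficient of the sample on \<open>l\<close>:
  subtracting \<open>l x *\<^sub>R c\<close> removes all correlation with \<open>l\<close>.\<close>

lemma distr_split_functional:
  assumes l: "bounded_linear (l :: 'a \<Rightarrow> real)" and nz: "(\<integral>x. (l x)\<^sup>2 \<partial>M) \<noteq> 0"
  defines "c \<equiv> inverse (\<integral>x. (l x)\<^sup>2 \<partial>M) *\<^sub>R cov_vector l"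
  shows "distr M borel (\<lambda>x. (l x, x - l x *\<^sub>R c)) = distr M borel l \<Otimes>\<^sub>M distr M borel (\<lambda>x. x - l x *\<^sub>R c)"
proof (rule distr_uncorrelated[OF l])
  let ?T = "\<lambda>x. x - l x *\<^sub>R c"
  show T: "bounded_linear ?T"
    by (intro bounded_linear_sub bounded_linear_ident bounded_linear_scaleR_const l)
  fix a :: "real \<Rightarrow> real" and b :: "'a \<Rightarrow> real" assume a: "bounded_linear a" and b: "bounded_linear b"
  have "a (l x) = a 1 * l x" for x using linear_simps(5)[OF a, of "l x" 1] by (simp add: mult.commute)
  then have "(\<integral>x. a (l x) * b (?T x) \<partial>M) = (\<integral>x. a 1 * (l x * b x - b c * (l x)\<^sup>2) \<partial>M)"
    by (simp add: linear_simps[OF b] algebra_simps power2_eq_square)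
  also have "\<dots> = a 1 * ((\<integral>x. l x * b x \<partial>M) - b c * (\<integral>x. (l x)\<^sup>2 \<partial>M))"
    using integrable_functional_mult[OF l b] square_integrable[OF l] by simp
  also have "b c * (\<integral>x. (l x)\<^sup>2 \<partial>M) = (\<integral>x. l x * b x \<partial>M)"
    using nz by (simp add: c_def linear_simps[OF b] functional_cov_vector[OF l b])
  finally show "(\<integral>x. a (l x) * b (?T x) \<partial>M) = 0" by simp
qed

text \<open>The tilt affects only the real coordinate \<open>l x\<close>, which is independent of
  the remainder. The shift formula on the line moves it by the variance, and the variance times the
  regression coefficient is the covariance vector. If the variance is zero, \<open>l\<close>
  vanishes almost surely and the shift is zero.\<close>

theorem cameron_martin:
  fixes \<phi> :: "'a \<Rightarrow> ennreal"
  assumes l: "bounded_linear (l :: 'a \<Rightarrow> real)" and [measurable]: "\<phi> \<in> borel_measurable borel"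
  shows "(\<integral>\<^sup>+ x. \<phi> x * ennreal (exp (l x)) \<partial>M) =
    ennreal (exp ((\<integral>x. (l x)\<^sup>2 \<partial>M) / 2)) * (\<integral>\<^sup>+ x. \<phi> (x + cov_vector l) \<partial>M)"
proof (cases "(\<integral>x. (l x)\<^sup>2 \<partial>M) = 0")
  case True
  have ae: "AE x in M. l x = 0" by (rule functional_eq_0_AE[OF l True])
  then have "cov_vector l = (\<integral>x. 0 \<partial>M)"
    unfolding cov_vector_def using bounded_linear_measurable[OF l] by (intro integral_cong_AE) auto
  then have c: "cov_vector l = 0" by simp
  have "(\<integral>\<^sup>+ x. \<phi> x * ennreal (exp (l x)) \<partial>M) = (\<integral>\<^sup>+ x. \<phi> x \<partial>M)"
    using ae by (intro nn_integral_cong_AE) auto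
  then show ?thesis using True c by simp
next
  case False
  define \<sigma> where "\<sigma> = sqrt (\<integral>x. (l x)\<^sup>2 \<partial>M)"
  have \<sigma>2: "(\<integral>x. (l x)\<^sup>2 \<partial>M) = \<sigma>\<^sup>2" by (simp add: \<sigma>_def)
  define c where "c = inverse (\<integral>x. (l x)\<^sup>2 \<partial>M) *\<^sub>R cov_vector l"
  have cov: "cov_vector l = (\<sigma>\<^sup>2) *\<^sub>R c" using False by (simp add: c_def \<sigma>2)
  define T where "T x = x - l x *\<^sub>R c" for x
  note lm [measurable] = bounded_linear_measurable[OF l]
  have T: "bounded_linear T"
    unfolding T_def by (intro bounded_linear_sub bounded_linear_ident bounded_linear_scaleR_const l)
  note Tm [measurable] = bounded_linear_measurable[OF T]
  have lT [measurable]: "(\<lambda>x. (l x, T x)) \<in> borel_measurable M" by measurable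
  interpret T: gaussian_measure "distr M borel T" by (rule gaussian_distr[OF T])
  have law: "distr M borel (\<lambda>x. (l x, T x)) = distr M borel l \<Otimes>\<^sub>M distr M borel T"
    unfolding T_def c_def by (rule distr_split_functional[OF l False])
  interpret S: prob_space std_normal_distribution by (rule prob_space_std_normal)
  have split: "(\<integral>\<^sup>+ x. F (l x) (T x) \<partial>M) = (\<integral>\<^sup>+ z. (\<integral>\<^sup>+ t. F (\<sigma> * t) z \<partial>std_normal_distribution) \<partial>distr M borel T)"
    if F' [measurable]: "(\<lambda>p. F (fst p) (snd p)) \<in> borel_measurable (borel \<Otimes>\<^sub>M borel)" for F :: "real \<Rightarrow> 'a \<Rightarrow> ennreal"
  proof -
    interpret L: prob_space "distr M borel l" by (rule prob_space_distr) simp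
    interpret LT: pair_prob_space "distr M borel l" "distr M borel T" ..
    have F: "(\<lambda>(t, z). F t z) \<in> borel_measurable borel"
      using F' unfolding split_beta borel_prod .
    have Fz: "(\<lambda>t. F t z) \<in> borel_measurable borel" for z
      using measurable_compose[of "\<lambda>t. (t, z)" borel "borel \<Otimes>\<^sub>M borel", OF _ F'] by simp
    have Fm: "(\<lambda>(t, z). F t z) \<in> borel_measurable (distr M borel l \<Otimes>\<^sub>M distr M borel T)"
      using F' unfolding split_beta by (subst measurable_cong_sets[OF sets_pair_measure_cong[OF sets_distr sets_distr] refl])
    have "(\<integral>\<^sup>+ x. F (l x) (T x) \<partial>M) = (\<integral>\<^sup>+ p. (\<lambda>(t, z). F t z) p \<partial>distr M borel (\<lambda>x. (l x, T x)))"
      using F by (subst nn_integral_distr[OF lT]) simp_all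
    also have "\<dots> = (\<integral>\<^sup>+ z. (\<integral>\<^sup>+ t. F t z \<partial>distr M borel l) \<partial>distr M borel T)"
      unfolding law using LT.nn_integral_snd[OF Fm] by simp
    also have "\<dots> = (\<integral>\<^sup>+ z. (\<integral>\<^sup>+ t. F (\<sigma> * t) z \<partial>std_normal_distribution) \<partial>distr M borel T)"
      unfolding law_functional[OF l, folded \<sigma>_def]
      using Fz by (intro nn_integral_cong nn_integral_distr) auto
    finally show ?thesis .
  qed
  have "(\<integral>\<^sup>+ x. \<phi> x * ennreal (exp (l x)) \<partial>M) = (\<integral>\<^sup>+ x. \<phi> (l x *\<^sub>R c + T x) * ennreal (exp (l x)) \<partial>M)"
    by (simp add: T_def)
  also have "\<dots> = (\<integral>\<^sup>+ z. (\<integral>\<^sup>+ t. \<phi> ((\<sigma> * t) *\<^sub>R c + z) * ennreal (exp (\<sigma> * t)) \<partial>std_normal_distribution) \<partial>distr M borel T)"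
    by (rule split) measurable
  also have "\<dots> = (\<integral>\<^sup>+ z. ennreal (exp (\<sigma>\<^sup>2 / 2)) * (\<integral>\<^sup>+ t. \<phi> ((\<sigma> * (t + \<sigma>)) *\<^sub>R c + z) \<partial>std_normal_distribution) \<partial>distr M borel T)"
    by (intro nn_integral_cong std_normal_shift) measurable
  also have "\<dots> = ennreal (exp (\<sigma>\<^sup>2 / 2)) * (\<integral>\<^sup>+ z. (\<integral>\<^sup>+ t. \<phi> ((\<sigma> * t + \<sigma>\<^sup>2) *\<^sub>R c + z) \<partial>std_normal_distribution) \<partial>distr M borel T)"
    by (subst nn_integral_cmult, measurable) (simp add: distrib_left power2_eq_square)
  also have "(\<integral>\<^sup>+ z. (\<integral>\<^sup>+ t. \<phi> ((\<sigma> * t + \<sigma>\<^sup>2) *\<^sub>R c + z) \<partial>std_normal_distribution) \<partial>distr M borel T) =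
     (\<integral>\<^sup>+ x. \<phi> ((l x + \<sigma>\<^sup>2) *\<^sub>R c + T x) \<partial>M)"
    by (rule split[symmetric]) measurable
  also have "\<dots> = (\<integral>\<^sup>+ x. \<phi> (x + cov_vector l) \<partial>M)"
    by (simp add: T_def cov algebra_simps)
  finally show ?thesis unfolding \<sigma>2 .
qed

lemma nn_integral_exp_functional:
  assumes l: "bounded_linear (l :: 'a \<Rightarrow> real)"
  shows "(\<integral>\<^sup>+ x. ennreal (exp (l x)) \<partial>M) = ennreal (exp ((\<integral>x. (l x)\<^sup>2 \<partial>M) / 2))"
  using cameron_martin[OF l, of "\<lambda>_. 1"] by (simp add: emeasure_space_1[simplified])

text \<open>The Cameron-Martin formula for the indicator of a null set: the tilted integral
  vanishes, hence so does the shifted one.\<close>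

lemma AE_shift_cov_vector:
  assumes l: "bounded_linear (l :: 'a \<Rightarrow> real)" and ae: "AE x in M. Q x"
  shows "AE x in M. Q (x + cov_vector l)"
proof -
  obtain N where N: "{x \<in> space M. \<not> Q x} \<subseteq> N" "emeasure M N = 0" "N \<in> sets M" using ae by (rule AE_E)
  have [measurable]: "N \<in> sets borel" using N by simp
  have "ennreal (exp ((\<integral>x. (l x)\<^sup>2 \<partial>M) / 2)) * (\<integral>\<^sup>+ x. indicator N (x + cov_vector l) \<partial>M) =
      (\<integral>\<^sup>+ x. indicator N x * ennreal (exp (l x)) \<partial>M)"
    by (rule cameron_martin[OF l, symmetric]) simp
  also have "\<dots> = 0"
  proof -
    have "AE x in M. x \<notin> N" using N by (intro AE_not_in) (auto simp: null_sets_def)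
    then have "AE x in M. indicator N x * ennreal (exp (l x)) = 0" by eventually_elim auto
    then show ?thesis using bounded_linear_measurable[OF l] by (subst nn_integral_0_iff_AE) auto
  qed
  finally have "(\<integral>\<^sup>+ x. indicator N (x + cov_vector l) \<partial>M) = (0 :: ennreal)" by (simp add: ennreal_eq_0_iff)
  then have "AE x in M. indicator N (x + cov_vector l) = (0 :: ennreal)"
    by (subst (asm) nn_integral_0_iff_AE) auto
  then show ?thesis
    by eventually_elim (use N(1) in \<open>auto simp: indicator_eq_0_iff\<close>)
qed

end

section \<open>The Prekopa-Leindler inequality\<close>

text \<open>The midpoints of \<open>b\<close> with the points of \<open>A\<close> up to
  \<open>a\<close>, and of \<open>a\<close> with the points of \<open>B\<close> from
  \<open>b\<close> on, all lie in \<open>C\<close>, on different sides of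
  \<open>(a + b) / 2\<close>. The two sets meet in at most that point, so their lengths add; the
  factor 2 is the scaling.\<close>

lemma midpoint_brunn_minkowski_cut:
  fixes A B C :: "real set"
  assumes [measurable]: "A \<in> sets borel" "B \<in> sets borel" "C \<in> sets borel"
    and mid: "\<And>x y. x \<in> A \<Longrightarrow> y \<in> B \<Longrightarrow> (x + y) / 2 \<in> C" and ab: "a \<in> A" "b \<in> B"
  shows "emeasure lborel (A \<inter> {..a}) + emeasure lborel (B \<inter> {b..}) \<le> 2 * emeasure lborel C"
proof -
  let ?A = "indicator (A \<inter> {..a}) :: real \<Rightarrow> ennreal" and ?B = "indicator (B \<inter> {b..}) :: real \<Rightarrow> ennreal"
  have "emeasure lborel (A \<inter> {..a}) = (\<integral>\<^sup>+ x. ?A x \<partial>lborel)"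
    by (subst nn_integral_indicator) auto
  also have "\<dots> = ennreal \<bar>2\<bar> * (\<integral>\<^sup>+ z. ?A (- b + 2 * z) \<partial>lborel)"
    by (rule nn_integral_real_affine) auto
  finally have A: "emeasure lborel (A \<inter> {..a}) = 2 * (\<integral>\<^sup>+ z. ?A (- b + 2 * z) \<partial>lborel)" by simp
  have "emeasure lborel (B \<inter> {b..}) = (\<integral>\<^sup>+ x. ?B x \<partial>lborel)"
    by (subst nn_integral_indicator) auto
  also have "\<dots> = ennreal \<bar>2\<bar> * (\<integral>\<^sup>+ z. ?B (- a + 2 * z) \<partial>lborel)"
    by (rule nn_integral_real_affine) auto
  finally have B: "emeasure lborel (B \<inter> {b..}) = 2 * (\<integral>\<^sup>+ z. ?B (- a + 2 * z) \<partial>lborel)" by simp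
  have "(\<integral>\<^sup>+ z. ?A (- b + 2 * z) + ?B (- a + 2 * z) \<partial>lborel) \<le> (\<integral>\<^sup>+ z. indicator C z \<partial>lborel)"
  proof (rule nn_integral_mono_AE)
    show "AE z in lborel. ?A (- b + 2 * z) + ?B (- a + 2 * z) \<le> indicator C z"
      using AE_lborel_singleton[of "(a + b) / 2"]
    proof eventually_elim
      case (elim z)
      have 1: "z \<in> C \<and> z < (a + b) / 2" if "- b + 2 * z \<in> A \<inter> {..a}"
        using mid[of "- b + 2 * z" b] that ab elim by auto
      have 2: "z \<in> C \<and> z > (a + b) / 2" if "- a + 2 * z \<in> B \<inter> {b..}"
        using mid[of a "- a + 2 * z"] that ab elim by auto
      show ?case
      proof (cases "- b + 2 * z \<in> A \<inter> {..a}")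
        case True
        then have "- a + 2 * z \<notin> B \<inter> {b..}" using 1 2 by force
        then show ?thesis using True 1[OF True] by (simp only: indicator_simps) simp
      next
        case False
        show ?thesis
        proof (cases "- a + 2 * z \<in> B \<inter> {b..}")
          case True
          then show ?thesis using False 2[OF True] by (simp only: indicator_simps) simp
        next
          case f: False
          show ?thesis unfolding indicator_simps(2)[OF False] indicator_simps(2)[OF f] by simp
        qed
      qed
    qed
  qed
  then have "(\<integral>\<^sup>+ z. ?A (- b + 2 * z) \<partial>lborel) + (\<integral>\<^sup>+ z. ?B (- a + 2 * z) \<partial>lborel) \<le> emeasure lborel C"
    by (subst (asm) nn_integral_add) auto
  then have "2 * ((\<integral>\<^sup>+ z. ?A (- b + 2 * z) \<partial>lborel) + (\<integral>\<^sup>+ z. ?B (- a + 2 * z) \<partial>lborel)) \<le> 2 * emeasure lborel C"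
    by (rule mult_left_mono) simp
  then show ?thesis unfolding A B by (simp only: distrib_left)
qed

text \<open>Cutting \<open>A\<close> near its supremum and \<open>B\<close> near its infimum
  discards only parts of intervals of length at most \<open>e / 2\<close>.\<close>

lemma midpoint_brunn_minkowski:
  fixes A B C :: "real set"
  assumes m [measurable]: "A \<in> sets borel" "B \<in> sets borel" "C \<in> sets borel"
    and mid: "\<And>x y. x \<in> A \<Longrightarrow> y \<in> B \<Longrightarrow> (x + y) / 2 \<in> C"
    and A: "A \<noteq> {}" "bdd_above A" and B: "B \<noteq> {}" "bdd_below B"
  shows "emeasure lborel A + emeasure lborel B \<le> 2 * emeasure lborel C"
proof (rule ennreal_le_epsilon)
  fix e :: real assume e: "e > 0"
  obtain a where a: "a \<in> A" "Sup A - e / 2 < a" using less_cSupE[of "Sup A - e/2" A] A e by auto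
  obtain b where b: "b \<in> B" "b < Inf B + e / 2" using cInf_lessD[of B "Inf B + e/2"] B e by auto
  have "emeasure lborel A \<le> emeasure lborel ((A \<inter> {..a}) \<union> {a..Sup A})"
    using cSup_upper[OF _ A(2)] by (intro emeasure_mono) auto
  also have "\<dots> \<le> emeasure lborel (A \<inter> {..a}) + emeasure lborel {a..Sup A}"
    by (rule emeasure_subadditive) auto
  also have "emeasure lborel {a..Sup A} \<le> ennreal (e / 2)"
    using a cSup_upper[OF a(1) A(2)] by (simp add: ennreal_leI)
  finally have 1: "emeasure lborel A \<le> emeasure lborel (A \<inter> {..a}) + ennreal (e / 2)" by simp
  have "emeasure lborel B \<le> emeasure lborel ((B \<inter> {b..}) \<union> {Inf B..b})"
    using cInf_lower[OF _ B(2)] by (intro emeasure_mono) auto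
  also have "\<dots> \<le> emeasure lborel (B \<inter> {b..}) + emeasure lborel {Inf B..b}"
    by (rule emeasure_subadditive) auto
  also have "emeasure lborel {Inf B..b} \<le> ennreal (e / 2)"
    using b cInf_lower[OF b(1) B(2)] by (simp add: ennreal_leI)
  finally have 2: "emeasure lborel B \<le> emeasure lborel (B \<inter> {b..}) + ennreal (e / 2)" by simp
  have "emeasure lborel A + emeasure lborel B \<le>
      (emeasure lborel (A \<inter> {..a}) + emeasure lborel (B \<inter> {b..})) + (ennreal (e / 2) + ennreal (e / 2))"
    using add_mono[OF 1 2] by (simp add: ac_simps)
  also have "ennreal (e / 2) + ennreal (e / 2) = ennreal e" using e by (simp flip: ennreal_plus)
  also have "(emeasure lborel (A \<inter> {..a}) + emeasure lborel (B \<inter> {b..})) + ennreal e \<le> 2 * emeasure lborel C + ennreal e"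
    by (intro add_right_mono midpoint_brunn_minkowski_cut m mid a b)
  finally show "emeasure lborel A + emeasure lborel B \<le> 2 * emeasure lborel C + ennreal e" .
qed

text \<open>Fubini for the region below the graph; restricting the levels to the unit interval
  produces the truncation at 1.\<close>

lemma layer_cake_unit:
  fixes f :: "real \<Rightarrow> real"
  assumes [measurable]: "f \<in> borel_measurable borel" and "\<And>x. 0 \<le> f x"
  shows "(\<integral>\<^sup>+ t. indicator {0<..<1} t * emeasure lborel {x. t < f x} \<partial>lborel) = (\<integral>\<^sup>+ x. ennreal (min 1 (f x)) \<partial>lborel)"
proof -
  have "(\<integral>\<^sup>+ t. indicator {0<..<1} t * emeasure lborel {x. t < f x} \<partial>lborel) =
     (\<integral>\<^sup>+ t. (\<integral>\<^sup>+ x. indicator {0<..<1} t * indicator {(t, x). t < f x} (t, x) \<partial>lborel) \<partial>lborel)"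
  proof (intro nn_integral_cong)
    fix t :: real
    have "(\<integral>\<^sup>+ x. indicator {0<..<1} t * indicator {(t, x). t < f x} (t, x) \<partial>lborel) =
       indicator {0<..<1} t * (\<integral>\<^sup>+ x. indicator {x. t < f x} x \<partial>lborel)"
      by (subst nn_integral_cmult[symmetric]) (auto simp: indicator_def intro!: nn_integral_cong)
    also have "(\<integral>\<^sup>+ x. indicator {x. t < f x} x \<partial>lborel) = emeasure lborel {x. t < f x}"
      by (rule nn_integral_indicator) simp
    finally show "indicator {0<..<1} t * emeasure lborel {x. t < f x} =
      (\<integral>\<^sup>+ x. indicator {0<..<1} t * indicator {(t, x). t < f x} (t, x) \<partial>lborel)" by simp
  qed
  also have "\<dots> = (\<integral>\<^sup>+ x. (\<integral>\<^sup>+ t. indicator {0<..<1} t * indicator {(t, x). t < f x} (t, x) \<partial>lborel) \<partial>lborel)"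
    by (rule lborel_pair.Fubini') (simp add: split_beta)
  also have "\<dots> = (\<integral>\<^sup>+ x. ennreal (min 1 (f x)) \<partial>lborel)"
  proof (intro nn_integral_cong)
    fix x
    have "(\<integral>\<^sup>+ t. indicator {0<..<1} t * indicator {(t, x). t < f x} (t, x) \<partial>lborel) =
      (\<integral>\<^sup>+ t. indicator {0<..<min 1 (f x)} t \<partial>lborel)"
      by (intro nn_integral_cong) (auto simp: indicator_def)
    also have "\<dots> = ennreal (min 1 (f x))" using assms(2)[of x] by simp
    finally show "(\<integral>\<^sup>+ t. indicator {0<..<1} t * indicator {(t, x). t < f x} (t, x) \<partial>lborel) = ennreal (min 1 (f x))" .
  qed
  finally show ?thesis .
qed

text \<open>Since \<open>f\<close> and \<open>g\<close> both exceed every level below 1, their level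
  sets are nonempty together, and the additive inequality for sets applies at each level.
  Integrating over the levels gives a sum on the left, which is stronger than the product
  form.\<close>

lemma prekopa_leindler_sup_one:
  fixes f g h :: "real \<Rightarrow> real"
  assumes [measurable]: "f \<in> borel_measurable borel" "g \<in> borel_measurable borel" "h \<in> borel_measurable borel"
    and nn: "\<And>x. 0 \<le> f x" "\<And>x. 0 \<le> g x" "\<And>x. 0 \<le> h x" and le1: "\<And>x. f x \<le> 1" "\<And>x. g x \<le> 1"
    and sup: "\<And>t. t < 1 \<Longrightarrow> \<exists>x. t < f x" "\<And>t. t < 1 \<Longrightarrow> \<exists>x. t < g x"
    and bdd: "\<And>t. 0 < t \<Longrightarrow> bounded {x. t < f x}" "\<And>t. 0 < t \<Longrightarrow> bounded {x. t < g x}"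
    and mid: "\<And>x y. f x * g y \<le> (h ((x + y) / 2))\<^sup>2"
  shows "(\<integral>\<^sup>+ x. ennreal (f x) \<partial>lborel) + (\<integral>\<^sup>+ x. ennreal (g x) \<partial>lborel) \<le> 2 * (\<integral>\<^sup>+ x. ennreal (h x) \<partial>lborel)"
proof -
  have m: "(\<lambda>t. indicator {0<..<1} t * emeasure lborel {x. t < u x}) \<in> borel_measurable lborel"
    if [measurable]: "u \<in> borel_measurable borel" for u :: "real \<Rightarrow> real"
  proof -
    have "{p \<in> space (borel \<Otimes>\<^sub>M borel). fst p < u (snd p)} \<in> sets (borel \<Otimes>\<^sub>M borel)" by measurable
    moreover have "{p \<in> space (borel \<Otimes>\<^sub>M borel). fst p < u (snd p)} = {(t, x). t < u x}"
      by (auto simp: space_pair_measure)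
    ultimately have "(\<lambda>t. emeasure lborel (Pair t -` {(t, x). t < u x})) \<in> borel_measurable lborel"
      by (intro lborel.measurable_emeasure_Pair) simp
    then show ?thesis by (simp add: vimage_def)
  qed
  have "(\<integral>\<^sup>+ x. ennreal (f x) \<partial>lborel) + (\<integral>\<^sup>+ x. ennreal (g x) \<partial>lborel) =
     (\<integral>\<^sup>+ t. indicator {0<..<1} t * emeasure lborel {x. t < f x} + indicator {0<..<1} t * emeasure lborel {x. t < g x} \<partial>lborel)"
    using m le1 by (subst nn_integral_add) (auto simp: layer_cake_unit nn min_absorb2)
  also have "\<dots> \<le> (\<integral>\<^sup>+ t. 2 * (indicator {0<..<1} t * emeasure lborel {x. t < h x}) \<partial>lborel)"
  proof (intro nn_integral_mono)
    fix t :: real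
    have "emeasure lborel {x. t < f x} + emeasure lborel {x. t < g x} \<le> 2 * emeasure lborel {x. t < h x}"
      if t: "0 < t" "t < 1"
    proof (rule midpoint_brunn_minkowski)
      fix x y assume "x \<in> {x. t < f x}" "y \<in> {x. t < g x}"
      then have "t * t < f x * g y" using t by (intro mult_strict_mono) auto
      then have "t\<^sup>2 < (h ((x + y) / 2))\<^sup>2" using mid[of x y] by (simp add: power2_eq_square)
      then show "(x + y) / 2 \<in> {x. t < h x}" using nn(3) power2_less_imp_less by auto
    qed (use sup t bdd in \<open>auto intro: bounded_imp_bdd_above bounded_imp_bdd_below\<close>)
    then show "indicator {0<..<1} t * emeasure lborel {x. t < f x} + indicator {0<..<1} t * emeasure lborel {x. t < g x}
      \<le> 2 * (indicator {0<..<1} t * emeasure lborel {x. t < h x})"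
      by (auto simp: indicator_def)
  qed
  also have "\<dots> = 2 * (\<integral>\<^sup>+ x. ennreal (min 1 (h x)) \<partial>lborel)"
    using m[of h] by (subst nn_integral_cmult) (auto simp: layer_cake_unit nn)
  also have "\<dots> \<le> 2 * (\<integral>\<^sup>+ x. ennreal (h x) \<partial>lborel)"
    by (intro mult_left_mono nn_integral_mono ennreal_leI) auto
  finally show ?thesis .
qed

text \<open>Dividing by the suprema achieves the normalisation to 1; \<open>h\<close> must then be
  divided by \<open>sqrt (a * b)\<close>, and the sum becomes a product by the arithmetic-geometric
  mean inequality.\<close>

lemma prekopa_leindler:
  fixes f g h :: "real \<Rightarrow> real"
  assumes int: "integrable lborel f" "integrable lborel g" "integrable lborel h"
    and nn: "\<And>x. 0 \<le> f x" "\<And>x. 0 \<le> g x" "\<And>x. 0 \<le> h x" and le: "\<And>x. f x \<le> K" "\<And>x. g x \<le> K"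
    and bdd: "\<And>t. 0 < t \<Longrightarrow> bounded {x. t < f x}" "\<And>t. 0 < t \<Longrightarrow> bounded {x. t < g x}"
    and mid: "\<And>x y. f x * g y \<le> (h ((x + y) / 2))\<^sup>2"
  shows "(\<integral>x. f x \<partial>lborel) * (\<integral>x. g x \<partial>lborel) \<le> (\<integral>x. h x \<partial>lborel)\<^sup>2"
proof -
  have [measurable]: "f \<in> borel_measurable borel" "g \<in> borel_measurable borel" "h \<in> borel_measurable borel"
    using int[THEN borel_measurable_integrable] by simp_all
  define a where "a = Sup (range f)"
  define b where "b = Sup (range g)"
  have fa: "f x \<le> a" for x unfolding a_def using le by (intro cSup_upper) (auto intro!: bdd_aboveI)
  have gb: "g x \<le> b" for x unfolding b_def using le by (intro cSup_upper) (auto intro!: bdd_aboveI)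
  consider "a = 0" | "b = 0" | "a > 0" "b > 0"
    using fa[of 0] gb[of 0] nn(1,2)[of 0] by linarith
  then show ?thesis
  proof cases
    case 1
    then have "f x = 0" for x using fa[of x] nn(1)[of x] by linarith
    then show ?thesis by simp
  next
    case 2
    then have "g x = 0" for x using gb[of x] nn(2)[of x] by linarith
    then show ?thesis by simp
  next
    case 3
    have "(\<integral>\<^sup>+ x. ennreal (f x / a) \<partial>lborel) + (\<integral>\<^sup>+ x. ennreal (g x / b) \<partial>lborel) \<le>
       2 * (\<integral>\<^sup>+ x. ennreal (h x / sqrt (a * b)) \<partial>lborel)"
    proof (rule prekopa_leindler_sup_one)
      show "\<exists>x. t < f x / a" if "t < 1" for t
      proof -
        have "t * a < a" using that 3 by simp
        then obtain x where "t * a < f x" unfolding a_def using less_cSupE[of _ "range f"] by auto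
        then show ?thesis using 3 by (auto simp: pos_less_divide_eq)
      qed
      show "\<exists>x. t < g x / b" if "t < 1" for t
      proof -
        have "t * b < b" using that 3 by simp
        then obtain x where "t * b < g x" unfolding b_def using less_cSupE[of _ "range g"] by auto
        then show ?thesis using 3 by (auto simp: pos_less_divide_eq)
      qed
      show "bounded {x. t < f x / a}" if "0 < t" for t using bdd(1)[of "t * a"] that 3 by (simp add: pos_less_divide_eq)
      show "bounded {x. t < g x / b}" if "0 < t" for t using bdd(2)[of "t * b"] that 3 by (simp add: pos_less_divide_eq)
      show "f x / a * (g y / b) \<le> (h ((x + y) / 2) / sqrt (a * b))\<^sup>2" for x y
        using mid[of x y] 3 by (simp add: power_divide divide_right_mono)
    qed (use nn 3 fa gb in auto)
    then have pl: "ennreal ((\<integral>x. f x \<partial>lborel) / a) + ennreal ((\<integral>x. g x \<partial>lborel) / b) \<le> 2 * ennreal ((\<integral>x. h x \<partial>lborel) / sqrt (a * b))"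
      using int nn 3 by (simp add: nn_integral_eq_integral)
    then have "ennreal ((\<integral>x. f x \<partial>lborel) / a + (\<integral>x. g x \<partial>lborel) / b) \<le> ennreal (2 * ((\<integral>x. h x \<partial>lborel) / sqrt (a * b)))"
    proof -
      have "2 * ennreal w = ennreal (2 * w)" if "0 \<le> w" for w
        using ennreal_mult[of 2 w] that by simp
      then have "2 * ennreal ((\<integral>x. h x \<partial>lborel) / sqrt (a * b)) = ennreal (2 * ((\<integral>x. h x \<partial>lborel) / sqrt (a * b)))"
        using nn 3 by simp
      moreover have "ennreal ((\<integral>x. f x \<partial>lborel) / a + (\<integral>x. g x \<partial>lborel) / b) = ennreal ((\<integral>x. f x \<partial>lborel) / a) + ennreal ((\<integral>x. g x \<partial>lborel) / b)"
        using nn 3 by (intro ennreal_plus) auto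
      ultimately show ?thesis using pl by (simp only:)
    qed
    then have le: "(\<integral>x. f x \<partial>lborel) / a + (\<integral>x. g x \<partial>lborel) / b \<le> 2 * ((\<integral>x. h x \<partial>lborel) / sqrt (a * b))"
      using nn 3 by (subst (asm) ennreal_le_iff) auto
    define u where "u = (\<integral>x. f x \<partial>lborel) / a"
    define v where "v = (\<integral>x. g x \<partial>lborel) / b"
    define w where "w = (\<integral>x. h x \<partial>lborel) / sqrt (a * b)"
    have uv: "0 \<le> u" "0 \<le> v" using nn 3 by (auto simp: u_def v_def)
    have "4 * (u * v) \<le> (u + v)\<^sup>2" using sum_squares_bound[of u v] by (simp add: power2_sum)
    also have "\<dots> \<le> (2 * w)\<^sup>2" using le uv by (intro power_mono) (auto simp: u_def v_def w_def)
    finally have "u * v \<le> w\<^sup>2" by (simp add: power_mult_distrib)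
    then show ?thesis using 3 by (simp add: u_def v_def w_def power_divide divide_simps)
  qed
qed

text \<open>Midpoints and values in the unit interval are both preserved by averaging over an
  independent component, and bounded functions are integrable; this allows the passage to
  convolutions and to L^1 approximation.\<close>

definition midpoint_prekopa :: "'a::{banach, second_countable_topology} measure \<Rightarrow> bool" where
  "midpoint_prekopa \<mu> \<longleftrightarrow> (\<forall>f g h :: 'a \<Rightarrow> real.
     f \<in> borel_measurable borel \<longrightarrow> g \<in> borel_measurable borel \<longrightarrow> h \<in> borel_measurable borel \<longrightarrow>
     (\<forall>x. f x \<in> {0..1}) \<longrightarrow> (\<forall>x. g x \<in> {0..1}) \<longrightarrow> (\<forall>x. h x \<in> {0..1}) \<longrightarrow>
     (\<forall>x y. f x * g y \<le> (h ((1/2) *\<^sub>R (x + y)))\<^sup>2) \<longrightarrow>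
     (\<integral>x. f x \<partial>\<mu>) * (\<integral>x. g x \<partial>\<mu>) \<le> (\<integral>x. h x \<partial>\<mu>)\<^sup>2)"

lemma midpoint_prekopaD:
  fixes f g h :: "'a::{banach, second_countable_topology} \<Rightarrow> real"
  assumes "midpoint_prekopa \<mu>"
    and "f \<in> borel_measurable borel" "g \<in> borel_measurable borel" "h \<in> borel_measurable borel"
    and "\<And>x. f x \<in> {0..1}" "\<And>x. g x \<in> {0..1}" "\<And>x. h x \<in> {0..1}"
    and "\<And>x y. f x * g y \<le> (h ((1/2) *\<^sub>R (x + y)))\<^sup>2"
  shows "(\<integral>x. f x \<partial>\<mu>) * (\<integral>x. g x \<partial>\<mu>) \<le> (\<integral>x. h x \<partial>\<mu>)\<^sup>2"
  using assms(1)[unfolded midpoint_prekopa_def, rule_format, of f g h] assms(2-) by blast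

text \<open>The Gaussian density is itself log-concave and is absorbed into the three functions. Its
  decay makes the level sets bounded, whatever the functions are.\<close>

lemma midpoint_prekopa_gaussian_line:
  fixes c :: "'a::{banach, second_countable_topology}"
  shows "midpoint_prekopa (distr std_normal_distribution borel (\<lambda>t. t *\<^sub>R c))"
  unfolding midpoint_prekopa_def
proof (intro allI impI)
  fix f g h :: "'a \<Rightarrow> real"
  assume [measurable]: "f \<in> borel_measurable borel" "g \<in> borel_measurable borel" "h \<in> borel_measurable borel"
    and 01: "\<forall>x. f x \<in> {0..1}" "\<forall>x. g x \<in> {0..1}" "\<forall>x. h x \<in> {0..1}"
    and mid: "\<forall>x y. f x * g y \<le> (h ((1/2) *\<^sub>R (x + y)))\<^sup>2"
  let ?n = "std_normal_density"
  \<comment> \<open>The first bound yields the constant \<open>K = 1\<close>; the second, from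
    \<open>1 + y \<le> exp y\<close>, is just enough decay for bounded level sets.\<close>
  have n_le: "?n x \<le> 1" "?n x \<le> 1 / (1 + x\<^sup>2 / 2)" for x
  proof -
    have "?n x \<le> exp (- x\<^sup>2 / 2)"
      unfolding std_normal_density_def using pi_gt3 by (intro mult_left_le_one_le) (auto simp: field_simps)
    moreover have "exp (- x\<^sup>2 / 2) \<le> 1 / (1 + x\<^sup>2 / 2)"
      using exp_ge_add_one_self[of "x\<^sup>2 / 2"] by (simp add: exp_minus field_simps add_pos_nonneg)
    ultimately show "?n x \<le> 1 / (1 + x\<^sup>2 / 2)" by linarith
    also have "\<dots> \<le> 1" by (simp add: add_pos_nonneg)
    finally show "?n x \<le> 1" .
  qed
  have eq: "(\<integral>x. u x \<partial>distr std_normal_distribution borel (\<lambda>t. t *\<^sub>R c)) = (\<integral>t. ?n t * u (t *\<^sub>R c) \<partial>lborel)"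
    and int: "integrable lborel (\<lambda>t. ?n t * u (t *\<^sub>R c))"
    if [measurable]: "u \<in> borel_measurable borel" and u: "\<forall>x. u x \<in> {0..1}" for u :: "'a \<Rightarrow> real"
  proof -
    show "(\<integral>x. u x \<partial>distr std_normal_distribution borel (\<lambda>t. t *\<^sub>R c)) = (\<integral>t. ?n t * u (t *\<^sub>R c) \<partial>lborel)"
      by (subst integral_distr) (simp_all add: integral_density)
    show "integrable lborel (\<lambda>t. ?n t * u (t *\<^sub>R c))"
    proof (rule Bochner_Integration.integrable_bound)
      show "integrable lborel ?n" by simp
      show "AE t in lborel. norm (?n t * u (t *\<^sub>R c)) \<le> norm (?n t)"
        using u by (intro AE_I2) (simp add: abs_mult mult_left_le)
    qed simp
  qed
  have le: "?n t * u (t *\<^sub>R c) \<le> ?n t" if "\<forall>x. u x \<in> {0..1}" for u :: "'a \<Rightarrow> real" and t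
    using that by (simp add: mult_left_le)
  have bdd: "bounded {t. s < ?n t * u (t *\<^sub>R c)}" if "0 < s" "\<forall>x. u x \<in> {0..1}" for u :: "'a \<Rightarrow> real" and s
  proof (rule boundedI)
    fix x assume "x \<in> {t. s < ?n t * u (t *\<^sub>R c)}"
    then have "s < 1 / (1 + x\<^sup>2 / 2)" using le[OF that(2), of x] n_le(2)[of x] by simp
    then have "s * (1 + x\<^sup>2 / 2) < 1" by (simp add: pos_less_divide_eq add_pos_nonneg)
    then have "s * (x\<^sup>2 / 2) < 1" using that(1) by (simp add: distrib_left)
    then have "x\<^sup>2 \<le> 2 / s" using that(1) by (simp add: field_simps)
    then show "norm x \<le> sqrt (2 / s)" by (simp add: real_le_rsqrt)
  qed
  show "(\<integral>x. f x \<partial>distr std_normal_distribution borel (\<lambda>t. t *\<^sub>R c)) * (\<integral>x. g x \<partial>distr std_normal_distribution borel (\<lambda>t. t *\<^sub>R c))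
     \<le> (\<integral>x. h x \<partial>distr std_normal_distribution borel (\<lambda>t. t *\<^sub>R c))\<^sup>2"
    unfolding eq[OF \<open>f \<in> _\<close> 01(1)] eq[OF \<open>g \<in> _\<close> 01(2)] eq[OF \<open>h \<in> _\<close> 01(3)]
  proof (rule prekopa_leindler[where K = 1])
    fix x y :: real
    have "exp (- x\<^sup>2 / 2) * exp (- y\<^sup>2 / 2) \<le> (exp (- ((x + y) / 2)\<^sup>2 / 2))\<^sup>2"
    proof -
      have "0 \<le> (x - y)\<^sup>2" by simp
      then have "- x\<^sup>2 / 2 + - y\<^sup>2 / 2 \<le> 2 * (- ((x + y) / 2)\<^sup>2 / 2)"
        by (simp add: power2_eq_square field_simps)
      then show ?thesis by (simp flip: exp_add exp_of_nat_mult add: power2_eq_square)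
    qed
    then have "(1 / sqrt (2 * pi))\<^sup>2 * (exp (- x\<^sup>2 / 2) * exp (- y\<^sup>2 / 2)) \<le> (1 / sqrt (2 * pi))\<^sup>2 * (exp (- ((x + y) / 2)\<^sup>2 / 2))\<^sup>2"
      by (rule mult_left_mono) simp
    then have n: "?n x * ?n y \<le> (?n ((x + y) / 2))\<^sup>2"
      unfolding std_normal_density_def by (simp add: power_mult_distrib power2_eq_square mult_ac)
    have "f (x *\<^sub>R c) * g (y *\<^sub>R c) \<le> (h (((x + y) / 2) *\<^sub>R c))\<^sup>2"
      using mid[rule_format, of "x *\<^sub>R c" "y *\<^sub>R c"] by (simp add: scaleR_add_left[symmetric])
    then have "(?n x * ?n y) * (f (x *\<^sub>R c) * g (y *\<^sub>R c)) \<le> (?n ((x + y) / 2))\<^sup>2 * (h (((x + y) / 2) *\<^sub>R c))\<^sup>2"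
      using n 01 by (intro mult_mono) auto
    then show "?n x * f (x *\<^sub>R c) * (?n y * g (y *\<^sub>R c)) \<le> (?n ((x + y) / 2) * h (((x + y) / 2) *\<^sub>R c))\<^sup>2"
      by (simp add: power_mult_distrib mult_ac)
    show "?n x * f (x *\<^sub>R c) \<le> 1" "?n x * g (x *\<^sub>R c) \<le> 1"
      by (rule order.trans[OF le[OF 01(1)] n_le(1)], rule order.trans[OF le[OF 01(2)] n_le(1)])
  qed (use 01 int bdd in auto)
qed

section \<open>Convolutions and tensorisation of the inequality\<close>

definition convolution_measure :: "'a::{banach, second_countable_topology} measure \<Rightarrow> 'a measure \<Rightarrow> 'a measure" where
  "convolution_measure \<mu> \<nu> = distr (\<mu> \<Otimes>\<^sub>M \<nu>) borel (\<lambda>(x, y). x + y)"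

locale borel_prob_pair = K: prob_space K + R: prob_space R
  for K R :: "'a::{banach, second_countable_topology} measure" +
  assumes sets_K [simp, measurable_cong]: "sets K = sets borel" and sets_R [simp, measurable_cong]: "sets R = sets borel"
begin

sublocale KR: pair_prob_space K R ..

lemma measurable_plus [measurable]: "(\<lambda>(x, y). x + y) \<in> borel_measurable (K \<Otimes>\<^sub>M R)"
  unfolding split_beta by measurable

lemma nn_integral_convolution:
  assumes [measurable]: "f \<in> borel_measurable borel"
  shows "(\<integral>\<^sup>+ x. f x \<partial>convolution_measure K R) = (\<integral>\<^sup>+ z. (\<integral>\<^sup>+ u. f (u + z) \<partial>K) \<partial>R)"
    and "(\<integral>\<^sup>+ x. f x \<partial>convolution_measure K R) = (\<integral>\<^sup>+ u. (\<integral>\<^sup>+ z. f (u + z) \<partial>R) \<partial>K)"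
proof -
  have m: "(\<lambda>(u, z). f (u + z)) \<in> borel_measurable (K \<Otimes>\<^sub>M R)" unfolding split_beta by measurable
  have "(\<integral>\<^sup>+ x. f x \<partial>convolution_measure K R) = (\<integral>\<^sup>+ p. (\<lambda>(u, z). f (u + z)) p \<partial>(K \<Otimes>\<^sub>M R))"
    unfolding convolution_measure_def by (subst nn_integral_distr) (auto simp: case_prod_unfold)
  then show "(\<integral>\<^sup>+ x. f x \<partial>convolution_measure K R) = (\<integral>\<^sup>+ z. (\<integral>\<^sup>+ u. f (u + z) \<partial>K) \<partial>R)"
    "(\<integral>\<^sup>+ x. f x \<partial>convolution_measure K R) = (\<integral>\<^sup>+ u. (\<integral>\<^sup>+ z. f (u + z) \<partial>R) \<partial>K)"
    using KR.nn_integral_snd[OF m] R.nn_integral_fst[OF m] by simp_all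
qed

lemma integrable_convolution:
  fixes f :: "'a \<Rightarrow> real"
  assumes f: "integrable (convolution_measure K R) f"
  shows "integrable (K \<Otimes>\<^sub>M R) (\<lambda>(u, z). f (u + z))"
    and "(\<integral>x. f x \<partial>convolution_measure K R) = (\<integral>z. (\<integral>u. f (u + z) \<partial>K) \<partial>R)"
proof -
  have [measurable]: "f \<in> borel_measurable borel" using f[THEN borel_measurable_integrable] by (simp add: convolution_measure_def)
  show i: "integrable (K \<Otimes>\<^sub>M R) (\<lambda>(u, z). f (u + z))"
    using f unfolding convolution_measure_def by (subst (asm) integrable_distr_eq) (auto simp: case_prod_unfold)
  have "(\<integral>x. f x \<partial>convolution_measure K R) = (\<integral>p. (\<lambda>(u, z). f (u + z)) p \<partial>(K \<Otimes>\<^sub>M R))"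
    unfolding convolution_measure_def by (subst integral_distr) (auto simp: case_prod_unfold)
  also have "\<dots> = (\<integral>z. (\<integral>u. f (u + z) \<partial>K) \<partial>R)"
    using KR.integral_snd[OF i] by simp
  finally show "(\<integral>x. f x \<partial>convolution_measure K R) = (\<integral>z. (\<integral>u. f (u + z) \<partial>K) \<partial>R)" .
qed

lemma prob_space_convolution: "prob_space (convolution_measure K R)"
  unfolding convolution_measure_def by (rule KR.P.prob_space_distr) simp

lemma sets_convolution [simp]: "sets (convolution_measure K R) = sets borel"
  by (simp add: convolution_measure_def)

lemma measurable_average:
  fixes f :: "'a \<Rightarrow> real"
  assumes [measurable]: "f \<in> borel_measurable borel"
  shows "(\<lambda>z. \<integral>u. f (u + z) \<partial>K) \<in> borel_measurable borel" "(\<lambda>u. \<integral>z. f (u + z) \<partial>R) \<in> borel_measurable borel"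
proof -
  have "(\<lambda>z. \<integral>u. f (u + z) \<partial>K) \<in> borel_measurable R"
    by (rule K.borel_measurable_lebesgue_integral) (simp add: split_beta)
  then show "(\<lambda>z. \<integral>u. f (u + z) \<partial>K) \<in> borel_measurable borel"
    unfolding measurable_cong_sets[OF sets_R refl] .
  have "(\<lambda>u. \<integral>z. f (u + z) \<partial>R) \<in> borel_measurable K"
    by (rule R.borel_measurable_lebesgue_integral) (simp add: split_beta)
  then show "(\<lambda>u. \<integral>z. f (u + z) \<partial>R) \<in> borel_measurable borel"
    unfolding measurable_cong_sets[OF sets_K refl] .
qed

lemma average_in_unit:
  fixes f :: "'a \<Rightarrow> real"
  assumes [measurable]: "f \<in> borel_measurable borel" and "\<And>x. f x \<in> {0..1}"
  shows "(\<integral>u. f u \<partial>K) \<in> {0..1}"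
proof -
  have "integrable K f" using assms(2) by (intro K.integrable_const_bound[where B = 1]) auto
  then have "(\<integral>u. f u \<partial>K) \<le> 1" using assms(2) by (intro K.integral_le_const) auto
  moreover have "0 \<le> (\<integral>u. f u \<partial>K)" using assms(2) by (intro integral_nonneg_AE) auto
  ultimately show ?thesis by simp
qed

text \<open>For fixed shifts \<open>z\<close> and \<open>w\<close>, the inequality for
  \<open>K\<close> shows that the averages over \<open>K\<close>, as functions of the shift, satisfy
  the hypothesis of the inequality for \<open>R\<close>.\<close>

lemma midpoint_prekopa_convolution:
  assumes K: "midpoint_prekopa K" and R: "midpoint_prekopa R"
  shows "midpoint_prekopa (convolution_measure K R)"
  unfolding midpoint_prekopa_def
proof (intro allI impI)
  fix f g h :: "'a \<Rightarrow> real"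
  assume m [measurable]: "f \<in> borel_measurable borel" "g \<in> borel_measurable borel" "h \<in> borel_measurable borel"
    and 01: "\<forall>x. f x \<in> {0..1}" "\<forall>x. g x \<in> {0..1}" "\<forall>x. h x \<in> {0..1}"
    and mid: "\<forall>x y. f x * g y \<le> (h ((1/2) *\<^sub>R (x + y)))\<^sup>2"
  interpret C: prob_space "convolution_measure K R" by (rule prob_space_convolution)
  have eq: "(\<integral>x. u x \<partial>convolution_measure K R) = (\<integral>z. (\<integral>v. u (v + z) \<partial>K) \<partial>R)"
    if [measurable]: "u \<in> borel_measurable borel" and "\<forall>x. u x \<in> {0..1}" for u :: "'a \<Rightarrow> real"
    using that(2) by (intro integrable_convolution(2) C.integrable_const_bound[where B = 1])
      (auto simp: measurable_cong_sets[OF sets_convolution refl])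
  have av: "(\<integral>v. u (v + z) \<partial>K) \<in> {0..1}"
    if [measurable]: "u \<in> borel_measurable borel" and "\<forall>x. u x \<in> {0..1}" for u :: "'a \<Rightarrow> real" and z
    using that(2) by (intro average_in_unit) auto
  have "(\<integral>v. f (v + z) \<partial>K) * (\<integral>v. g (v + w) \<partial>K) \<le> (\<integral>v. h (v + (1/2) *\<^sub>R (z + w)) \<partial>K)\<^sup>2" for z w
  proof (rule midpoint_prekopaD[OF K])
    fix x y
    have "(1/2) *\<^sub>R ((x + z) + (y + w)) = (1/2) *\<^sub>R (x + y) + (1/2) *\<^sub>R (z + w)" by (simp add: algebra_simps)
    then show "f (x + z) * g (y + w) \<le> (h ((1/2) *\<^sub>R (x + y) + (1/2) *\<^sub>R (z + w)))\<^sup>2"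
      using mid by metis
  qed (use 01 in auto)
  then show "(\<integral>x. f x \<partial>convolution_measure K R) * (\<integral>x. g x \<partial>convolution_measure K R) \<le> (\<integral>x. h x \<partial>convolution_measure K R)\<^sup>2"
    unfolding eq[OF m(1) 01(1)] eq[OF m(2) 01(2)] eq[OF m(3) 01(3)]
    by (intro midpoint_prekopaD[OF R] measurable_average m av 01)
qed

end

section \<open>Cylindrical approximation\<close>

context borel_prob_pair
begin

text \<open>\<open>c\<close> almost surely ignores the component distributed as \<open>R\<close>, so
  its average over \<open>K\<close> is constant in \<open>z\<close> and its average over
  \<open>R\<close> is \<open>c\<close> itself. Each replacement of \<open>f\<close> by
  \<open>c\<close> costs \<open>e\<close>, and two are made.\<close>

lemma
  fixes f c :: "'a \<Rightarrow> real"
  assumes f: "integrable (convolution_measure K R) f" and c: "integrable (convolution_measure K R) c"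
    and inv: "AE z in R. \<forall>u. c (u + z) = c u"
    and e: "(\<integral>\<^sup>+ x. ennreal \<bar>f x - c x\<bar> \<partial>convolution_measure K R) \<le> e"
  shows average_K_near_const: "(\<integral>\<^sup>+ z. ennreal \<bar>(\<integral>u. f (u + z) \<partial>K) - (\<integral>x. f x \<partial>convolution_measure K R)\<bar> \<partial>R) \<le> 2 * e"
    and average_R_near_self: "(\<integral>\<^sup>+ u. (\<integral>\<^sup>+ z. ennreal \<bar>f (u + z) - (\<integral>w. f (u + w) \<partial>R)\<bar> \<partial>R) \<partial>K) \<le> 2 * e"
proof -
  let ?C = "convolution_measure K R"
  have fm [measurable]: "f \<in> borel_measurable borel" using f[THEN borel_measurable_integrable] by (simp add: convolution_measure_def)
  have cm [measurable]: "c \<in> borel_measurable borel" using c[THEN borel_measurable_integrable] by (simp add: convolution_measure_def)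
  have dm [measurable]: "(\<lambda>x. ennreal \<bar>f x - c x\<bar>) \<in> borel_measurable borel" by measurable
  note If = integrable_convolution(1)[OF f] and Ic = integrable_convolution(1)[OF c]
  have abs_int: "ennreal \<bar>\<integral>x. w x \<partial>N\<bar> \<le> (\<integral>\<^sup>+ x. ennreal \<bar>w x\<bar> \<partial>N)" if "integrable N w" for N and w :: "'a \<Rightarrow> real"
    using integral_norm_bound_ennreal[OF that] by simp
  show "(\<integral>\<^sup>+ z. ennreal \<bar>(\<integral>u. f (u + z) \<partial>K) - (\<integral>x. f x \<partial>?C)\<bar> \<partial>R) \<le> 2 * e"
  proof -
    have "AE z in R. (\<integral>u. c (u + z) \<partial>K) = (\<integral>u. c u \<partial>K)"
      using inv by eventually_elim simp
    then have "(\<integral>z. (\<integral>u. c (u + z) \<partial>K) \<partial>R) = (\<integral>z. (\<integral>u. c u \<partial>K) \<partial>R)"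
      using measurable_average(1)[OF cm] by (intro integral_cong_AE) auto
    then have \<kappa>: "(\<integral>x. c x \<partial>?C) = (\<integral>u. c u \<partial>K)"
      using integrable_convolution(2)[OF c] by (simp add: R.prob_space)
    have "ennreal \<bar>(\<integral>x. c x \<partial>?C) - (\<integral>x. f x \<partial>?C)\<bar> = ennreal \<bar>\<integral>x. f x - c x \<partial>?C\<bar>"
      using f c by (simp add: abs_minus_commute)
    also have "\<dots> \<le> e" using abs_int[OF Bochner_Integration.integrable_diff[OF f c]] e by (rule order.trans)
    finally have 1: "ennreal \<bar>(\<integral>x. c x \<partial>?C) - (\<integral>x. f x \<partial>?C)\<bar> \<le> e" .
    have "AE z in R. ennreal \<bar>(\<integral>u. f (u + z) \<partial>K) - (\<integral>x. f x \<partial>?C)\<bar> \<le> (\<integral>\<^sup>+ u. ennreal \<bar>f (u + z) - c (u + z)\<bar> \<partial>K) + e"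
      using KR.AE_integrable_snd[OF If] KR.AE_integrable_snd[OF Ic] inv
    proof eventually_elim
      case (elim z)
      have "(\<integral>u. f (u + z) \<partial>K) - (\<integral>x. f x \<partial>?C) = (\<integral>u. f (u + z) - c (u + z) \<partial>K) + ((\<integral>x. c x \<partial>?C) - (\<integral>x. f x \<partial>?C))"
        using elim \<kappa> by simp
      then have "ennreal \<bar>(\<integral>u. f (u + z) \<partial>K) - (\<integral>x. f x \<partial>?C)\<bar> \<le>
          ennreal (\<bar>\<integral>u. f (u + z) - c (u + z) \<partial>K\<bar> + \<bar>(\<integral>x. c x \<partial>?C) - (\<integral>x. f x \<partial>?C)\<bar>)"
        by (intro ennreal_leI) linarith
      also have "\<dots> = ennreal \<bar>\<integral>u. f (u + z) - c (u + z) \<partial>K\<bar> + ennreal \<bar>(\<integral>x. c x \<partial>?C) - (\<integral>x. f x \<partial>?C)\<bar>"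
        by (rule ennreal_plus) simp_all
      also have "\<dots> \<le> (\<integral>\<^sup>+ u. ennreal \<bar>f (u + z) - c (u + z)\<bar> \<partial>K) + e"
        using elim by (intro add_mono 1 abs_int Bochner_Integration.integrable_diff)
      finally show ?case .
    qed
    then have "(\<integral>\<^sup>+ z. ennreal \<bar>(\<integral>u. f (u + z) \<partial>K) - (\<integral>x. f x \<partial>?C)\<bar> \<partial>R) \<le>
        (\<integral>\<^sup>+ z. (\<integral>\<^sup>+ u. ennreal \<bar>f (u + z) - c (u + z)\<bar> \<partial>K) + e \<partial>R)"
      by (rule nn_integral_mono_AE)
    also have "\<dots> = (\<integral>\<^sup>+ x. ennreal \<bar>f x - c x\<bar> \<partial>?C) + e"
      by (subst nn_integral_add) (simp_all add: nn_integral_convolution(1)[OF dm] R.emeasure_space_1)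
    also have "\<dots> \<le> 2 * e" using e by (simp add: mult_2 add_right_mono)
    finally show ?thesis .
  qed
  show "(\<integral>\<^sup>+ u. (\<integral>\<^sup>+ z. ennreal \<bar>f (u + z) - (\<integral>w. f (u + w) \<partial>R)\<bar> \<partial>R) \<partial>K) \<le> 2 * e"
  proof -
    have "AE u in K. (\<integral>\<^sup>+ z. ennreal \<bar>f (u + z) - (\<integral>w. f (u + w) \<partial>R)\<bar> \<partial>R) \<le> 2 * (\<integral>\<^sup>+ z. ennreal \<bar>f (u + z) - c (u + z)\<bar> \<partial>R)"
      using KR.AE_integrable_fst[OF If] KR.AE_integrable_fst[OF Ic]
    proof eventually_elim
      case (elim u)
      let ?E = "\<integral>\<^sup>+ z. ennreal \<bar>f (u + z) - c (u + z)\<bar> \<partial>R"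
      have "(\<integral>w. c (u + w) \<partial>R) = (\<integral>w. c u \<partial>R)"
        using inv by (intro integral_cong_AE) auto
      then have "c u - (\<integral>w. f (u + w) \<partial>R) = (\<integral>w. c (u + w) - f (u + w) \<partial>R)"
        using elim by (simp add: R.prob_space)
      then have "ennreal \<bar>c u - (\<integral>w. f (u + w) \<partial>R)\<bar> \<le> (\<integral>\<^sup>+ z. ennreal \<bar>c (u + z) - f (u + z)\<bar> \<partial>R)"
        using abs_int[OF Bochner_Integration.integrable_diff[OF elim(2,1)]] by simp
      then have 2: "ennreal \<bar>c u - (\<integral>w. f (u + w) \<partial>R)\<bar> \<le> ?E" by (simp add: abs_minus_commute)
      have "(\<integral>\<^sup>+ z. ennreal \<bar>f (u + z) - (\<integral>w. f (u + w) \<partial>R)\<bar> \<partial>R) \<le> (\<integral>\<^sup>+ z. ennreal \<bar>f (u + z) - c (u + z)\<bar> + ?E \<partial>R)"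
      proof (rule nn_integral_mono_AE)
        show "AE z in R. ennreal \<bar>f (u + z) - (\<integral>w. f (u + w) \<partial>R)\<bar> \<le> ennreal \<bar>f (u + z) - c (u + z)\<bar> + ?E"
          using inv
        proof eventually_elim
          case (elim z)
          have "ennreal \<bar>f (u + z) - (\<integral>w. f (u + w) \<partial>R)\<bar> \<le> ennreal (\<bar>f (u + z) - c (u + z)\<bar> + \<bar>c u - (\<integral>w. f (u + w) \<partial>R)\<bar>)"
            using elim[rule_format, of u] by (intro ennreal_leI) linarith
          also have "\<dots> = ennreal \<bar>f (u + z) - c (u + z)\<bar> + ennreal \<bar>c u - (\<integral>w. f (u + w) \<partial>R)\<bar>"
            by (rule ennreal_plus) simp_all
          finally show ?case using 2 add_left_mono order.trans by blast
        qed
      qed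
      also have "\<dots> = ?E + ?E"
        by (subst nn_integral_add) (simp_all add: R.emeasure_space_1)
      finally show ?case by (simp add: mult_2)
    qed
    then have "(\<integral>\<^sup>+ u. (\<integral>\<^sup>+ z. ennreal \<bar>f (u + z) - (\<integral>w. f (u + w) \<partial>R)\<bar> \<partial>R) \<partial>K) \<le>
       (\<integral>\<^sup>+ u. 2 * (\<integral>\<^sup>+ z. ennreal \<bar>f (u + z) - c (u + z)\<bar> \<partial>R) \<partial>K)"
      by (rule nn_integral_mono_AE)
    also have "\<dots> = 2 * (\<integral>\<^sup>+ x. ennreal \<bar>f x - c x\<bar> \<partial>?C)"
      by (subst nn_integral_cmult) (simp_all add: nn_integral_convolution(2)[OF dm])
    also have "\<dots> \<le> 2 * e" using e by (intro mult_left_mono) auto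
    finally show ?thesis .
  qed
qed

end

text \<open>Invariance along the common kernel of the first \<open>n\<close> functionals avoids an
  explicit factorisation through \<open>n\<close> real coordinates and makes combinations of
  cylindrical functions immediate.\<close>

definition cylindrical :: "(nat \<Rightarrow> 'a::real_vector \<Rightarrow> real) \<Rightarrow> nat \<Rightarrow> ('a \<Rightarrow> 'b) \<Rightarrow> bool" where
  "cylindrical L n f \<longleftrightarrow> (\<forall>z. (\<forall>i<n. L i z = 0) \<longrightarrow> (\<forall>x. f (x + z) = f x))"

lemma cylindrical_mono: "cylindrical L n f \<Longrightarrow> n \<le> m \<Longrightarrow> cylindrical L m f"
  unfolding cylindrical_def by (meson less_le_trans)

lemma cylindrical_combine:
  assumes "cylindrical L n f" "cylindrical L m g"
  shows "cylindrical L (max n m) (\<lambda>x. H (f x) (g x))"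
  using cylindrical_mono[OF assms(1), of "max n m"] cylindrical_mono[OF assms(2), of "max n m"]
  by (simp add: cylindrical_def)

section \<open>Density of cylindrical sets and functions\<close>

context gaussian_measure
begin

text \<open>Induction over the generated sigma-algebra: approximability passes to complements
  because the symmetric difference does not change, and to countable unions by cutting to finitely
  many sets at a cost of \<open>e / 2\<close>.\<close>

lemma cylindrical_sets_dense:
  assumes L: "\<And>i. bounded_linear (L i)"
    and gen: "sets (borel :: 'a measure) = sigma_sets UNIV {{x. L i x \<le> r} | i r. True}"
    and A: "A \<in> sets borel" and "e > 0"
  shows "\<exists>n C. cylindrical L n (\<lambda>x. x \<in> C) \<and> C \<in> sets borel \<and> measure M ((A - C) \<union> (C - A)) < e"
  using A[unfolded gen] \<open>e > 0\<close>
proof (induction arbitrary: e)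
  case (Basic a)
  then obtain i r where a: "a = {x. L i x \<le> r}" by auto
  have "a \<in> sets borel" unfolding gen using Basic by (intro sigma_sets.Basic)
  moreover have "cylindrical L (Suc i) (\<lambda>x. x \<in> a)"
    using linear_simps(1)[OF L] by (simp add: cylindrical_def a)
  ultimately show ?case using Basic by (intro exI[of _ "Suc i"] exI[of _ a]) simp
next
  case Empty
  then show ?case by (intro exI[of _ 0] exI[of _ "{}"]) (simp add: cylindrical_def)
next
  case (Compl a)
  then obtain n C where C: "cylindrical L n (\<lambda>x. x \<in> C)" "C \<in> sets borel" "measure M ((a - C) \<union> (C - a)) < e" by blast
  have "((UNIV - a) - (UNIV - C)) \<union> ((UNIV - C) - (UNIV - a)) = (a - C) \<union> (C - a)" by auto
  then show ?case
    using C by (intro exI[of _ n] exI[of _ "UNIV - C"]) (auto simp: cylindrical_def)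
next
  case (Union a)
  have am: "a i \<in> sets borel" for i using Union(1)[of i] by (simp add: gen)
  have fin: "\<exists>n C. cylindrical L n (\<lambda>x. x \<in> C) \<and> C \<in> sets borel \<and> measure M (((\<Union>i<k. a i) - C) \<union> (C - (\<Union>i<k. a i))) < d"
    if "d > 0" for k :: nat and d
    using that
  proof (induction k arbitrary: d)
    case 0
    then show ?case by (intro exI[of _ 0] exI[of _ "{}"]) (simp add: cylindrical_def)
  next
    case (Suc k)
    obtain n C where C: "cylindrical L n (\<lambda>x. x \<in> C)" "C \<in> sets borel"
      "measure M (((\<Union>i<k. a i) - C) \<union> (C - (\<Union>i<k. a i))) < d / 2"
      using Suc.IH[of "d / 2"] Suc.prems by auto
    obtain m D where D: "cylindrical L m (\<lambda>x. x \<in> D)" "D \<in> sets borel" "measure M ((a k - D) \<union> (D - a k)) < d / 2"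
      using Union(2)[of "d / 2" k] Suc.prems by auto
    have "measure M (((\<Union>i<Suc k. a i) - (C \<union> D)) \<union> ((C \<union> D) - (\<Union>i<Suc k. a i))) \<le>
      measure M ((((\<Union>i<k. a i) - C) \<union> (C - (\<Union>i<k. a i))) \<union> ((a k - D) \<union> (D - a k)))"
      using am C D by (intro finite_measure_mono) (auto simp: less_Suc_eq)
    also have "\<dots> \<le> measure M (((\<Union>i<k. a i) - C) \<union> (C - (\<Union>i<k. a i))) + measure M ((a k - D) \<union> (D - a k))"
      using am C D by (intro measure_Un_le) auto
    also have "\<dots> < d" using C D by simp
    finally show ?case
      using cylindrical_combine[OF C(1) D(1), of "(\<or>)"] C(2) D(2)
      by (intro exI[of _ "max n m"] exI[of _ "C \<union> D"]) auto
  qed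
  have "(\<lambda>k. measure M (\<Union>i<k. a i)) \<longlonglongrightarrow> measure M (\<Union>k. \<Union>i<k. a i)"
    using am by (intro finite_Lim_measure_incseq) (auto simp: incseq_def, meson lessThan_iff less_le_trans)
  also have "(\<Union>k. \<Union>i<k. a i) = (\<Union>i. a i)" by blast
  finally have "eventually (\<lambda>k. measure M (\<Union>i. a i) - e / 2 < measure M (\<Union>i<k. a i)) sequentially"
    using Union.prems by (intro order_tendstoD) auto
  then obtain k where k: "measure M (\<Union>i. a i) - e / 2 < measure M (\<Union>i<k. a i)"
    by (auto dest: eventually_happens)
  obtain n C where C: "cylindrical L n (\<lambda>x. x \<in> C)" "C \<in> sets borel"
      "measure M (((\<Union>i<k. a i) - C) \<union> (C - (\<Union>i<k. a i))) < e / 2"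
    using fin[of "e / 2" k] Union.prems by auto
  have "measure M ((\<Union>i. a i) - (\<Union>i<k. a i)) = measure M (\<Union>i. a i) - measure M (\<Union>i<k. a i)"
    using am by (intro finite_measure_Diff) auto
  then have d: "measure M ((\<Union>i. a i) - (\<Union>i<k. a i)) < e / 2" using k by simp
  have "measure M (((\<Union>i. a i) - C) \<union> (C - (\<Union>i. a i))) \<le>
     measure M (((\<Union>i. a i) - (\<Union>i<k. a i)) \<union> (((\<Union>i<k. a i) - C) \<union> (C - (\<Union>i<k. a i))))"
    using am C by (intro finite_measure_mono) auto
  also have "\<dots> \<le> measure M ((\<Union>i. a i) - (\<Union>i<k. a i)) + measure M (((\<Union>i<k. a i) - C) \<union> (C - (\<Union>i<k. a i)))"
    using am C by (intro measure_Un_le) auto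
  also have "\<dots> < e" using d C by simp
  finally show ?case using C by blast
qed

lemma cylindrical_functions_dense:
  fixes f :: "'a \<Rightarrow> real"
  assumes L: "\<And>i. bounded_linear (L i)"
    and gen: "sets (borel :: 'a measure) = sigma_sets UNIV {{x. L i x \<le> r} | i r. True}"
    and f: "integrable M f" and "e > 0"
  shows "\<exists>n c. cylindrical L n c \<and> integrable M c \<and> (\<integral>x. \<bar>f x - c x\<bar> \<partial>M) < e"
  using f \<open>e > 0\<close>
proof (induction arbitrary: e rule: integrable_induct)
  case (base A r)
  have A: "A \<in> sets borel" using base by simp
  \<comment> \<open>The added 1 covers \<open>r = 0\<close> and makes the final estimate
    strict.\<close>
  define d where "d = e / (1 + \<bar>r\<bar>)"
  have d: "d > 0" using base by (simp add: d_def add_pos_nonneg)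
  obtain n C where C: "cylindrical L n (\<lambda>x. x \<in> C)" "C \<in> sets borel" "measure M ((A - C) \<union> (C - A)) < d"
    using cylindrical_sets_dense[OF L gen A d] by blast
  have "(\<integral>x. \<bar>indicator A x *\<^sub>R r - indicator C x *\<^sub>R r\<bar> \<partial>M) = (\<integral>x. \<bar>r\<bar> * indicator ((A - C) \<union> (C - A)) x \<partial>M)"
    by (intro Bochner_Integration.integral_cong) (auto simp: indicator_def)
  also have "\<dots> = \<bar>r\<bar> * measure M ((A - C) \<union> (C - A))"
    using A C by simp
  also have "\<dots> \<le> \<bar>r\<bar> * d" using C by (intro mult_left_mono) auto
  also have "\<dots> < e" using base by (simp add: d_def field_simps add_pos_nonneg)
  finally have "(\<integral>x. \<bar>indicator A x *\<^sub>R r - indicator C x *\<^sub>R r\<bar> \<partial>M) < e" .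
  moreover have "cylindrical L n (\<lambda>x. indicator C x *\<^sub>R r)"
    using C(1) by (simp add: cylindrical_def indicator_def)
  moreover have "integrable M (\<lambda>x. indicator C x *\<^sub>R r)"
    using C(2) by (intro integrable_const_bound[where B = "\<bar>r\<bar>"]) (auto simp: indicator_def)
  ultimately show ?case by blast
next
  case (add f g)
  obtain n c where c: "cylindrical L n c" "integrable M c" "(\<integral>x. \<bar>f x - c x\<bar> \<partial>M) < e / 2"
    using add.IH(1)[of "e / 2"] add.prems by auto
  obtain m d where d: "cylindrical L m d" "integrable M d" "(\<integral>x. \<bar>g x - d x\<bar> \<partial>M) < e / 2"
    using add.IH(2)[of "e / 2"] add.prems by auto
  have "(\<integral>x. \<bar>f x + g x - (c x + d x)\<bar> \<partial>M) \<le> (\<integral>x. \<bar>f x - c x\<bar> + \<bar>g x - d x\<bar> \<partial>M)"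
    using add.hyps c d by (intro integral_mono) auto
  also have "\<dots> < e" using add.hyps c d by simp
  finally show ?case
    using cylindrical_combine[OF c(1) d(1), of "(+)"] c(2) d(2)
    by (intro exI[of _ "max n m"] exI[of _ "\<lambda>x. c x + d x"]) auto
next
  case (lim f s)
  have "(\<lambda>i. \<integral>x. \<bar>f x - s i x\<bar> \<partial>M) \<longlonglongrightarrow> (\<integral>x. 0 \<partial>M)"
  \<comment> \<open>The approximants \<open>s i\<close> are bounded by twice the modulus of
    \<open>f\<close>, which gives the constant 3.\<close>
  proof (rule integral_dominated_convergence[where w = "\<lambda>x. 3 * \<bar>f x\<bar>"])
    show "AE x in M. (\<lambda>i. \<bar>f x - s i x\<bar>) \<longlonglongrightarrow> 0"
    proof (rule AE_I2)
      fix x assume "x \<in> space M"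
      then have "(\<lambda>i. \<bar>f x - s i x\<bar>) \<longlonglongrightarrow> \<bar>f x - f x\<bar>"
        using lim.hyps(2) by (intro tendsto_intros) auto
      then show "(\<lambda>i. \<bar>f x - s i x\<bar>) \<longlonglongrightarrow> 0" by simp
    qed
    show "AE x in M. norm \<bar>f x - s i x\<bar> \<le> 3 * \<bar>f x\<bar>" for i
    proof (rule AE_I2)
      fix x assume "x \<in> space M"
      then show "norm \<bar>f x - s i x\<bar> \<le> 3 * \<bar>f x\<bar>"
        using lim.hyps(3)[of x i] abs_triangle_ineq4[of "f x" "s i x"] by simp
    qed
  qed (use lim.hyps in auto)
  then have "eventually (\<lambda>i. (\<integral>x. \<bar>f x - s i x\<bar> \<partial>M) < e / 2) sequentially"
    using lim.prems by (intro order_tendstoD) auto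
  then obtain i where i: "(\<integral>x. \<bar>f x - s i x\<bar> \<partial>M) < e / 2" by (auto dest: eventually_happens)
  obtain n c where c: "cylindrical L n c" "integrable M c" "(\<integral>x. \<bar>s i x - c x\<bar> \<partial>M) < e / 2"
    using lim.IH[of "e / 2" i] lim.prems by auto
  have "(\<integral>x. \<bar>f x - c x\<bar> \<partial>M) \<le> (\<integral>x. \<bar>f x - s i x\<bar> + \<bar>s i x - c x\<bar> \<partial>M)"
    using lim.hyps c by (intro integral_mono) auto
  also have "\<dots> < e" using lim.hyps c i by simp
  finally show ?case using c by blast
qed

section \<open>Gram-Schmidt decomposition of a Gaussian sample\<close>

definition direction :: "('a \<Rightarrow> real) \<Rightarrow> 'a" where
  "direction l = inverse (\<integral>x. (l x)\<^sup>2 \<partial>M) *\<^sub>R cov_vector l"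

text \<open>The product form stays valid for a functional of variance zero: there
  \<open>direction l\<close> is \<open>0\<close> because \<open>inverse 0 = 0\<close>, and the
  integral vanishes as well.\<close>

lemma functional_direction:
  assumes l: "bounded_linear (l :: 'a \<Rightarrow> real)" and b: "bounded_linear (b :: 'a \<Rightarrow> real)"
  shows "b (direction l) * (\<integral>x. (l x)\<^sup>2 \<partial>M) = (\<integral>x. l x * b x \<partial>M)"
proof (cases "(\<integral>x. (l x)\<^sup>2 \<partial>M) = 0")
  case True
  have "(\<integral>x. l x * b x \<partial>M) = (\<integral>x. 0 \<partial>M)"
    using functional_eq_0_AE[OF l True] bounded_linear_measurable[OF l] bounded_linear_measurable[OF b]
    by (intro integral_cong_AE) auto
  then show ?thesis using True by simp
next
  case False
  then show ?thesis by (simp add: direction_def linear_simps[OF b] functional_cov_vector[OF l b])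
qed

text \<open>\<open>residual L n x\<close> is the part of the sample \<open>x\<close> that is independent of \<open>L 0, \<dots>, L (n - 1)\<close>.\<close>

primrec residual :: "(nat \<Rightarrow> 'a \<Rightarrow> real) \<Rightarrow> nat \<Rightarrow> 'a \<Rightarrow> 'a" where
  "residual L 0 = (\<lambda>x. x)"
| "residual L (Suc n) = (\<lambda>x. residual L n x - L n (residual L n x) *\<^sub>R direction (\<lambda>y. L n (residual L n y)))"

declare residual.simps(2) [simp del]

context
  fixes L :: "nat \<Rightarrow> 'a \<Rightarrow> real"
  assumes L: "\<And>i. bounded_linear (L i)"
begin

lemma bounded_linear_residual: "bounded_linear (residual L n)"
proof (induction n)
  case 0 then show ?case by (simp add: bounded_linear_ident)
next
  case (Suc n)
  show ?case unfolding residual.simps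
    by (intro bounded_linear_sub Suc bounded_linear_scaleR_const bounded_linear_compose[OF L Suc])
qed

lemma bounded_linear_coordinate: "bounded_linear (\<lambda>x. L n (residual L n x))"
  by (rule bounded_linear_compose[OF L bounded_linear_residual])

lemma bounded_linear_removed: "bounded_linear (\<lambda>x. x - residual L n x)"
  by (intro bounded_linear_sub bounded_linear_ident bounded_linear_residual)

text \<open>Orthogonality in Gram-Schmidt. The functional \<open>l\<close> sees only the residual,
  so it is uncorrelated with the removed part, and its covariance with \<open>b (T x)\<close> is
  \<open>b c\<close> times its variance. The two remaining terms created by the new direction then
  cancel.\<close>

lemma residual_uncorrelated:
  assumes a: "bounded_linear (a :: 'a \<Rightarrow> real)" and b: "bounded_linear (b :: 'a \<Rightarrow> real)"
  shows "(\<integral>x. a (x - residual L n x) * b (residual L n x) \<partial>M) = 0"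
  using a b
proof (induction n arbitrary: a b)
  case 0 then show ?case using linear_simps(3)[OF 0(1)] by simp
next
  case (Suc n)
  note a = Suc.prems(1) and b = Suc.prems(2)
  define T where "T = residual L n"
  define l where "l = (\<lambda>x. L n (T x))"
  define c where "c = direction l"
  have T: "bounded_linear T" unfolding T_def by (rule bounded_linear_residual)
  have l: "bounded_linear l" unfolding l_def T_def by (rule bounded_linear_coordinate)
  have P: "bounded_linear (\<lambda>x. x - T x)" unfolding T_def by (rule bounded_linear_removed)
  have aP: "bounded_linear (\<lambda>x. a (x - T x))" by (rule bounded_linear_compose[OF a P])
  have bT: "bounded_linear (\<lambda>x. b (T x))" by (rule bounded_linear_compose[OF b T])
  have bP: "bounded_linear (\<lambda>x. b (x - T x))" by (rule bounded_linear_compose[OF b P])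
  have "(\<integral>x. l x * b (x - T x) + l x * b (T x) \<partial>M) = (\<integral>x. l x * b x \<partial>M)"
    by (intro Bochner_Integration.integral_cong) (simp_all add: linear_simps[OF b] algebra_simps)
  moreover have "(\<integral>x. l x * b (x - T x) \<partial>M) = 0"
    using Suc.IH[OF b L, of n] by (simp add: l_def T_def mult.commute)
  ultimately have lbT: "(\<integral>x. l x * b (T x) \<partial>M) = b c * (\<integral>x. (l x)\<^sup>2 \<partial>M)"
    using integrable_functional_mult[OF l bP] integrable_functional_mult[OF l bT] functional_direction[OF l b]
    by (simp add: c_def)
  have rs: "residual L (Suc n) x = T x - l x *\<^sub>R c" for x
    by (simp add: residual.simps(2) T_def l_def c_def)
  have "(\<integral>x. a (x - residual L (Suc n) x) * b (residual L (Suc n) x) \<partial>M) =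
    (\<integral>x. a (x - T x) * b (T x) - b c * (a (x - T x) * l x) + (a c * (l x * b (T x)) - (a c * b c) * (l x)\<^sup>2) \<partial>M)"
    by (intro Bochner_Integration.integral_cong)
       (simp_all add: linear_simps[OF a] linear_simps[OF b] rs algebra_simps power2_eq_square)
  also have "\<dots> = (\<integral>x. a (x - T x) * b (T x) \<partial>M) - b c * (\<integral>x. a (x - T x) * l x \<partial>M) +
     (a c * (\<integral>x. l x * b (T x) \<partial>M) - (a c * b c) * (\<integral>x. (l x)\<^sup>2 \<partial>M))"
    using integrable_functional_mult[OF aP bT] integrable_functional_mult[OF aP l] integrable_functional_mult[OF l bT]
      square_integrable[OF l] by simp
  also have "\<dots> = 0"
    unfolding lbT using Suc.IH[OF a b] Suc.IH[OF a L, of n] by (simp add: T_def l_def)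
  finally show ?case .
qed

text \<open>If the new coordinate has positive variance, \<open>L n c = 1\<close> removes it
  exactly, and the earlier functionals vanish on \<open>c\<close> because they vanish almost surely
  on the residual. If its variance is zero, the coordinate is itself almost surely zero.\<close>

lemma functional_residual_AE: "i < n \<Longrightarrow> AE x in M. L i (residual L n x) = 0"
proof (induction n)
  case (Suc n)
  define T where "T = residual L n"
  define l where "l = (\<lambda>x. L n (T x))"
  define c where "c = direction l"
  define q where "q = (\<integral>x. (l x)\<^sup>2 \<partial>M)"
  have T: "bounded_linear T" unfolding T_def by (rule bounded_linear_residual)
  have l: "bounded_linear l" unfolding l_def T_def by (rule bounded_linear_coordinate)
  have Lj: "bounded_linear (\<lambda>x. L j (x - T x))" "bounded_linear (\<lambda>x. L j (T x))" for j
    unfolding T_def by (rule bounded_linear_compose[OF L bounded_linear_removed], rule bounded_linear_compose[OF L bounded_linear_residual])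
  have eq: "L j (residual L (Suc n) x) = L j (T x) - l x * L j c" for j x
    by (simp add: residual.simps(2) T_def l_def c_def linear_simps[OF L])
  have Lc: "L j c * q = (\<integral>x. l x * L j (T x) \<partial>M)" for j
  proof -
    have "(\<integral>x. l x * L j (x - T x) + l x * L j (T x) \<partial>M) = (\<integral>x. l x * L j x \<partial>M)"
      by (intro Bochner_Integration.integral_cong) (simp_all add: linear_simps[OF L] algebra_simps)
    moreover have "(\<integral>x. l x * L j (x - T x) \<partial>M) = 0"
      using residual_uncorrelated[OF L L, of j n n] by (simp add: l_def T_def mult.commute)
    ultimately show ?thesis
      using integrable_functional_mult[OF l Lj(1)] integrable_functional_mult[OF l Lj(2)] functional_direction[OF l L]
      by (simp add: c_def q_def)
  qed
  show ?case
  proof (cases "q = 0")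
    case True
    then have l0: "AE x in M. l x = 0" using functional_eq_0_AE[OF l] by (simp add: q_def)
    show ?thesis
    proof (cases "i = n")
      case True
      show ?thesis using l0 by eventually_elim (simp add: eq True l_def)
    next
      case False
      then have "AE x in M. L i (T x) = 0" using Suc by (simp add: T_def)
      then show ?thesis using l0 by eventually_elim (simp add: eq)
    qed
  next
    case q: False
    show ?thesis
    proof (cases "i = n")
      case True
      have "L n c * q = q" unfolding Lc by (simp add: q_def l_def power2_eq_square)
      then have "L n c = 1" using q by simp
      then show ?thesis by (simp add: eq True l_def)
    next
      case False
      then have ae: "AE x in M. L i (T x) = 0" using Suc by (simp add: T_def)
      have "L i c * q = (\<integral>x. 0 \<partial>M)" unfolding Lc
        using ae bounded_linear_measurable[OF l] bounded_linear_measurable[OF Lj(2)] by (intro integral_cong_AE) auto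
      then have "L i c = 0" using q by simp
      then show ?thesis using ae by (simp add: eq)
    qed
  qed
qed simp

lemma convolution_uncorrelated:
  fixes S T :: "'a \<Rightarrow> 'a"
  assumes S: "bounded_linear S" and T: "bounded_linear T"
    and uncor: "\<And>(a :: 'a \<Rightarrow> real) (b :: 'a \<Rightarrow> real). bounded_linear a \<Longrightarrow> bounded_linear b \<Longrightarrow> (\<integral>x. a (S x) * b (T x) \<partial>M) = 0"
  shows "convolution_measure (distr M borel S) (distr M borel T) = distr M borel (\<lambda>x. S x + T x)"
proof -
  note [measurable] = bounded_linear_measurable[OF S] bounded_linear_measurable[OF T]
  have [measurable]: "(\<lambda>(x, y). x + y :: 'a) \<in> borel_measurable borel"
    unfolding split_beta by (intro borel_measurable_continuous_onI continuous_intros)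
  have "convolution_measure (distr M borel S) (distr M borel T) = distr (distr M borel (\<lambda>x. (S x, T x))) borel (\<lambda>(x, y). x + y)"
    unfolding convolution_measure_def by (simp only: distr_uncorrelated[OF S T uncor])
  also have "\<dots> = distr M borel (\<lambda>x. S x + T x)"
    by (subst distr_distr) (auto simp: comp_def split_beta)
  finally show ?thesis .
qed

lemma convolution_residual:
  "convolution_measure (distr M borel (\<lambda>x. x - residual L n x)) (distr M borel (residual L n)) = M"
proof -
  have "convolution_measure (distr M borel (\<lambda>x. x - residual L n x)) (distr M borel (residual L n)) = distr M borel (\<lambda>x. x)"
    using convolution_uncorrelated[OF bounded_linear_removed[of n] bounded_linear_residual[of n] residual_uncorrelated[of _ _ n]]
    unfolding diff_add_cancel .
  also have "\<dots> = M" by (rule distr_id2) simp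
  finally show ?thesis .
qed

lemma borel_prob_pair_residual: "borel_prob_pair (distr M borel (\<lambda>x. x - residual L n x)) (distr M borel (residual L n))"
  using bounded_linear_measurable[OF bounded_linear_removed] bounded_linear_measurable[OF bounded_linear_residual]
  by (auto simp: borel_prob_pair_def borel_prob_pair_axioms_def intro!: prob_space_distr)

text \<open>The removed part is a sum of independent Gaussian multiples of fixed vectors. Each
  multiple is a Gaussian law on a line, and independence turns the sum into a convolution.\<close>

lemma midpoint_prekopa_removed: "midpoint_prekopa (distr M borel (\<lambda>x. x - residual L n x))"
proof (induction n)
  case 0
  have "distr M borel (\<lambda>x. x - residual L 0 x) = distr std_normal_distribution borel (\<lambda>t. t *\<^sub>R 0)"
    using distr_const[of "0 :: 'a" borel] prob_space.distr_const[OF prob_space_std_normal, of "0 :: 'a" borel] by simp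
  then show ?case using midpoint_prekopa_gaussian_line[of "0 :: 'a"] by (simp only:)
next
  case (Suc n)
  define T where "T = residual L n"
  define l where "l = (\<lambda>x. L n (T x))"
  define c where "c = direction l"
  have l: "bounded_linear l" unfolding l_def T_def by (rule bounded_linear_coordinate)
  note [measurable] = bounded_linear_measurable[OF l]
  have P: "bounded_linear (\<lambda>x. x - T x)" unfolding T_def by (rule bounded_linear_removed)
  have lc: "bounded_linear (\<lambda>x. l x *\<^sub>R c)" by (intro bounded_linear_scaleR_const l)
  have "distr M borel (\<lambda>x. l x *\<^sub>R c) = distr (distr M borel l) borel (\<lambda>t. t *\<^sub>R c)"
    by (subst distr_distr) (auto simp: comp_def)
  also have "\<dots> = distr std_normal_distribution borel (\<lambda>t. t *\<^sub>R (sqrt (\<integral>x. (l x)\<^sup>2 \<partial>M) *\<^sub>R c))"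
    unfolding law_functional[OF l] by (subst distr_distr) (auto simp: comp_def mult.commute)
  finally have 1: "midpoint_prekopa (distr M borel (\<lambda>x. l x *\<^sub>R c))"
    by (simp only: midpoint_prekopa_gaussian_line)
  have unc: "(\<integral>x. a (x - T x) * b (l x *\<^sub>R c) \<partial>M) = 0" if "bounded_linear a" "bounded_linear b" for a b :: "'a \<Rightarrow> real"
  proof -
    have "(\<integral>x. a (x - T x) * b (l x *\<^sub>R c) \<partial>M) = (\<integral>x. b c * (a (x - T x) * l x) \<partial>M)"
      by (simp add: linear_simps[OF that(2)] ac_simps)
    also have "\<dots> = 0" using residual_uncorrelated[OF that(1) L, of n n] by (simp add: T_def l_def)
    finally show ?thesis .
  qed
  have "borel_prob_pair (distr M borel (\<lambda>x. x - T x)) (distr M borel (\<lambda>x. l x *\<^sub>R c))"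
    using bounded_linear_measurable[OF P] bounded_linear_measurable[OF lc]
    by (auto simp: borel_prob_pair_def borel_prob_pair_axioms_def intro!: prob_space_distr)
  then have "midpoint_prekopa (convolution_measure (distr M borel (\<lambda>x. x - T x)) (distr M borel (\<lambda>x. l x *\<^sub>R c)))"
    using Suc 1 by (intro borel_prob_pair.midpoint_prekopa_convolution) (simp_all add: T_def)
  also have "convolution_measure (distr M borel (\<lambda>x. x - T x)) (distr M borel (\<lambda>x. l x *\<^sub>R c)) = distr M borel (\<lambda>x. (x - T x) + l x *\<^sub>R c)"
    by (rule convolution_uncorrelated[OF P lc unc])
  also have "(\<lambda>x. (x - T x) + l x *\<^sub>R c) = (\<lambda>x. x - residual L (Suc n) x)"
    by (simp add: residual.simps(2) T_def l_def c_def algebra_simps)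
  finally show ?case .
qed

text \<open>The residual lies almost surely in the common kernel of the first \<open>m\<close>
  functionals.\<close>

lemma cylindrical_residual_AE:
  assumes "cylindrical L m c" "m \<le> n"
  shows "AE z in distr M borel (residual L n). \<forall>u. c (u + z) = c u"
proof -
  note [measurable] = bounded_linear_measurable[OF L] bounded_linear_measurable[OF bounded_linear_residual]
  have "AE x in M. \<forall>i<m. L i (residual L n x) = 0"
    using functional_residual_AE assms(2) by (subst AE_all_countable, intro allI) (case_tac "i < m", auto)
  then have "AE z in distr M borel (residual L n). \<forall>i<m. L i z = 0"
    by (subst AE_distr_iff) auto
  then show ?thesis by eventually_elim (use assms(1) in \<open>auto simp: cylindrical_def\<close>)
qed

end

text \<open>Fixing the residual at a value \<open>z\<close> leaves an average over finitely many
  Gaussian coordinates, where the inequality is known. For large \<open>n\<close> these averages of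
  \<open>f\<close>, \<open>g\<close> and \<open>h\<close> are close in mean to the full integrals,
  so there is a common \<open>z\<close> at which all three are close.\<close>

theorem midpoint_prekopa_gaussian: "midpoint_prekopa M"
  unfolding midpoint_prekopa_def
proof (intro allI impI)
  fix f g h :: "'a \<Rightarrow> real"
  assume m [measurable]: "f \<in> borel_measurable borel" "g \<in> borel_measurable borel" "h \<in> borel_measurable borel"
    and 01: "\<forall>x. f x \<in> {0..1}" "\<forall>x. g x \<in> {0..1}" "\<forall>x. h x \<in> {0..1}"
    and mid: "\<forall>x y. f x * g y \<le> (h ((1/2) *\<^sub>R (x + y)))\<^sup>2"
  obtain L :: "nat \<Rightarrow> 'a \<Rightarrow> real" where L: "\<And>i. bounded_linear (L i)"
    and gen: "sets (borel :: 'a measure) = sigma_sets UNIV {{x. L i x \<le> r} | i r. True}"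
    using functionals_generate_borel[where 'a = 'a] by blast
  have int: "integrable M u" if "u \<in> borel_measurable borel" "\<forall>x. u x \<in> {0..1}" for u :: "'a \<Rightarrow> real"
    using that by (intro integrable_const_bound[where B = 1]) auto
  have unit: "(\<integral>x. u x \<partial>M) \<in> {0..1}" if "u \<in> borel_measurable borel" "\<forall>x. u x \<in> {0..1}" for u :: "'a \<Rightarrow> real"
    using that int[OF that] by (auto intro!: integral_le_const integral_nonneg_AE)
  have approx: "\<exists>n c. cylindrical L n c \<and> integrable M c \<and> (\<integral>\<^sup>+ x. ennreal \<bar>u x - c x\<bar> \<partial>M) \<le> ennreal e"
    if u: "u \<in> borel_measurable borel" "\<forall>x. u x \<in> {0..1}" and e: "e > 0" for u :: "'a \<Rightarrow> real" and e
  proof -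
    obtain n c where c: "cylindrical L n c" "integrable M c" "(\<integral>x. \<bar>u x - c x\<bar> \<partial>M) < e"
      using cylindrical_functions_dense[OF L gen int[OF u] e] by blast
    then have "(\<integral>\<^sup>+ x. ennreal \<bar>u x - c x\<bar> \<partial>M) = ennreal (\<integral>x. \<bar>u x - c x\<bar> \<partial>M)"
      using int[OF u] by (intro nn_integral_eq_integral) auto
    then show ?thesis using c by (intro exI[of _ n] exI[of _ c]) (simp add: ennreal_leI)
  qed
  show "(\<integral>x. f x \<partial>M) * (\<integral>x. g x \<partial>M) \<le> (\<integral>x. h x \<partial>M)\<^sup>2"
  proof (rule field_le_epsilon)
    fix \<eta> :: real assume \<eta>: "\<eta> > 0"
    \<comment> \<open>The bound \<open>d \<le> 1\<close> linearises the products: each of the two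
      sides changes by at most \<open>3 * d\<close>, and \<open>6 * d \<le> \<eta>\<close>.\<close>
    define d where "d = min 1 (\<eta> / 6)"
    have d: "0 < d" "d \<le> 1" "6 * d \<le> \<eta>" using \<eta> by (auto simp: d_def)
    \<comment> \<open>The three deviations have mean at most \<open>6 * e\<close> in total; dividing
      by 7 makes this smaller than \<open>d\<close>.\<close>
    define e where "e = d / 7"
    have e: "0 < e" using d by (simp add: e_def)
    obtain n1 c1 where c1: "cylindrical L n1 c1" "integrable M c1" "(\<integral>\<^sup>+ x. ennreal \<bar>f x - c1 x\<bar> \<partial>M) \<le> ennreal e"
      using approx[OF m(1) 01(1) e] by blast
    obtain n2 c2 where c2: "cylindrical L n2 c2" "integrable M c2" "(\<integral>\<^sup>+ x. ennreal \<bar>g x - c2 x\<bar> \<partial>M) \<le> ennreal e"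
      using approx[OF m(2) 01(2) e] by blast
    obtain n3 c3 where c3: "cylindrical L n3 c3" "integrable M c3" "(\<integral>\<^sup>+ x. ennreal \<bar>h x - c3 x\<bar> \<partial>M) \<le> ennreal e"
      using approx[OF m(3) 01(3) e] by blast
    define n where "n = n1 + n2 + n3"
    define K where "K = distr M borel (\<lambda>x. x - residual L n x)"
    define R where "R = distr M borel (residual L n)"
    interpret KR: borel_prob_pair K R unfolding K_def R_def by (rule borel_prob_pair_residual[OF L])
    have conv: "convolution_measure K R = M" unfolding K_def R_def by (rule convolution_residual[OF L])
    have Kp: "midpoint_prekopa K" unfolding K_def by (rule midpoint_prekopa_removed[OF L])
    define av where "av u z = (\<integral>x. u (x + z) \<partial>K)" for u :: "'a \<Rightarrow> real" and z
    have avm [measurable]: "av u \<in> borel_measurable borel" if "u \<in> borel_measurable borel" for u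
      unfolding av_def[abs_def] by (rule KR.measurable_average(1)[OF that])
    have near: "(\<integral>\<^sup>+ z. ennreal \<bar>av u z - (\<integral>x. u x \<partial>M)\<bar> \<partial>R) \<le> ennreal (2 * e)"
      if "u \<in> borel_measurable borel" "\<forall>x. u x \<in> {0..1}" "cylindrical L k c" "k \<le> n" "integrable M c" "(\<integral>\<^sup>+ x. ennreal \<bar>u x - c x\<bar> \<partial>M) \<le> ennreal e"
      for u c k
    proof -
      have "(\<integral>\<^sup>+ z. ennreal \<bar>av u z - (\<integral>x. u x \<partial>M)\<bar> \<partial>R) \<le> 2 * ennreal e"
        using KR.average_K_near_const[of u c "ennreal e"] int[OF that(1,2)] that(5,6) cylindrical_residual_AE[OF L that(3,4)]
        unfolding conv av_def R_def[symmetric] by blast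
      also have "2 * ennreal e = ennreal (2 * e)" using ennreal_mult[of 2 e] e by simp
      finally show ?thesis .
    qed
    define S where "S z = \<bar>av f z - (\<integral>x. f x \<partial>M)\<bar> + \<bar>av g z - (\<integral>x. g x \<partial>M)\<bar> + \<bar>av h z - (\<integral>x. h x \<partial>M)\<bar>" for z
    have "\<exists>z. S z < d"
    proof (rule ccontr)
      assume "\<nexists>z. S z < d"
      then have "(\<integral>\<^sup>+ z. ennreal d \<partial>R) \<le> (\<integral>\<^sup>+ z. ennreal (S z) \<partial>R)"
        by (intro nn_integral_mono ennreal_leI) (auto simp: not_less)
      also have "\<dots> = (\<integral>\<^sup>+ z. ennreal \<bar>av f z - (\<integral>x. f x \<partial>M)\<bar> + ennreal \<bar>av g z - (\<integral>x. g x \<partial>M)\<bar> + ennreal \<bar>av h z - (\<integral>x. h x \<partial>M)\<bar> \<partial>R)"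
        unfolding S_def by (simp add: ennreal_plus)
      also have "\<dots> = (\<integral>\<^sup>+ z. ennreal \<bar>av f z - (\<integral>x. f x \<partial>M)\<bar> \<partial>R) + (\<integral>\<^sup>+ z. ennreal \<bar>av g z - (\<integral>x. g x \<partial>M)\<bar> \<partial>R) + (\<integral>\<^sup>+ z. ennreal \<bar>av h z - (\<integral>x. h x \<partial>M)\<bar> \<partial>R)"
        by (simp add: nn_integral_add)
      also have "\<dots> \<le> ennreal (2 * e) + ennreal (2 * e) + ennreal (2 * e)"
        by (intro add_mono near[OF m(1) 01(1) c1(1) _ c1(2,3)] near[OF m(2) 01(2) c2(1) _ c2(2,3)] near[OF m(3) 01(3) c3(1) _ c3(2,3)])
           (auto simp: n_def)
      also have "\<dots> = ennreal (6 * e)" using e by (simp flip: ennreal_plus)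
      also have "(\<integral>\<^sup>+ z. ennreal d \<partial>R) = ennreal d" by (simp add: KR.R.emeasure_space_1)
      finally have "d \<le> 6 * e" using e by (simp add: ennreal_le_iff)
      then show False using d by (simp add: e_def)
    qed
    then obtain z where z: "S z < d" by blast
    have "av f z * av g z \<le> (av h z)\<^sup>2"
      unfolding av_def
    proof (rule midpoint_prekopaD[OF Kp, where f = "\<lambda>x. f (x + z)" and g = "\<lambda>x. g (x + z)" and h = "\<lambda>x. h (x + z)"])
      fix x y
      \<comment> \<open>The same shift in both arguments reappears unchanged in their
        midpoint.\<close>
      have "(1/2) *\<^sub>R ((x + z) + (y + z)) = (1/2) *\<^sub>R (x + y) + z" by (simp add: algebra_simps flip: scaleR_2)
      then show "f (x + z) * g (y + z) \<le> (h ((1/2) *\<^sub>R (x + y) + z))\<^sup>2" using mid by metis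
    qed (use 01 in auto)
    moreover have "av u z \<in> {0..1}" if um: "u \<in> borel_measurable borel" and u: "\<forall>x. u x \<in> {0..1}" for u
    proof -
      note [measurable] = um
      show ?thesis unfolding av_def using u by (intro KR.average_in_unit) auto
    qed
    note this[OF m(1) 01(1)] this[OF m(2) 01(2)] this[OF m(3) 01(3)]
    moreover have "(\<integral>x. f x \<partial>M) \<le> av f z + d" "(\<integral>x. g x \<partial>M) \<le> av g z + d" "av h z \<le> (\<integral>x. h x \<partial>M) + d"
      using z by (auto simp: S_def)
    moreover note unit[OF m(1) 01(1)] unit[OF m(2) 01(2)] unit[OF m(3) 01(3)]
    ultimately have b: "(\<integral>x. f x \<partial>M) * (\<integral>x. g x \<partial>M) \<le> (av f z + d) * (av g z + d)"
      "(av h z)\<^sup>2 \<le> ((\<integral>x. h x \<partial>M) + d)\<^sup>2" "av f z * av g z \<le> (av h z)\<^sup>2"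
      "av f z \<le> 1" "av g z \<le> 1" "(\<integral>x. h x \<partial>M) \<le> 1"
      by (auto intro!: mult_mono power_mono)
    have "(av f z + d) * (av g z + d) = av f z * av g z + d * (av f z + av g z + d)" by (simp add: algebra_simps)
    also have "\<dots> \<le> av f z * av g z + d * 3"
      using b d by (intro add_left_mono mult_left_mono) auto
    finally have 1: "(\<integral>x. f x \<partial>M) * (\<integral>x. g x \<partial>M) \<le> (av h z)\<^sup>2 + d * 3" using b by linarith
    have "((\<integral>x. h x \<partial>M) + d)\<^sup>2 = (\<integral>x. h x \<partial>M)\<^sup>2 + d * (2 * (\<integral>x. h x \<partial>M) + d)" by (simp add: power2_eq_square algebra_simps)
    also have "\<dots> \<le> (\<integral>x. h x \<partial>M)\<^sup>2 + d * 3" using b d by (intro add_left_mono mult_left_mono) auto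
    finally show "(\<integral>x. f x \<partial>M) * (\<integral>x. g x \<partial>M) \<le> (\<integral>x. h x \<partial>M)\<^sup>2 + \<eta>"
      using 1 b(2) d(3) by linarith
  qed
qed

end

section \<open>Even log-concave weights\<close>

text \<open>Everything follows from \<open>1 - y \<le> exp (- y)\<close>; the modulus in the
  exponent covers both signs.\<close>

lemma exp_minus_one_minus_le: "exp y - 1 - y \<le> y\<^sup>2 * exp \<bar>y\<bar>" for y :: real
proof -
  have 1: "exp y - 1 \<le> y * exp y"
    using mult_right_mono[OF exp_ge_add_one_self[of "- y"], of "exp y"] by (simp add: algebra_simps flip: exp_add)
  show ?thesis
  proof (cases "y \<ge> 0")
    case True
    have "exp y - 1 - y \<le> y * (exp y - 1)" using 1 by (simp add: algebra_simps)
    also have "\<dots> \<le> y * (y * exp y)" using 1 True by (intro mult_left_mono)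
    finally show ?thesis using True by (simp add: power2_eq_square mult.assoc)
  next
    case False
    have "exp y - 1 - y \<le> (- y) * (1 - exp y)" using 1 by (simp add: algebra_simps)
    also have "\<dots> \<le> (- y) * (- y)" using False exp_ge_add_one_self[of y] by (intro mult_left_mono) linarith+
    also have "\<dots> = y\<^sup>2 * 1" by (simp add: power2_eq_square)
    also have "\<dots> \<le> y\<^sup>2 * exp \<bar>y\<bar>" by (intro mult_left_mono) auto
    finally show ?thesis .
  qed
qed

text \<open>For \<open>D > 1\<close> the left side is negative, so only the range of the standard
  logarithm estimate matters.\<close>

lemma ln_one_plus_ge: "D - D\<^sup>2 \<le> ln (1 + D)" if "0 \<le> D" for D :: real
proof (cases "D \<le> 1")
  case True then show ?thesis using ln_one_plus_pos_lower_bound[of D] that by simp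
next
  case False
  then have "D \<le> D\<^sup>2" by (simp add: power2_eq_square)
  moreover have "0 \<le> ln (1 + D)" using that by simp
  ultimately show ?thesis by simp
qed

context gaussian_measure
begin

lemma integral_uminus:
  assumes [measurable]: "f \<in> borel_measurable borel"
  shows "(\<integral>x. f (- x) \<partial>M) = (\<integral>x. f x \<partial>M :: real)"
proof -
  have "(\<integral>x. f x \<partial>distr M borel uminus) = (\<integral>x. f (- x) \<partial>M)"
    by (subst integral_distr) auto
  then show ?thesis by (simp add: distr_uminus)
qed

text \<open>The function \<open>k\<close> agrees with \<open>g\<close> almost everywhere. Keeping both allows \<open>g\<close> to be the indicator
  of a Borel set that is contained in a convex set and differs from it by a null set.\<close>

definition even_log_concave :: "('a \<Rightarrow> real) \<Rightarrow> bool" where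
  "even_log_concave g \<longleftrightarrow> g \<in> borel_measurable borel \<and> (\<forall>x. g x \<in> {0..1}) \<and> (\<forall>x. g (- x) = g x) \<and>
     (\<exists>k. k \<in> borel_measurable borel \<and> (\<forall>x. k x \<in> {0..1}) \<and> (AE x in M. k x = g x) \<and>
        (\<forall>x y. g x * g y \<le> (k ((1/2) *\<^sub>R (x + y)))\<^sup>2))"

lemma integrable_unit_interval:
  "g \<in> borel_measurable borel \<Longrightarrow> (\<And>x. g x \<in> {0..1}) \<Longrightarrow> integrable M (g :: 'a \<Rightarrow> real)"
  by (intro integrable_const_bound[where B = 1]) auto

lemma integral_unit_interval:
  assumes "g \<in> borel_measurable borel" "\<And>x. g x \<in> {0..1}"
  shows "(\<integral>x. g x \<partial>M :: real) \<in> {0..1}"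
  using integrable_unit_interval[OF assms] assms(2) by (auto intro!: integral_le_const integral_nonneg_AE)

text \<open>Prekopa-Leindler for the translates of \<open>g\<close> by \<open>h\<close> and
  \<open>- h\<close>, with \<open>k\<close> at the midpoint. Evenness of \<open>g\<close> and
  symmetry of the measure make the two translated integrals equal, and a square root is
  taken.\<close>

lemma anderson_inequality:
  assumes g: "even_log_concave g"
  shows "(\<integral>x. g (x + h) \<partial>M) \<le> (\<integral>x. g x \<partial>M)"
proof -
  obtain k where gm [measurable]: "g \<in> borel_measurable borel" and g01: "\<And>x. g x \<in> {0..1}" and ge: "\<And>x. g (- x) = g x"
    and km [measurable]: "k \<in> borel_measurable borel" and k01: "\<And>x. k x \<in> {0..1}" and kg: "AE x in M. k x = g x"
    and mid: "\<And>x y. g x * g y \<le> (k ((1/2) *\<^sub>R (x + y)))\<^sup>2"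
    using g unfolding even_log_concave_def by blast
  have "(\<integral>x. g (x + h) \<partial>M) * (\<integral>x. g (x - h) \<partial>M) \<le> (\<integral>x. k x \<partial>M)\<^sup>2"
  proof (rule midpoint_prekopaD[OF midpoint_prekopa_gaussian])
    show "g (x + h) * g (y - h) \<le> (k ((1/2) *\<^sub>R (x + y)))\<^sup>2" for x y using mid[of "x + h" "y - h"] by simp
  qed (use g01 k01 in auto)
  also have "(\<integral>x. g (x - h) \<partial>M) = (\<integral>x. g (x + h) \<partial>M)"
    using integral_uminus[of "\<lambda>x. g (x - h)"] ge[of "_ + h"] by simp
  also have "(\<integral>x. k x \<partial>M) = (\<integral>x. g x \<partial>M)" using kg by (intro integral_cong_AE) auto
  finally have "(\<integral>x. g (x + h) \<partial>M)\<^sup>2 \<le> (\<integral>x. g x \<partial>M)\<^sup>2" by (simp add: power2_eq_square)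
  then show ?thesis by (rule power2_le_imp_le) (use g01 in \<open>auto intro!: integral_nonneg_AE\<close>)
qed

lemma integrable_exp_functional:
  assumes l: "bounded_linear (l :: 'a \<Rightarrow> real)"
  shows "integrable M (\<lambda>x. exp (l x))"
  using nn_integral_exp_functional[OF l] bounded_linear_measurable[OF l] by (intro integrableI_nonneg) auto

lemma integral_mult_exp_le:
  assumes g: "even_log_concave g" and l: "bounded_linear l"
  shows "(\<integral>x. g x * exp (l x) \<partial>M) \<le> (\<integral>x. g x \<partial>M) * (\<integral>x. exp (l x) \<partial>M)"
proof -
  have gm [measurable]: "g \<in> borel_measurable borel" and g01: "\<And>x. g x \<in> {0..1}"
    using g unfolding even_log_concave_def by blast+
  note [measurable] = bounded_linear_measurable[OF l]
  let ?q = "exp ((\<integral>x. (l x)\<^sup>2 \<partial>M) / 2)"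
  have q: "(\<integral>x. exp (l x) \<partial>M) = ?q"
    using nn_integral_exp_functional[OF l] integrable_exp_functional[OF l] by (subst (asm) nn_integral_eq_integral) auto
  have i: "integrable M (\<lambda>x. g x * exp (l x))"
  proof (rule Bochner_Integration.integrable_bound[OF integrable_exp_functional[OF l]])
    show "AE x in M. norm (g x * exp (l x)) \<le> norm (exp (l x))"
      using g01 by (intro AE_I2) (simp add: abs_mult mult_left_le_one_le)
  qed simp
  have "ennreal (\<integral>x. g x * exp (l x) \<partial>M) = (\<integral>\<^sup>+ x. ennreal (g x) * ennreal (exp (l x)) \<partial>M)"
    using i g01 by (subst nn_integral_eq_integral[symmetric]) (auto simp: ennreal_mult intro!: nn_integral_cong)
  also have "\<dots> = ennreal ?q * (\<integral>\<^sup>+ x. ennreal (g (x + cov_vector l)) \<partial>M)"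
    by (rule cameron_martin[OF l]) simp
  also have "(\<integral>\<^sup>+ x. ennreal (g (x + cov_vector l)) \<partial>M) = ennreal (\<integral>x. g (x + cov_vector l) \<partial>M)"
    using g01 by (intro nn_integral_eq_integral integrable_unit_interval) auto
  also have "ennreal ?q * \<dots> \<le> ennreal ?q * ennreal (\<integral>x. g x \<partial>M)"
    by (intro mult_left_mono ennreal_leI anderson_inequality g) simp
  also have "\<dots> = ennreal ((\<integral>x. g x \<partial>M) * ?q)" by (simp add: ennreal_mult'' mult.commute)
  finally show ?thesis
    using g01 unfolding q by (subst (asm) ennreal_le_iff) (auto intro!: mult_nonneg_nonneg integral_nonneg_AE)
qed

text \<open>For two independent samples \<open>x, y\<close> weighted by \<open>g\<close>, this is the density of \<open>(u, v)\<close>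
  with \<open>u = (x + y) / \<surd>2\<close> and \<open>v = (x - y) / \<surd>2\<close>.\<close>

definition rotated :: "('a \<Rightarrow> real) \<Rightarrow> 'a \<Rightarrow> 'a \<Rightarrow> real" where
  "rotated g u v = g ((u + v) /\<^sub>R sqrt 2) * g ((u - v) /\<^sub>R sqrt 2)"

lemma measurable_rotated [measurable (raw)]:
  assumes [measurable]: "g \<in> borel_measurable borel" "u \<in> borel_measurable N" "v \<in> borel_measurable N"
  shows "(\<lambda>x. rotated g (u x) (v x)) \<in> borel_measurable N"
  unfolding rotated_def by measurable

lemma measurable_rotated_section:
  assumes [measurable]: "g \<in> borel_measurable borel"
  shows "rotated g u \<in> borel_measurable borel"
  unfolding rotated_def[abs_def] by measurable

lemma rotated_unit: "(\<And>x. g x \<in> {0..1}) \<Longrightarrow> rotated g u v \<in> {0..1}"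
  unfolding rotated_def by (auto intro!: mult_nonneg_nonneg mult_le_one)

lemma measurable_rotation:
  "(\<lambda>(x, y). ((x + y) /\<^sub>R sqrt 2, (x - y) /\<^sub>R sqrt 2) :: 'a \<times> 'a) \<in> borel_measurable (M \<Otimes>\<^sub>M M)"
proof -
  interpret gaussian_pair M M ..
  show ?thesis unfolding split_beta by measurable
qed

lemma nn_integral_rotation:
  assumes [measurable]: "F \<in> borel_measurable (borel \<Otimes>\<^sub>M borel)"
  shows "(\<integral>\<^sup>+ x. (\<integral>\<^sup>+ y. F (x, y) \<partial>M) \<partial>M) = (\<integral>\<^sup>+ u. (\<integral>\<^sup>+ v. F ((u + v) /\<^sub>R sqrt 2, (u - v) /\<^sub>R sqrt 2) \<partial>M) \<partial>M)"
proof -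
  have Fm: "F \<in> borel_measurable (M \<Otimes>\<^sub>M M)"
    using assms by (subst measurable_cong_sets[OF sets_pair_measure_cong[OF sets_M sets_M] refl])
  have Fm': "(\<lambda>z. F (case z of (u, v) \<Rightarrow> ((u + v) /\<^sub>R sqrt 2, (u - v) /\<^sub>R sqrt 2))) \<in> borel_measurable (M \<Otimes>\<^sub>M M)"
    using measurable_compose[OF measurable_rotation] assms by (simp add: borel_prod)
  have "(\<integral>\<^sup>+ x. (\<integral>\<^sup>+ y. F (x, y) \<partial>M) \<partial>M) = (\<integral>\<^sup>+ z. F z \<partial>(M \<Otimes>\<^sub>M M))"
    by (rule nn_integral_fst[OF Fm])
  also have "\<dots> = (\<integral>\<^sup>+ z. F z \<partial>distr (M \<Otimes>\<^sub>M M) borel (\<lambda>(x, y). ((x + y) /\<^sub>R sqrt 2, (x - y) /\<^sub>R sqrt 2)))"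
    by (simp only: distr_rotation)
  also have "\<dots> = (\<integral>\<^sup>+ z. F (case z of (u, v) \<Rightarrow> ((u + v) /\<^sub>R sqrt 2, (u - v) /\<^sub>R sqrt 2)) \<partial>(M \<Otimes>\<^sub>M M))"
    using assms by (intro nn_integral_distr measurable_rotation) (simp add: borel_prod)
  also have "\<dots> = (\<integral>\<^sup>+ u. (\<integral>\<^sup>+ v. F ((u + v) /\<^sub>R sqrt 2, (u - v) /\<^sub>R sqrt 2) \<partial>M) \<partial>M)"
    using nn_integral_fst[OF Fm'] by simp
  finally show ?thesis .
qed

text \<open>The set of pairs where \<open>k\<close> and \<open>g\<close> differ in some component is
  null, and rotation invariance keeps it null; Fubini then treats almost all sections. The 0-1
  valued integrand is the indicator of this set.\<close>

lemma rotated_AE_eq: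
  assumes [measurable]: "g \<in> borel_measurable borel" "k \<in> borel_measurable borel" and ae: "AE x in M. k x = g x"
  shows "AE u in M. AE v in M. rotated k u v = rotated g u v"
proof -
  have [measurable]: "Measurable.pred (borel \<Otimes>\<^sub>M borel) (\<lambda>p. k (fst p) = g (fst p) \<and> k (snd p) = g (snd p))" by measurable
  have "(\<integral>\<^sup>+ u. (\<integral>\<^sup>+ v. (if k ((u + v) /\<^sub>R sqrt 2) = g ((u + v) /\<^sub>R sqrt 2) \<and> k ((u - v) /\<^sub>R sqrt 2) = g ((u - v) /\<^sub>R sqrt 2) then 0 else 1) \<partial>M) \<partial>M)
     = (\<integral>\<^sup>+ x. (\<integral>\<^sup>+ y. (if k x = g x \<and> k y = g y then 0 else 1) \<partial>M) \<partial>M)"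
    using nn_integral_rotation[of "\<lambda>p. if k (fst p) = g (fst p) \<and> k (snd p) = g (snd p) then 0 else (1 :: ennreal)"] by simp
  also have "\<dots> = (\<integral>\<^sup>+ x. 0 \<partial>M)"
  proof (rule nn_integral_cong_AE)
    show "AE x in M. (\<integral>\<^sup>+ y. (if k x = g x \<and> k y = g y then 0 else 1) \<partial>M) = (0 :: ennreal)"
      using ae
    proof eventually_elim
      case (elim x)
      have "(\<integral>\<^sup>+ y. (if k x = g x \<and> k y = g y then 0 else 1) \<partial>M) = (\<integral>\<^sup>+ y. 0 \<partial>M :: ennreal)"
        using ae elim by (intro nn_integral_cong_AE) auto
      then show ?case by simp
    qed
  qed
  also have "\<dots> = 0" by simp
  finally have "AE u in M. (\<integral>\<^sup>+ v. (if k ((u + v) /\<^sub>R sqrt 2) = g ((u + v) /\<^sub>R sqrt 2) \<and> k ((u - v) /\<^sub>R sqrt 2) = g ((u - v) /\<^sub>R sqrt 2) then 0 else 1) \<partial>M) = (0 :: ennreal)"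
    by (subst (asm) nn_integral_0_iff_AE) auto
  then show ?thesis
  proof eventually_elim
    case (elim u)
    then have "AE v in M. (if k ((u + v) /\<^sub>R sqrt 2) = g ((u + v) /\<^sub>R sqrt 2) \<and> k ((u - v) /\<^sub>R sqrt 2) = g ((u - v) /\<^sub>R sqrt 2) then 0 else 1) = (0 :: ennreal)"
      by (subst (asm) nn_integral_0_iff_AE) auto
    then show ?case by eventually_elim (auto simp: rotated_def split: if_splits)
  qed
qed

text \<open>The rotation is linear, so midpoints of pairs go to midpoints, and the two midpoint
  inequalities are multiplied.\<close>

lemma rotated_midpoint:
  assumes mid: "\<And>x y. g x * g y \<le> (k ((1/2) *\<^sub>R (x + y)))\<^sup>2" and g0: "\<And>x. 0 \<le> g x"
  shows "rotated g u v * rotated g u' v' \<le> (rotated k ((1/2) *\<^sub>R (u + u')) ((1/2) *\<^sub>R (v + v')))\<^sup>2"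
proof -
  have a: "(1/2) *\<^sub>R ((u + v) /\<^sub>R sqrt 2 + (u' + v') /\<^sub>R sqrt 2) = ((1/2) *\<^sub>R (u + u') + (1/2) *\<^sub>R (v + v')) /\<^sub>R sqrt 2"
    and b: "(1/2) *\<^sub>R ((u - v) /\<^sub>R sqrt 2 + (u' - v') /\<^sub>R sqrt 2) = ((1/2) *\<^sub>R (u + u') - (1/2) *\<^sub>R (v + v')) /\<^sub>R sqrt 2"
    by (simp_all add: algebra_simps)
  have "(g ((u + v) /\<^sub>R sqrt 2) * g ((u' + v') /\<^sub>R sqrt 2)) * (g ((u - v) /\<^sub>R sqrt 2) * g ((u' - v') /\<^sub>R sqrt 2))
     \<le> (k (((1/2) *\<^sub>R (u + u') + (1/2) *\<^sub>R (v + v')) /\<^sub>R sqrt 2))\<^sup>2 * (k (((1/2) *\<^sub>R (u + u') - (1/2) *\<^sub>R (v + v')) /\<^sub>R sqrt 2))\<^sup>2"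
    using mid[of "(u + v) /\<^sub>R sqrt 2" "(u' + v') /\<^sub>R sqrt 2"] mid[of "(u - v) /\<^sub>R sqrt 2" "(u' - v') /\<^sub>R sqrt 2"] g0
    unfolding a b by (intro mult_mono mult_nonneg_nonneg) auto
  then show ?thesis by (simp add: rotated_def power_mult_distrib mult_ac)
qed

text \<open>Evenness in \<open>v\<close> comes from exchanging the two factors. Only almost every
  \<open>u\<close> qualifies, because the section of \<open>k\<close> must agree almost everywhere
  with that of \<open>g\<close>.\<close>

lemma even_log_concave_rotated:
  assumes g: "even_log_concave g"
  shows "AE u in M. even_log_concave (rotated g u)"
proof -
  obtain k where gm [measurable]: "g \<in> borel_measurable borel" and g01: "\<And>x. g x \<in> {0..1}" and ge: "\<And>x. g (- x) = g x"
    and km [measurable]: "k \<in> borel_measurable borel" and k01: "\<And>x. k x \<in> {0..1}" and kg: "AE x in M. k x = g x"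
    and mid: "\<And>x y. g x * g y \<le> (k ((1/2) *\<^sub>R (x + y)))\<^sup>2"
    using g unfolding even_log_concave_def by blast
  have g0: "0 \<le> g x" for x using g01[of x] by simp
  show ?thesis using rotated_AE_eq[OF gm km kg]
  proof eventually_elim
    case (elim u)
    have 1: "rotated g u \<in> borel_measurable borel" "rotated k u \<in> borel_measurable borel"
      by (rule measurable_rotated_section[OF gm], rule measurable_rotated_section[OF km])
    have 2: "rotated g u (- v) = rotated g u v" for v by (simp add: rotated_def mult.commute)
    have 3: "rotated g u v * rotated g u v' \<le> (rotated k u ((1/2) *\<^sub>R (v + v')))\<^sup>2" for v v'
      using rotated_midpoint[where g = g and k = k, OF mid g0, of u v u v'] by (simp flip: scaleR_2)
    show ?case unfolding even_log_concave_def
      using 1 2 3 rotated_unit[where g = g, OF g01] rotated_unit[where g = k, OF k01] elim by blast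
  qed
qed

text \<open>Prekopa-Leindler in the variable \<open>v\<close> gives the midpoint inequality.
  Changing the sign of \<open>u\<close> exchanges the two factors, up to the evenness of
  \<open>g\<close>.\<close>

lemma even_log_concave_marginal:
  assumes g: "even_log_concave g"
  shows "even_log_concave (\<lambda>u. \<integral>v. rotated g u v \<partial>M)"
proof -
  obtain k where gm [measurable]: "g \<in> borel_measurable borel" and g01: "\<And>x. g x \<in> {0..1}" and ge: "\<And>x. g (- x) = g x"
    and km [measurable]: "k \<in> borel_measurable borel" and k01: "\<And>x. k x \<in> {0..1}" and kg: "AE x in M. k x = g x"
    and mid: "\<And>x y. g x * g y \<le> (k ((1/2) *\<^sub>R (x + y)))\<^sup>2"
    using g unfolding even_log_concave_def by blast
  have g0: "0 \<le> g x" for x using g01[of x] by simp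
  have m: "rotated f u \<in> borel_measurable borel" if "f \<in> borel_measurable borel" for f u
    by (rule measurable_rotated_section[OF that])
  have 1: "(\<lambda>u. \<integral>v. rotated f u v \<partial>M) \<in> borel_measurable borel" if [measurable]: "f \<in> borel_measurable borel" for f
  proof -
    have "(\<lambda>u. \<integral>v. rotated f u v \<partial>M) \<in> borel_measurable M"
      by (rule borel_measurable_lebesgue_integral) (simp add: split_beta)
    then show ?thesis by simp
  qed
  have 2: "(\<integral>v. rotated f u v \<partial>M) \<in> {0..1}" if "f \<in> borel_measurable borel" "\<And>x. f x \<in> {0..1}" for f u
    by (rule integral_unit_interval[OF m[OF that(1)] rotated_unit[where g = f, OF that(2)]])
  have 3: "(\<integral>v. rotated g (- u) v \<partial>M) = (\<integral>v. rotated g u v \<partial>M)" for u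
  proof -
    have "rotated g (- u) v = rotated g u v" for v
      using ge[of "(u - v) /\<^sub>R sqrt 2"] ge[of "(u + v) /\<^sub>R sqrt 2"]
      by (simp add: rotated_def mult.commute) (simp add: algebra_simps)
    then show ?thesis by simp
  qed
  have 4: "AE u in M. (\<integral>v. rotated k u v \<partial>M) = (\<integral>v. rotated g u v \<partial>M)"
    using rotated_AE_eq[OF gm km kg]
    by eventually_elim (intro integral_cong_AE, simp_all add: m)
  have 5: "(\<integral>v. rotated g u v \<partial>M) * (\<integral>v. rotated g u' v \<partial>M) \<le> (\<integral>v. rotated k ((1/2) *\<^sub>R (u + u')) v \<partial>M)\<^sup>2" for u u'
    by (rule midpoint_prekopaD[OF midpoint_prekopa_gaussian m[OF gm] m[OF gm] m[OF km] rotated_unit[where g = g, OF g01] rotated_unit[where g = g, OF g01] rotated_unit[where g = k, OF k01] rotated_midpoint[where g = g and k = k, OF mid g0]])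
  show ?thesis unfolding even_log_concave_def
    using 1[OF gm] 1[OF km] 2[OF gm g01] 2[OF km k01] 3 4 5 by blast
qed

text \<open>The error is weighted by the mass of \<open>g\<close>, and the bound is uniform in
  \<open>g\<close> and in the shift \<open>w\<close>: conditioning on \<open>u\<close> replaces both
  the weight and the base point.\<close>

definition correlated_upto :: "('a \<Rightarrow> ennreal) \<Rightarrow> real \<Rightarrow> ennreal \<Rightarrow> bool" where
  "correlated_upto f s \<epsilon> \<longleftrightarrow> (\<forall>w g. even_log_concave g \<longrightarrow>
     (\<integral>\<^sup>+ x. ennreal (g x) * f (s *\<^sub>R x + w) \<partial>M) \<le> ennreal (\<integral>x. g x \<partial>M) * ((\<integral>\<^sup>+ x. f (s *\<^sub>R x + w) \<partial>M) + \<epsilon>))"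

text \<open>Two samples weighted by \<open>g\<close> are rotated into \<open>u\<close> and \<open>v\<close>. Given \<open>u\<close>, the law of \<open>v\<close> has again an
  even log-concave density, so \<open>v\<close> may be replaced by a Gaussian sample at cost \<open>\<epsilon>\<close>; then the same is
  done with \<open>u\<close>, whose density is the marginal.\<close>

lemma correlated_upto_double:
  assumes fm [measurable]: "f \<in> borel_measurable borel" and good: "correlated_upto f (s / sqrt 2) \<epsilon>"
  shows "correlated_upto f s (2 * \<epsilon>)"
  unfolding correlated_upto_def
proof (intro allI impI)
  fix w :: 'a and g assume g: "even_log_concave g"
  have gm [measurable]: "g \<in> borel_measurable borel" and g01: "\<And>x. g x \<in> {0..1}"
    using g unfolding even_log_concave_def by blast+
  define I where "I = (\<integral>x. g x \<partial>M)"
  define r where "r = s / sqrt 2"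
  define \<kappa> where "\<kappa> u = (\<integral>v. rotated g u v \<partial>M)" for u
  have \<kappa>: "even_log_concave \<kappa>" unfolding \<kappa>_def[abs_def] by (rule even_log_concave_marginal[OF g])
  have \<kappa>m [measurable]: "\<kappa> \<in> borel_measurable borel" and \<kappa>01: "\<And>x. \<kappa> x \<in> {0..1}"
    using \<kappa> unfolding even_log_concave_def by blast+
  have good: "(\<integral>\<^sup>+ x. ennreal (h x) * f (r *\<^sub>R x + w') \<partial>M) \<le> ennreal (\<integral>x. h x \<partial>M) * ((\<integral>\<^sup>+ x. f (r *\<^sub>R x + w') \<partial>M) + \<epsilon>)"
    if "even_log_concave h" for h w'
    using good that unfolding correlated_upto_def r_def by blast
  have rm: "rotated g u \<in> borel_measurable borel" for u
    by (rule measurable_rotated_section[OF gm])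
  have gI: "(\<integral>\<^sup>+ x. ennreal (g x) \<partial>M) = ennreal I"
    unfolding I_def using g01 by (intro nn_integral_eq_integral integrable_unit_interval) auto
  have \<kappa>nn: "(\<integral>\<^sup>+ v. ennreal (rotated g u v) \<partial>M) = ennreal (\<kappa> u)" for u
    unfolding \<kappa>_def using rotated_unit[where g = g, OF g01] by (intro nn_integral_eq_integral integrable_unit_interval rm) auto
  have \<kappa>I: "(\<integral>\<^sup>+ u. ennreal (\<kappa> u) \<partial>M) = ennreal I * ennreal I"
  proof -
    have "(\<integral>\<^sup>+ u. ennreal (\<kappa> u) \<partial>M) = (\<integral>\<^sup>+ u. (\<integral>\<^sup>+ v. ennreal (rotated g u v) \<partial>M) \<partial>M)" by (simp add: \<kappa>nn)
    also have "\<dots> = (\<integral>\<^sup>+ x. (\<integral>\<^sup>+ y. ennreal (g x * g y) \<partial>M) \<partial>M)"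
      unfolding rotated_def using nn_integral_rotation[of "\<lambda>p. ennreal (g (fst p) * g (snd p))"] by simp
    also have "\<dots> = (\<integral>\<^sup>+ x. ennreal (g x) * (\<integral>\<^sup>+ y. ennreal (g y) \<partial>M) \<partial>M)"
      using g01 by (subst nn_integral_cmult[symmetric]) (auto simp: ennreal_mult)
    also have "\<dots> = ennreal I * ennreal I" by (simp add: gI nn_integral_multc)
    finally show ?thesis .
  qed
  have \<kappa>I': "ennreal (\<integral>u. \<kappa> u \<partial>M) = ennreal I * ennreal I"
    using \<kappa>I \<kappa>01 by (subst (asm) nn_integral_eq_integral) (auto intro!: integrable_unit_interval)
  \<comment> \<open>In rotated variables the argument splits into multiples of \<open>u\<close> and
    \<open>v\<close> at the common scale \<open>r\<close>, so the same hypothesis serves both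
    replacements.\<close>
  have sr: "s *\<^sub>R ((u + v) /\<^sub>R sqrt 2) + w = r *\<^sub>R v + (r *\<^sub>R u + w)" for u v
  proof -
    have "s *\<^sub>R ((u + v) /\<^sub>R sqrt 2) = r *\<^sub>R (u + v)" by (simp add: r_def divide_inverse)
    then show ?thesis by (simp add: scaleR_add_right add_ac)
  qed
  \<comment> \<open>The factor \<open>I\<close> introduces the independent second sample
    \<open>y\<close>. It is cancelled at the end, where mass zero needs a separate argument.\<close>
  have "ennreal I * (\<integral>\<^sup>+ x. ennreal (g x) * f (s *\<^sub>R x + w) \<partial>M) =
      (\<integral>\<^sup>+ x. (\<integral>\<^sup>+ y. ennreal (g x * g y) * f (s *\<^sub>R x + w) \<partial>M) \<partial>M)"
  proof -
    have "(\<integral>\<^sup>+ y. ennreal (g x * g y) * f (s *\<^sub>R x + w) \<partial>M) = (ennreal (g x) * f (s *\<^sub>R x + w)) * ennreal I" for x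
    proof -
      have "(\<integral>\<^sup>+ y. ennreal (g x * g y) * f (s *\<^sub>R x + w) \<partial>M) = (\<integral>\<^sup>+ y. (ennreal (g x) * f (s *\<^sub>R x + w)) * ennreal (g y) \<partial>M)"
        using g01 by (intro nn_integral_cong) (simp add: ennreal_mult mult_ac)
      also have "\<dots> = (ennreal (g x) * f (s *\<^sub>R x + w)) * ennreal I"
        by (subst nn_integral_cmult) (simp_all add: gI)
      finally show ?thesis .
    qed
    then show ?thesis by (simp add: nn_integral_multc nn_integral_cmult mult.commute)
  qed
  also have "\<dots> = (\<integral>\<^sup>+ u. (\<integral>\<^sup>+ v. ennreal (rotated g u v) * f (r *\<^sub>R v + (r *\<^sub>R u + w)) \<partial>M) \<partial>M)"
    using nn_integral_rotation[of "\<lambda>p. ennreal (g (fst p) * g (snd p)) * f (s *\<^sub>R fst p + w)"]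
    by (simp add: rotated_def[symmetric] sr[symmetric])
  also have "\<dots> \<le> (\<integral>\<^sup>+ u. ennreal (\<kappa> u) * ((\<integral>\<^sup>+ v. f (r *\<^sub>R v + (r *\<^sub>R u + w)) \<partial>M) + \<epsilon>) \<partial>M)"
  proof (rule nn_integral_mono_AE)
    show "AE u in M. (\<integral>\<^sup>+ v. ennreal (rotated g u v) * f (r *\<^sub>R v + (r *\<^sub>R u + w)) \<partial>M) \<le>
        ennreal (\<kappa> u) * ((\<integral>\<^sup>+ v. f (r *\<^sub>R v + (r *\<^sub>R u + w)) \<partial>M) + \<epsilon>)"
      using even_log_concave_rotated[OF g] by eventually_elim (unfold \<kappa>_def, rule good)
  qed
  also have "\<dots> = (\<integral>\<^sup>+ u. ennreal (\<kappa> u) * (\<integral>\<^sup>+ v. f (r *\<^sub>R v + (r *\<^sub>R u + w)) \<partial>M) \<partial>M) + ennreal I * ennreal I * \<epsilon>"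
    by (simp add: distrib_left nn_integral_add nn_integral_multc \<kappa>I)
  also have "(\<integral>\<^sup>+ u. ennreal (\<kappa> u) * (\<integral>\<^sup>+ v. f (r *\<^sub>R v + (r *\<^sub>R u + w)) \<partial>M) \<partial>M) =
     (\<integral>\<^sup>+ u. (\<integral>\<^sup>+ v. ennreal (\<kappa> u) * f (r *\<^sub>R v + (r *\<^sub>R u + w)) \<partial>M) \<partial>M)"
    by (simp add: nn_integral_cmult)
  \<comment> \<open>Once \<open>v\<close> is an unweighted sample, Fubini exchanges the order of
    integration, and now \<open>u\<close>, whose density is \<open>\<kappa>\<close>, is replaced for
    fixed \<open>v\<close>.\<close>
  also have "\<dots> = (\<integral>\<^sup>+ v. (\<integral>\<^sup>+ u. ennreal (\<kappa> u) * f (r *\<^sub>R u + (r *\<^sub>R v + w)) \<partial>M) \<partial>M)"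
  proof -
    interpret MM: pair_sigma_finite M M ..
    have "(\<lambda>(u, v). ennreal (\<kappa> u) * f (r *\<^sub>R v + (r *\<^sub>R u + w))) \<in> borel_measurable (M \<Otimes>\<^sub>M M)"
      unfolding split_beta by measurable
    from MM.Fubini'[OF this] show ?thesis by (simp add: add.left_commute)
  qed
  also have "\<dots> \<le> (\<integral>\<^sup>+ v. ennreal I * ennreal I * ((\<integral>\<^sup>+ u. f (r *\<^sub>R u + (r *\<^sub>R v + w)) \<partial>M) + \<epsilon>) \<partial>M)"
    using good[OF \<kappa>] unfolding \<kappa>I' by (intro nn_integral_mono) auto
  also have "\<dots> = ennreal I * ennreal I * ((\<integral>\<^sup>+ v. (\<integral>\<^sup>+ u. f (r *\<^sub>R u + (r *\<^sub>R v + w)) \<partial>M) \<partial>M) + \<epsilon>)"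
    by (subst nn_integral_cmult) (simp_all add: nn_integral_add emeasure_space_1[simplified])
  also have "(\<integral>\<^sup>+ v. (\<integral>\<^sup>+ u. f (r *\<^sub>R u + (r *\<^sub>R v + w)) \<partial>M) \<partial>M) = (\<integral>\<^sup>+ x. (\<integral>\<^sup>+ y. f (s *\<^sub>R x + w) \<partial>M) \<partial>M)"
  proof -
    have "(\<lambda>p. f (s *\<^sub>R fst p + w)) \<in> borel_measurable (borel \<Otimes>\<^sub>M borel)" by measurable
    from nn_integral_rotation[OF this] show ?thesis unfolding fst_conv sr by (rule sym)
  qed
  also have "\<dots> = (\<integral>\<^sup>+ x. f (s *\<^sub>R x + w) \<partial>M)" by (simp add: emeasure_space_1[simplified])
  finally have main: "ennreal I * (\<integral>\<^sup>+ x. ennreal (g x) * f (s *\<^sub>R x + w) \<partial>M) \<le>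
      ennreal I * (ennreal I * ((\<integral>\<^sup>+ x. f (s *\<^sub>R x + w) \<partial>M) + 2 * \<epsilon>))"
    by (simp add: distrib_left mult_2 mult.assoc add.assoc add_right_mono)
  show "(\<integral>\<^sup>+ x. ennreal (g x) * f (s *\<^sub>R x + w) \<partial>M) \<le> ennreal (\<integral>x. g x \<partial>M) * ((\<integral>\<^sup>+ x. f (s *\<^sub>R x + w) \<partial>M) + 2 * \<epsilon>)"
  proof (cases "I = 0")
    case True
    then have "AE x in M. g x = 0"
      using integral_nonneg_eq_0_iff_AE[of M g] g01 integrable_unit_interval[OF gm g01] unfolding I_def by auto
    then have "(\<integral>\<^sup>+ x. ennreal (g x) * f (s *\<^sub>R x + w) \<partial>M) = (\<integral>\<^sup>+ x. 0 \<partial>M)"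
      by (intro nn_integral_cong_AE) auto
    then show ?thesis by simp
  next
    case False
    then have "0 < I" using integral_unit_interval[OF gm g01] unfolding I_def by auto
    then show ?thesis using main unfolding I_def[symmetric]
      by (subst (asm) ennreal_mult_le_mult_iff) auto
  qed
qed

lemma correlated_upto_iterate:
  assumes fm: "f \<in> borel_measurable borel" and "correlated_upto f (s / sqrt 2 ^ n) \<epsilon>"
  shows "correlated_upto f s (2 ^ n * \<epsilon>)"
  using assms(2)
proof (induction n arbitrary: s)
  case (Suc n)
  have "correlated_upto f (s / sqrt 2) (2 ^ n * \<epsilon>)" using Suc by (simp add: mult.commute)
  from correlated_upto_double[OF fm this] show ?case by (simp add: mult.assoc)
qed simp

end

section \<open>Maxima of affine functionals\<close>

context gaussian_measure
begin

text \<open>The sum is at most \<open>n\<close> times its largest term, and the exponential of that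
  is at most a sum of the integrable functions \<open>exp (n * b j x)\<close> and
  \<open>exp (- n * b j x)\<close>.\<close>

lemma integrable_exp_sum_abs:
  fixes b :: "'i \<Rightarrow> 'a \<Rightarrow> real"
  assumes J: "finite J" and b: "\<And>j. j \<in> J \<Longrightarrow> bounded_linear (b j)"
  shows "integrable M (\<lambda>x. exp (\<Sum>j\<in>J. \<bar>b j x\<bar>))"
proof (cases "J = {}")
  case True then show ?thesis by simp
next
  case False
  define n where "n = real (card J)"
  have n: "n > 0" using False J by (simp add: n_def card_gt_0_iff)
  have bm: "b j \<in> borel_measurable borel" if "j \<in> J" for j using b[OF that] by (rule bounded_linear_measurable)
  show ?thesis
  proof (rule Bochner_Integration.integrable_bound)
    show "integrable M (\<lambda>x. \<Sum>j\<in>J. exp (n * b j x) + exp (- n * b j x))"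
      using b by (intro Bochner_Integration.integrable_sum Bochner_Integration.integrable_add integrable_exp_functional bounded_linear_const_mult)
    show "(\<lambda>x. exp (\<Sum>j\<in>J. \<bar>b j x\<bar>)) \<in> borel_measurable M"
    proof -
      have "(\<lambda>x. \<Sum>j\<in>J. \<bar>b j x\<bar>) \<in> borel_measurable borel"
        by (rule borel_measurable_sum) (rule borel_measurable_abs[OF bm])
      then show ?thesis unfolding measurable_M by (rule measurable_compose[OF _ borel_measurable_exp])
    qed
    show "AE x in M. norm (exp (\<Sum>j\<in>J. \<bar>b j x\<bar>)) \<le> norm (\<Sum>j\<in>J. exp (n * b j x) + exp (- n * b j x))"
    proof (rule AE_I2)
      fix x
      obtain i where i: "i \<in> J" "\<And>j. j \<in> J \<Longrightarrow> \<bar>b j x\<bar> \<le> \<bar>b i x\<bar>"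
        using obtains_MAX[OF J False, of "\<lambda>j. \<bar>b j x\<bar>"] J by (metis Max_ge finite_imageI imageI)
      have "(\<Sum>j\<in>J. \<bar>b j x\<bar>) \<le> n * \<bar>b i x\<bar>"
        using sum_bounded_above[of J "\<lambda>j. \<bar>b j x\<bar>" "\<bar>b i x\<bar>"] i by (simp add: n_def)
      then have "exp (\<Sum>j\<in>J. \<bar>b j x\<bar>) \<le> exp (n * \<bar>b i x\<bar>)" by simp
      also have "\<dots> \<le> exp (n * b i x) + exp (- n * b i x)"
        by (cases "b i x \<ge> 0") (simp_all add: add_increasing add_increasing2)
      also have "\<dots> \<le> (\<Sum>j\<in>J. exp (n * b j x) + exp (- n * b j x))"
        using J i(1) by (intro member_le_sum) (auto intro: add_nonneg_nonneg)
      finally show "norm (exp (\<Sum>j\<in>J. \<bar>b j x\<bar>)) \<le> norm (\<Sum>j\<in>J. exp (n * b j x) + exp (- n * b j x))"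
        by (simp add: sum_nonneg)
    qed
  qed
qed

text \<open>With \<open>p\<close> the softmax weights at \<open>w\<close>, the function at \<open>s x + w\<close> is an affine function of \<open>x\<close> plus
  \<open>ln (1 + D x)\<close>, where \<open>D\<close> is a combination of exponentials of functionals and \<open>D\<^sup>2 = O(s\<^sup>4)\<close>.\<close>

lemma log_sum_exp_correlated_upto:
  fixes a :: "'i \<Rightarrow> 'a \<Rightarrow> real" and c :: "'i \<Rightarrow> real"
  assumes J: "finite J" "J \<noteq> {}" and a: "\<And>j. j \<in> J \<Longrightarrow> bounded_linear (a j)"
  defines "F \<equiv> \<lambda>x. ln (\<Sum>j\<in>J. exp (a j x + c j))"
  assumes F0: "\<And>x. 0 \<le> F x"
  obtains C where "0 \<le> C" "\<And>s. 0 < s \<Longrightarrow> s \<le> 1 \<Longrightarrow> correlated_upto (\<lambda>x. ennreal (F x)) s (ennreal (C * s ^ 4))"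
proof -
  define \<Lambda> where "\<Lambda> x = (\<Sum>j\<in>J. \<bar>a j x\<bar>)" for x
  have \<Lambda>0: "0 \<le> \<Lambda> x" for x by (simp add: \<Lambda>_def sum_nonneg)
  \<comment> \<open>The integral of the square of
    \<open>4 * s\<^sup>2 * exp (4 * \<Lambda> x)\<close>, the bound for \<open>D x\<close> below,
    with the power of \<open>s\<close> taken out. It depends on neither \<open>g\<close> nor
    \<open>w\<close>.\<close>
  define C where "C = 16 * (\<integral>x. exp (8 * \<Lambda> x) \<partial>M)"
  have e8: "integrable M (\<lambda>x. exp (8 * \<Lambda> x))"
    using integrable_exp_sum_abs[OF J(1), of "\<lambda>j x. 8 * a j x"] a
    by (simp add: \<Lambda>_def sum_distrib_left abs_mult bounded_linear_const_mult)
  have am [measurable]: "a j \<in> borel_measurable borel" if "j \<in> J" for j using a[OF that] by (rule bounded_linear_measurable)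
  have Fm [measurable]: "F \<in> borel_measurable borel"
    unfolding F_def using am by (intro borel_measurable_ln borel_measurable_sum borel_measurable_exp borel_measurable_add) auto
  have "0 \<le> C" by (simp add: C_def)
  moreover have "correlated_upto (\<lambda>x. ennreal (F x)) s (ennreal (C * s ^ 4))" if s: "0 < s" "s \<le> 1" for s
    unfolding correlated_upto_def
  proof (intro allI impI)
    fix w :: 'a and g assume g: "even_log_concave g"
    have gm [measurable]: "g \<in> borel_measurable borel" and g01: "\<And>x. g x \<in> {0..1}" and ge: "\<And>x. g (- x) = g x"
      using g unfolding even_log_concave_def by blast+
    define Z where "Z = (\<Sum>j\<in>J. exp (a j w + c j))"
    have Z: "Z > 0" unfolding Z_def using J by (intro sum_pos) auto
    define p where "p j = exp (a j w + c j) / Z" for j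
    have p0: "0 \<le> p j" for j using Z by (simp add: p_def)
    have p1: "(\<Sum>j\<in>J. p j) = 1" using Z by (simp add: p_def Z_def flip: sum_divide_distrib)
    have ple: "p j \<le> 1" if "j \<in> J" for j using member_le_sum[of j J p] J p0 p1 that by simp
    \<comment> \<open>The derivative of \<open>F\<close> at \<open>w\<close>. Subtracting it centres
      the functionals under the weights \<open>p\<close>, so the expansion of \<open>D\<close>
      starts with its quadratic term.\<close>
    define m where "m x = (\<Sum>j\<in>J. p j * a j x)" for x
    define b where "b j x = a j x - m x" for j x
    have m: "bounded_linear m"
      unfolding m_def using a by (intro bounded_linear_sum bounded_linear_const_mult)
    have b: "bounded_linear (b j)" if "j \<in> J" for j
      unfolding b_def by (intro bounded_linear_sub a that m)
    have sb: "bounded_linear (\<lambda>x. s * b j x)" if "j \<in> J" for j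
      by (intro bounded_linear_const_mult b that)
    have pb: "(\<Sum>j\<in>J. p j * b j x) = 0" for x
      by (simp add: b_def m_def right_diff_distrib sum_subtractf p1 flip: sum_distrib_right)
    define D where "D x = (\<Sum>j\<in>J. p j * (exp (s * b j x) - 1))" for x
    have D_alt: "D x = (\<Sum>j\<in>J. p j * (exp (s * b j x) - 1 - s * b j x))" for x
    proof -
      have "(\<Sum>j\<in>J. p j * (exp (s * b j x) - 1 - s * b j x)) = D x - s * (\<Sum>j\<in>J. p j * b j x)"
        by (simp add: D_def right_diff_distrib sum_subtractf sum_distrib_left mult_ac)
      then show ?thesis by (simp add: pb)
    qed
    have D0: "0 \<le> D x" for x
    proof -
      have "0 \<le> exp (s * b j x) - 1 - s * b j x" for j
        using exp_ge_add_one_self[of "s * b j x"] by linarith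
      then show ?thesis unfolding D_alt using p0 by (intro sum_nonneg mult_nonneg_nonneg) auto
    qed
    have b_le: "\<bar>b j x\<bar> \<le> 2 * \<Lambda> x" if "j \<in> J" for j x
    proof -
      have "\<bar>m x\<bar> \<le> (\<Sum>j\<in>J. \<bar>p j * a j x\<bar>)" unfolding m_def by (rule sum_abs)
      also have "\<dots> \<le> \<Lambda> x" unfolding \<Lambda>_def using p0 ple
        by (intro sum_mono) (simp add: abs_mult mult_left_le_one_le)
      finally have "\<bar>m x\<bar> \<le> \<Lambda> x" .
      moreover have "\<bar>a j x\<bar> \<le> \<Lambda> x" unfolding \<Lambda>_def using J(1) that by (intro member_le_sum) auto
      ultimately show ?thesis unfolding b_def by linarith
    qed
    have D_le: "D x \<le> 4 * s\<^sup>2 * exp (4 * \<Lambda> x)" for x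
    proof -
      have t: "exp (s * b j x) - 1 - s * b j x \<le> 4 * s\<^sup>2 * exp (4 * \<Lambda> x)" if "j \<in> J" for j
      proof -
        have y: "\<bar>s * b j x\<bar> \<le> s * (2 * \<Lambda> x)" using b_le[OF that, of x] s by (simp add: abs_mult mult_left_mono)
        have y2: "s * (2 * \<Lambda> x) \<le> 2 * \<Lambda> x" using s \<Lambda>0[of x] by (intro mult_left_le_one_le) auto
        have "exp (s * b j x) - 1 - s * b j x \<le> \<bar>s * b j x\<bar>\<^sup>2 * exp \<bar>s * b j x\<bar>" using exp_minus_one_minus_le by simp
        also have "\<dots> \<le> (s * (2 * \<Lambda> x))\<^sup>2 * exp (2 * \<Lambda> x)"
          using y y2 by (intro mult_mono power_mono) auto
        also have "\<dots> = 4 * s\<^sup>2 * ((\<Lambda> x)\<^sup>2 * exp (2 * \<Lambda> x))" by (simp add: power_mult_distrib)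
        \<comment> \<open>The square of \<Lambda> is absorbed into the exponential, which raises the
          exponent from \<open>2 * \<Lambda> x\<close> to \<open>4 * \<Lambda> x\<close>.\<close>
        also have "\<dots> \<le> 4 * s\<^sup>2 * (exp (\<Lambda> x) ^ 2 * exp (2 * \<Lambda> x))"
        proof -
          have "\<Lambda> x \<le> exp (\<Lambda> x)" using exp_ge_add_one_self[of "\<Lambda> x"] by linarith
          then show ?thesis using \<Lambda>0[of x] by (intro mult_left_mono mult_right_mono power_mono) auto
        qed
        also have "exp (\<Lambda> x) ^ 2 * exp (2 * \<Lambda> x) = exp (4 * \<Lambda> x)"
          by (simp add: power2_eq_square flip: exp_add)
        finally show ?thesis .
      qed
      have "D x \<le> (\<Sum>j\<in>J. p j * (4 * s\<^sup>2 * exp (4 * \<Lambda> x)))"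
        unfolding D_alt using t p0 by (intro sum_mono mult_left_mono) auto
      also have "\<dots> = 4 * s\<^sup>2 * exp (4 * \<Lambda> x)" using p1 by (simp flip: sum_distrib_right)
      finally show ?thesis .
    qed
    have D2_le: "(D x)\<^sup>2 \<le> 16 * s ^ 4 * exp (8 * \<Lambda> x)" for x
    proof -
      have "(D x)\<^sup>2 \<le> (4 * s\<^sup>2 * exp (4 * \<Lambda> x))\<^sup>2" using D_le D0 by (intro power_mono)
      also have "\<dots> = 16 * s ^ 4 * exp (8 * \<Lambda> x)"
        by (simp add: power_mult_distrib flip: power_mult) (simp add: power2_eq_square flip: exp_add)
      finally show ?thesis .
    qed
    have expand: "F (s *\<^sub>R x + w) = F w + s * m x + ln (1 + D x)" for x
    proof -
      have R: "1 + D x = (\<Sum>j\<in>J. p j * exp (s * b j x))"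
        by (simp add: D_def right_diff_distrib sum_subtractf p1)
      have "exp (a j (s *\<^sub>R x + w) + c j) = Z * (exp (s * m x) * (p j * exp (s * b j x)))" if "j \<in> J" for j
        using Z by (simp add: p_def linear_simps[OF a[OF that]] b_def exp_add exp_diff right_diff_distrib)
      then have "(\<Sum>j\<in>J. exp (a j (s *\<^sub>R x + w) + c j)) = Z * exp (s * m x) * (1 + D x)"
        by (simp add: R sum_distrib_left mult.assoc)
      moreover have "0 < 1 + D x" using D0[of x] by linarith
      ultimately show ?thesis using Z by (simp add: F_def Z_def[symmetric] ln_mult)
    qed
    note mm [measurable] = bounded_linear_measurable[OF m]
    have iexp: "integrable M (\<lambda>x. exp (s * b j x))" if "j \<in> J" for j
      by (rule integrable_exp_functional[OF sb[OF that]])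
    have iD: "integrable M D"
      unfolding D_def[abs_def] using iexp by (intro Bochner_Integration.integrable_sum integrable_mult_right Bochner_Integration.integrable_diff) auto
    have Dm [measurable]: "D \<in> borel_measurable borel" using borel_measurable_integrable[OF iD] by simp
    have iD2: "integrable M (\<lambda>x. (D x)\<^sup>2)"
      using D2_le by (intro Bochner_Integration.integrable_bound[OF integrable_mult_right[OF e8, of "16 * s ^ 4"]]) (auto intro!: AE_I2)
    have ln_le: "ln (1 + D x) \<le> D x" for x using ln_add_one_self_le_self[OF D0] .
    have ln0: "0 \<le> ln (1 + D x)" for x using D0[of x] by simp
    have iln: "integrable M (\<lambda>x. ln (1 + D x))"
      using ln_le ln0 D0 by (intro Bochner_Integration.integrable_bound[OF iD]) (auto intro!: AE_I2)
    have im: "integrable M m" by (rule integrable_functional[OF m])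
    have mult_g: "integrable M (\<lambda>x. g x * f x)" if "integrable M f" for f :: "'a \<Rightarrow> real"
    proof (rule Bochner_Integration.integrable_bound[OF that])
      show "AE x in M. norm (g x * f x) \<le> norm (f x)"
        using g01 by (intro AE_I2) (simp add: abs_mult mult_left_le_one_le)
      show "(\<lambda>x. g x * f x) \<in> borel_measurable M" using borel_measurable_integrable[OF that] gm by simp
    qed
    have ig: "integrable M g" by (rule integrable_unit_interval[OF gm g01])
    have iF: "integrable M (\<lambda>x. F (s *\<^sub>R x + w))" unfolding expand using im iln by simp
    \<comment> \<open>An odd function is integrated against an even weight.\<close>
    have gm0: "(\<integral>x. g x * m x \<partial>M) = 0"
    proof -
      have "(\<integral>x. g x * m x \<partial>M) = (\<integral>x. g (- x) * m (- x) \<partial>M)"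
        by (rule integral_uminus[symmetric]) simp
      also have "\<dots> = - (\<integral>x. g x * m x \<partial>M)" by (simp add: ge linear_simps[OF m])
      finally show ?thesis by simp
    qed
    \<comment> \<open>This comparison has no error: \<open>D\<close> combines, with nonnegative
      coefficients, exponentials minus constants, and constants have no excess either.\<close>
    have gD: "(\<integral>x. g x * D x \<partial>M) \<le> (\<integral>x. g x \<partial>M) * (\<integral>x. D x \<partial>M)"
    proof -
      have "(\<integral>x. g x * D x \<partial>M) = (\<integral>x. (\<Sum>j\<in>J. p j * (g x * exp (s * b j x) - g x)) \<partial>M)"
        by (simp add: D_def sum_distrib_left algebra_simps)
      also have "\<dots> = (\<Sum>j\<in>J. p j * ((\<integral>x. g x * exp (s * b j x) \<partial>M) - (\<integral>x. g x \<partial>M)))"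
        using mult_g[OF iexp] ig by (subst Bochner_Integration.integral_sum) auto
      also have "\<dots> \<le> (\<Sum>j\<in>J. p j * ((\<integral>x. g x \<partial>M) * (\<integral>x. exp (s * b j x) \<partial>M) - (\<integral>x. g x \<partial>M)))"
        using integral_mult_exp_le[OF g sb] p0 by (intro sum_mono mult_left_mono) auto
      also have "\<dots> = (\<integral>x. g x \<partial>M) * (\<Sum>j\<in>J. p j * ((\<integral>x. exp (s * b j x) \<partial>M) - 1))"
        by (simp add: sum_distrib_left algebra_simps)
      also have "(\<Sum>j\<in>J. p j * ((\<integral>x. exp (s * b j x) \<partial>M) - 1)) = (\<integral>x. D x \<partial>M)"
        unfolding D_def[abs_def] using iexp by (subst Bochner_Integration.integral_sum) (auto simp: prob_space[simplified])
      finally show ?thesis .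
    qed
    have I01: "(\<integral>x. g x \<partial>M) \<in> {0..1}" by (rule integral_unit_interval[OF gm g01])
    have "(\<integral>x. g x * F (s *\<^sub>R x + w) \<partial>M) = (\<integral>x. F w * g x + s * (g x * m x) + g x * ln (1 + D x) \<partial>M)"
      unfolding expand by (simp add: algebra_simps)
    also have "\<dots> = F w * (\<integral>x. g x \<partial>M) + s * (\<integral>x. g x * m x \<partial>M) + (\<integral>x. g x * ln (1 + D x) \<partial>M)"
      using ig mult_g[OF im] mult_g[OF iln] by simp
    also have "(\<integral>x. g x * ln (1 + D x) \<partial>M) \<le> (\<integral>x. g x * D x \<partial>M)"
      using ln_le g01 mult_g[OF iln] mult_g[OF iD] by (intro integral_mono mult_left_mono) auto
    also note gD
    finally have up: "(\<integral>x. g x * F (s *\<^sub>R x + w) \<partial>M) \<le> (\<integral>x. g x \<partial>M) * (F w + (\<integral>x. D x \<partial>M))"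
      by (simp add: gm0 algebra_simps)
    \<comment> \<open>On the weighted side \<open>ln (1 + D) \<le> D\<close> was enough. On the
      unweighted side the reverse estimate loses the integral of \<open>D\<^sup>2\<close>, the only
      source of the error.\<close>
    have "(\<integral>x. D x \<partial>M) - (\<integral>x. (D x)\<^sup>2 \<partial>M) = (\<integral>x. D x - (D x)\<^sup>2 \<partial>M)" using iD iD2 by simp
    also have "\<dots> \<le> (\<integral>x. ln (1 + D x) \<partial>M)"
      using ln_one_plus_ge[OF D0] iD iD2 iln by (intro integral_mono) auto
    finally have "F w + (\<integral>x. D x \<partial>M) \<le> F w + (\<integral>x. ln (1 + D x) \<partial>M) + (\<integral>x. (D x)\<^sup>2 \<partial>M)" by simp
    also have "F w + (\<integral>x. ln (1 + D x) \<partial>M) = (\<integral>x. F (s *\<^sub>R x + w) \<partial>M)"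
      unfolding expand using im iln integral_functional[OF m] by (simp add: prob_space[simplified])
    also have "(\<integral>x. (D x)\<^sup>2 \<partial>M) \<le> (\<integral>x. 16 * s ^ 4 * exp (8 * \<Lambda> x) \<partial>M)"
      using D2_le iD2 e8 by (intro integral_mono) auto
    also have "\<dots> = C * s ^ 4" by (simp add: C_def)
    finally have lo: "F w + (\<integral>x. D x \<partial>M) \<le> (\<integral>x. F (s *\<^sub>R x + w) \<partial>M) + C * s ^ 4" by simp
    have "(\<integral>x. g x * F (s *\<^sub>R x + w) \<partial>M) \<le> (\<integral>x. g x \<partial>M) * ((\<integral>x. F (s *\<^sub>R x + w) \<partial>M) + C * s ^ 4)"
      using up mult_left_mono[OF lo, of "\<integral>x. g x \<partial>M"] I01 by simp
    then have "ennreal (\<integral>x. g x * F (s *\<^sub>R x + w) \<partial>M) \<le> ennreal ((\<integral>x. g x \<partial>M) * ((\<integral>x. F (s *\<^sub>R x + w) \<partial>M) + C * s ^ 4))"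
      by (rule ennreal_leI)
    also have "\<dots> = ennreal (\<integral>x. g x \<partial>M) * (ennreal (\<integral>x. F (s *\<^sub>R x + w) \<partial>M) + ennreal (C * s ^ 4))"
      using I01 F0 \<open>0 \<le> C\<close> s by (subst ennreal_mult) (auto simp: ennreal_plus intro!: add_nonneg_nonneg)
    also have "ennreal (\<integral>x. F (s *\<^sub>R x + w) \<partial>M) = (\<integral>\<^sup>+ x. ennreal (F (s *\<^sub>R x + w)) \<partial>M)"
      using iF F0 by (intro nn_integral_eq_integral[symmetric]) auto
    also have "ennreal (\<integral>x. g x * F (s *\<^sub>R x + w) \<partial>M) = (\<integral>\<^sup>+ x. ennreal (g x * F (s *\<^sub>R x + w)) \<partial>M)"
      using mult_g[OF iF] F0 g01 by (intro nn_integral_eq_integral[symmetric]) auto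
    also have "\<dots> = (\<integral>\<^sup>+ x. ennreal (g x) * ennreal (F (s *\<^sub>R x + w)) \<partial>M)"
      using F0 g01 by (intro nn_integral_cong) (simp add: ennreal_mult)
    finally show "(\<integral>\<^sup>+ x. ennreal (g x) * ennreal (F (s *\<^sub>R x + w)) \<partial>M) \<le>
      ennreal (\<integral>x. g x \<partial>M) * ((\<integral>\<^sup>+ x. ennreal (F (s *\<^sub>R x + w)) \<partial>M) + ennreal (C * s ^ 4))" .
  qed
  ultimately show ?thesis by (rule that)
qed

lemma log_sum_exp_correlation:
  fixes a :: "'i \<Rightarrow> 'a \<Rightarrow> real" and c :: "'i \<Rightarrow> real"
  assumes J: "finite J" "J \<noteq> {}" and a: "\<And>j. j \<in> J \<Longrightarrow> bounded_linear (a j)"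
    and F0: "\<And>x. 0 \<le> ln (\<Sum>j\<in>J. exp (a j x + c j))" and g: "even_log_concave g"
  shows "(\<integral>\<^sup>+ x. ennreal (g x) * ennreal (ln (\<Sum>j\<in>J. exp (a j x + c j))) \<partial>M) \<le>
    ennreal (\<integral>x. g x \<partial>M) * (\<integral>\<^sup>+ x. ennreal (ln (\<Sum>j\<in>J. exp (a j x + c j))) \<partial>M)"
proof -
  let ?F = "\<lambda>x. ln (\<Sum>j\<in>J. exp (a j x + c j))"
  have gm [measurable]: "g \<in> borel_measurable borel" and g01: "\<And>x. g x \<in> {0..1}"
    using g unfolding even_log_concave_def by blast+
  have I01: "(\<integral>x. g x \<partial>M) \<in> {0..1}" by (rule integral_unit_interval[OF gm g01])
  have am: "a j \<in> borel_measurable borel" if "j \<in> J" for j using a[OF that] by (rule bounded_linear_measurable)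
  have Fm: "(\<lambda>x. ennreal (?F x)) \<in> borel_measurable borel"
    using am by (intro measurable_compose[OF _ measurable_ennreal] borel_measurable_ln borel_measurable_sum borel_measurable_exp borel_measurable_add) auto
  obtain C where C: "0 \<le> C" "\<And>s. 0 < s \<Longrightarrow> s \<le> 1 \<Longrightarrow> correlated_upto (\<lambda>x. ennreal (?F x)) s (ennreal (C * s ^ 4))"
    using log_sum_exp_correlated_upto[OF J a F0] by blast
  show ?thesis
  proof (rule ennreal_le_epsilon)
    fix e :: real assume e: "0 < e"
    obtain n :: nat where "C / e < real n" using reals_Archimedean2 by blast
    also have "real n \<le> 2 ^ n" using less_exp[of n] by (simp flip: of_nat_le_iff)
    finally have n: "C / 2 ^ n \<le> e" using e by (simp add: field_simps)
    define s where "s = 1 / sqrt 2 ^ n"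
    have s: "0 < s" "s \<le> 1" by (simp_all add: s_def one_le_power)
    have "correlated_upto (\<lambda>x. ennreal (?F x)) 1 (2 ^ n * ennreal (C * s ^ 4))"
      by (rule correlated_upto_iterate[OF Fm]) (use C(2)[OF s] in \<open>simp add: s_def\<close>)
    then have "(\<integral>\<^sup>+ x. ennreal (g x) * ennreal (?F (1 *\<^sub>R x + 0)) \<partial>M) \<le>
      ennreal (\<integral>x. g x \<partial>M) * ((\<integral>\<^sup>+ x. ennreal (?F (1 *\<^sub>R x + 0)) \<partial>M) + 2 ^ n * ennreal (C * s ^ 4))"
      using g unfolding correlated_upto_def by blast
    also have "2 ^ n * ennreal (C * s ^ 4) = ennreal (C / 2 ^ n)"
    proof -
      have "s ^ 4 = 1 / (2 ^ n) ^ 2"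
      proof -
        have "(sqrt 2 ^ n) ^ 4 = ((sqrt 2) ^ 2) ^ (2 * n)" by (simp only: power_mult[symmetric] mult_ac) simp
        then show ?thesis by (simp add: s_def power_divide power_mult mult.commute)
      qed
      then have "C / 2 ^ n = 2 ^ n * (C * s ^ 4)" by (simp add: power2_eq_square)
      then show ?thesis using C(1) s by (simp add: ennreal_mult ennreal_power[symmetric] del: ennreal_power)
    qed
    also have "ennreal (\<integral>x. g x \<partial>M) * ((\<integral>\<^sup>+ x. ennreal (?F (1 *\<^sub>R x + 0)) \<partial>M) + ennreal (C / 2 ^ n)) \<le>
       ennreal (\<integral>x. g x \<partial>M) * (\<integral>\<^sup>+ x. ennreal (?F x) \<partial>M) + ennreal e"
    proof -
      have "ennreal (\<integral>x. g x \<partial>M) * ennreal (C / 2 ^ n) \<le> 1 * ennreal e"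
        using I01 n by (intro mult_mono) (auto simp: ennreal_le_1 intro: ennreal_leI)
      then show ?thesis by (simp add: distrib_left add_left_mono)
    qed
    finally show "(\<integral>\<^sup>+ x. ennreal (g x) * ennreal (?F x) \<partial>M) \<le> ennreal (\<integral>x. g x \<partial>M) * (\<integral>\<^sup>+ x. ennreal (?F x) \<partial>M) + ennreal e"
      by simp
  qed
qed

text \<open>At inverse temperature \<beta> the log-sum-exp lies between \<beta> times the maximum
  and the same plus \<open>ln (card J)\<close>; after division by \<beta> the difference is at most
  \<open>e\<close>.\<close>

lemma max_affine_correlation:
  fixes a :: "'i \<Rightarrow> 'a \<Rightarrow> real" and c :: "'i \<Rightarrow> real"
  assumes J: "finite J" "J \<noteq> {}" and a: "\<And>j. j \<in> J \<Longrightarrow> bounded_linear (a j)"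
    and F0: "\<And>x. 0 \<le> (MAX j\<in>J. a j x + c j)" and g: "even_log_concave g"
  shows "(\<integral>\<^sup>+ x. ennreal (g x) * ennreal (MAX j\<in>J. a j x + c j) \<partial>M) \<le>
    ennreal (\<integral>x. g x \<partial>M) * (\<integral>\<^sup>+ x. ennreal (MAX j\<in>J. a j x + c j) \<partial>M)"
proof (rule ennreal_le_epsilon)
  let ?F = "\<lambda>x. MAX j\<in>J. a j x + c j"
  have gm [measurable]: "g \<in> borel_measurable borel" and g01: "\<And>x. g x \<in> {0..1}"
    using g unfolding even_log_concave_def by blast+
  have I01: "(\<integral>x. g x \<partial>M) \<in> {0..1}" by (rule integral_unit_interval[OF gm g01])
  have am: "a j \<in> borel_measurable borel" if "j \<in> J" for j using a[OF that] by (rule bounded_linear_measurable)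
  have Fm [measurable]: "?F \<in> borel_measurable borel"
    using am J by (intro borel_measurable_Max borel_measurable_add) auto
  fix e :: real assume e: "0 < e"
  \<comment> \<open>The summand 1 keeps \<beta> positive when \<open>J\<close> has a single
    element.\<close>
  define \<beta> where "\<beta> = (ln (card J) + 1) / e"
  have cJ: "card J \<ge> 1" using J by (simp add: Suc_le_eq card_gt_0_iff)
  then have lnJ: "0 \<le> ln (card J)" by simp
  have \<beta>: "\<beta> > 0" using lnJ e by (simp add: \<beta>_def add_nonneg_pos)
  let ?L = "\<lambda>x. ln (\<Sum>j\<in>J. exp (\<beta> * a j x + \<beta> * c j))"
  have lower: "\<beta> * ?F x \<le> ?L x" and upper: "?L x \<le> \<beta> * ?F x + ln (card J)" for x
  proof -
    obtain i where i: "i \<in> J" "?F x = a i x + c i"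
      using obtains_MAX[OF J, of "\<lambda>j. a j x + c j"] by metis
    have max: "a j x + c j \<le> ?F x" if "j \<in> J" for j using J that by (intro Max_ge) auto
    have pos: "0 < (\<Sum>j\<in>J. exp (\<beta> * a j x + \<beta> * c j))" using J by (intro sum_pos) auto
    have "exp (\<beta> * ?F x) = exp (\<beta> * a i x + \<beta> * c i)" using i by (simp add: distrib_left)
    also have "\<dots> \<le> (\<Sum>j\<in>J. exp (\<beta> * a j x + \<beta> * c j))" using J i by (intro member_le_sum) auto
    finally show "\<beta> * ?F x \<le> ?L x" using pos by (simp add: ln_ge_iff)
    have "(\<Sum>j\<in>J. exp (\<beta> * a j x + \<beta> * c j)) \<le> (\<Sum>j\<in>J. exp (\<beta> * ?F x))"
      using max \<beta> by (intro sum_mono) (simp flip: distrib_left)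
    also have "\<dots> = card J * exp (\<beta> * ?F x)" by simp
    finally have "?L x \<le> ln (card J * exp (\<beta> * ?F x))" using pos by (intro ln_mono) auto
    also have "\<dots> = \<beta> * ?F x + ln (card J)" using cJ by (simp add: ln_mult)
    finally show "?L x \<le> \<beta> * ?F x + ln (card J)" .
  qed
  have L0: "0 \<le> ?L x" for x using lower[of x] F0[of x] \<beta> by (smt (verit) mult_nonneg_nonneg)
  have "ennreal \<beta> * (\<integral>\<^sup>+ x. ennreal (g x) * ennreal (?F x) \<partial>M) = (\<integral>\<^sup>+ x. ennreal \<beta> * (ennreal (g x) * ennreal (?F x)) \<partial>M)"
    by (rule nn_integral_cmult[symmetric]) simp
  also have "\<dots> \<le> (\<integral>\<^sup>+ x. ennreal (g x) * ennreal (?L x) \<partial>M)"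
  proof (rule nn_integral_mono)
    fix x
    have "ennreal \<beta> * (ennreal (g x) * ennreal (?F x)) = ennreal (g x) * ennreal (\<beta> * ?F x)"
      using \<beta> F0 by (simp add: ennreal_mult mult_ac)
    also have "\<dots> \<le> ennreal (g x) * ennreal (?L x)" using lower by (intro mult_left_mono ennreal_leI) auto
    finally show "ennreal \<beta> * (ennreal (g x) * ennreal (?F x)) \<le> ennreal (g x) * ennreal (?L x)" .
  qed
  also have "\<dots> \<le> ennreal (\<integral>x. g x \<partial>M) * (\<integral>\<^sup>+ x. ennreal (?L x) \<partial>M)"
    using a by (intro log_sum_exp_correlation J L0 g bounded_linear_const_mult)
  also have "\<dots> \<le> ennreal (\<integral>x. g x \<partial>M) * (\<integral>\<^sup>+ x. ennreal \<beta> * ennreal (?F x) + ennreal (\<beta> * e) \<partial>M)"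
  proof (intro mult_left_mono nn_integral_mono)
    fix x
    have "?L x \<le> \<beta> * ?F x + \<beta> * e" using upper[of x] lnJ e by (simp add: \<beta>_def)
    then have "ennreal (?L x) \<le> ennreal (\<beta> * ?F x + \<beta> * e)" by (rule ennreal_leI)
    also have "\<dots> = ennreal \<beta> * ennreal (?F x) + ennreal (\<beta> * e)"
      using \<beta> e F0 by (simp add: ennreal_plus ennreal_mult)
    finally show "ennreal (?L x) \<le> ennreal \<beta> * ennreal (?F x) + ennreal (\<beta> * e)" .
  qed simp
  also have "(\<integral>\<^sup>+ x. ennreal \<beta> * ennreal (?F x) + ennreal (\<beta> * e) \<partial>M) = ennreal \<beta> * ((\<integral>\<^sup>+ x. ennreal (?F x) \<partial>M) + ennreal e)"
    using \<beta> e by (simp add: nn_integral_add nn_integral_cmult distrib_left ennreal_mult emeasure_space_1[simplified])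
  finally have "ennreal \<beta> * (\<integral>\<^sup>+ x. ennreal (g x) * ennreal (?F x) \<partial>M) \<le>
     ennreal \<beta> * (ennreal (\<integral>x. g x \<partial>M) * ((\<integral>\<^sup>+ x. ennreal (?F x) \<partial>M) + ennreal e))"
    by (simp add: mult_ac)
  then have "(\<integral>\<^sup>+ x. ennreal (g x) * ennreal (?F x) \<partial>M) \<le> ennreal (\<integral>x. g x \<partial>M) * ((\<integral>\<^sup>+ x. ennreal (?F x) \<partial>M) + ennreal e)"
    using \<beta> by (subst (asm) ennreal_mult_le_mult_iff) auto
  also have "\<dots> \<le> ennreal (\<integral>x. g x \<partial>M) * (\<integral>\<^sup>+ x. ennreal (?F x) \<partial>M) + ennreal e"
  proof -
    have "ennreal (\<integral>x. g x \<partial>M) * ennreal e \<le> 1 * ennreal e"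
      using I01 by (intro mult_right_mono) (auto simp: ennreal_le_1)
    then show ?thesis by (simp add: distrib_left add_left_mono)
  qed
  finally show "(\<integral>\<^sup>+ x. ennreal (g x) * ennreal (?F x) \<partial>M) \<le> ennreal (\<integral>x. g x \<partial>M) * (\<integral>\<^sup>+ x. ennreal (?F x) \<partial>M) + ennreal e" .
qed

end

section \<open>Convex functions\<close>

text \<open>Supporting affine functions at a countable dense set suffice. Each subgradient is
  bounded because the function is bounded above near its base point.\<close>

lemma convex_affine_minorants:
  fixes \<phi> :: "'a::{real_normed_vector, second_countable_topology} \<Rightarrow> real"
  assumes conv: "convex_on UNIV \<phi>" and cont: "continuous_on UNIV \<phi>"
  obtains a :: "nat \<Rightarrow> 'a \<Rightarrow> real" and c :: "nat \<Rightarrow> real"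
  where "\<And>j. bounded_linear (a j)" "\<And>j x. a j x + c j \<le> \<phi> x" "\<And>x e. 0 < e \<Longrightarrow> \<exists>j. \<phi> x - e < a j x + c j"
proof -
  obtain D :: "'a set" where D: "countable D" "\<And>X. open X \<Longrightarrow> X \<noteq> {} \<Longrightarrow> \<exists>d\<in>D. d \<in> X"
    using countable_dense_setE by blast
  have Dne: "D \<noteq> {}" using D(2)[of UNIV] by auto
  define d where "d = from_nat_into D"
  have d: "range d = D" unfolding d_def using D(1) Dne by (simp add: range_from_nat_into)
  have isc: "isCont \<phi> x" for x using cont by (simp add: continuous_on_eq_continuous_at)
  have "\<exists>l. bounded_linear l \<and> (\<forall>x. \<phi> x0 + l (x - x0) \<le> \<phi> x)" for x0
  proof -
    obtain l where l: "linear l" "\<And>x. \<phi> x0 + l (x - x0) \<le> \<phi> x"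
      using convex_linear_subgradient[OF conv] by blast
    interpret linear l by fact
    obtain \<delta> where \<delta>: "\<delta> > 0" "\<And>x. dist x x0 < \<delta> \<Longrightarrow> dist (\<phi> x) (\<phi> x0) < 1"
      using isc[of x0] unfolding continuous_at_eps_delta using zero_less_one by blast
    have le: "l v \<le> norm v * (2 / \<delta>)" for v
    proof (cases "v = 0")
      case False
      define r where "r = \<delta> / (2 * norm v)"
      have r: "r > 0" using \<delta> False by (simp add: r_def)
      have "dist (x0 + r *\<^sub>R v) x0 < \<delta>" using \<delta> False by (simp add: dist_norm r_def)
      then have "\<phi> (x0 + r *\<^sub>R v) < \<phi> x0 + 1" using \<delta>(2) by (fastforce simp: dist_real_def)
      then have "r * l v \<le> 1" using l(2)[of "x0 + r *\<^sub>R v"] by (simp add: scale)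
      then show ?thesis using r False \<delta>(1) by (simp add: r_def field_simps)
    qed (simp add: zero)
    have "bounded_linear l"
    proof (rule bounded_linear_intro)
      show "norm (l x) \<le> norm x * (2 / \<delta>)" for x using le[of x] le[of "- x"] by (simp add: neg abs_le_iff)
    qed (simp_all add: add scale)
    then show ?thesis using l(2) by blast
  qed
  then obtain l where l: "\<And>x0. bounded_linear (l x0)" "\<And>x0 x. \<phi> x0 + l x0 (x - x0) \<le> \<phi> x" by metis
  have eq: "l (d j) x + (\<phi> (d j) - l (d j) (d j)) = \<phi> (d j) + l (d j) (x - d j)" for j x
    by (simp add: linear_simps[OF l(1)])
  show ?thesis
  proof (rule that[of "\<lambda>j. l (d j)" "\<lambda>j. \<phi> (d j) - l (d j) (d j)"])
    show "bounded_linear (l (d j))" for j by (rule l(1))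
    show "l (d j) x + (\<phi> (d j) - l (d j) (d j)) \<le> \<phi> x" for j x
      unfolding eq by (rule l(2))
    fix x and e :: real assume e: "0 < e"
    \<comment> \<open>To approximate at \<open>x\<close> without a uniform bound on the
      subgradients, the one at \<open>d j\<close> is tested at the reflection
      \<open>2 *\<^sub>R d j - x\<close>. This bounds the affine function at \<open>x\<close> from
      below by \<open>2 * \<phi> (d j) - \<phi> (2 *\<^sub>R d j - x)\<close>, which is near
      \<open>\<phi> x\<close>.\<close>
    have "isCont (\<lambda>y. 2 * \<phi> y - \<phi> (2 *\<^sub>R y - x)) x"
      by (intro continuous_intros isCont_o2[OF _ isc] isc)
    then obtain \<delta> where \<delta>: "\<delta> > 0" "\<And>y. dist y x < \<delta> \<Longrightarrow> dist (2 * \<phi> y - \<phi> (2 *\<^sub>R y - x)) (2 * \<phi> x - \<phi> (2 *\<^sub>R x - x)) < e"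
      unfolding continuous_at_eps_delta using e by blast
    obtain j where j: "dist (d j) x < \<delta>"
      using D(2)[of "ball x \<delta>"] \<delta>(1) d by (auto simp: dist_commute)
    have "dist (2 * \<phi> (d j) - \<phi> (2 *\<^sub>R d j - x)) (\<phi> x) < e"
      using \<delta>(2)[OF j] by (simp add: scaleR_2)
    then have 1: "\<phi> x - e < 2 * \<phi> (d j) - \<phi> (2 *\<^sub>R d j - x)" by (simp add: dist_real_def)
    have e: "2 *\<^sub>R d j - x - d j = - (x - d j)" by (simp add: scaleR_2)
    then have "\<phi> (d j) - l (d j) (x - d j) \<le> \<phi> (2 *\<^sub>R d j - x)"
      using l(2)[of "d j" "2 *\<^sub>R d j - x"] unfolding e linear_simps(4)[OF l(1)] by simp
    then have "\<phi> x - e < \<phi> (d j) + l (d j) (x - d j)" using 1 by linarith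
    then show "\<exists>j. \<phi> x - e < l (d j) x + (\<phi> (d j) - l (d j) (d j))" unfolding eq by blast
  qed
qed

lemma (in gaussian_measure) convex_continuous_correlation:
  assumes conv: "convex_on UNIV \<phi>" and cont: "continuous_on UNIV \<phi>" and \<phi>0: "\<And>x. 0 \<le> \<phi> x"
    and g: "even_log_concave g"
  shows "(\<integral>\<^sup>+ x. ennreal (g x) * ennreal (\<phi> x) \<partial>M) \<le> ennreal (\<integral>x. g x \<partial>M) * (\<integral>\<^sup>+ x. ennreal (\<phi> x) \<partial>M)"
proof -
  have gm [measurable]: "g \<in> borel_measurable borel" using g unfolding even_log_concave_def by blast
  obtain a :: "nat \<Rightarrow> 'a \<Rightarrow> real" and c where a: "\<And>j. bounded_linear (a j)" "\<And>j x. a j x + c j \<le> \<phi> x"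
    "\<And>x e. 0 < e \<Longrightarrow> \<exists>j. \<phi> x - e < a j x + c j"
    using convex_affine_minorants[OF conv cont] by blast
  \<comment> \<open>Index 0 carries the zero function, which keeps every finite maximum
    nonnegative.\<close>
  define b where "b j = (case j of 0 \<Rightarrow> (\<lambda>_. 0) | Suc i \<Rightarrow> a i)" for j
  define k where "k j = (case j of 0 \<Rightarrow> 0 | Suc i \<Rightarrow> c i)" for j
  have b: "bounded_linear (b j)" for j by (cases j) (simp_all add: b_def a bounded_linear_zero)
  note [measurable] = bounded_linear_measurable[OF b]
  have bk: "b j x + k j \<le> \<phi> x" for j x by (cases j) (simp_all add: b_def k_def a \<phi>0)
  define F where "F m x = (MAX j\<in>{..m}. b j x + k j)" for m x
  have Fm [measurable]: "F m \<in> borel_measurable borel" for m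
    unfolding F_def by (intro borel_measurable_Max) auto
  have F_ge: "b j x + k j \<le> F m x" if "j \<le> m" for j m x unfolding F_def using that by (intro Max_ge) auto
  have F0: "0 \<le> F m x" for m x using F_ge[of 0 m x] by (simp add: b_def k_def)
  have F_le: "F m x \<le> \<phi> x" for m x unfolding F_def using bk by (intro Max.boundedI) auto
  have inc: "F m x \<le> F m' x" if "m \<le> m'" for m m' x unfolding F_def using that by (intro Max_mono) auto
  have sup: "(SUP m. ennreal (F m x)) = ennreal (\<phi> x)" for x
  proof (rule antisym)
    show "(SUP m. ennreal (F m x)) \<le> ennreal (\<phi> x)" using F_le by (intro SUP_least ennreal_leI)
    show "ennreal (\<phi> x) \<le> (SUP m. ennreal (F m x))"
    proof (rule ennreal_le_epsilon)
      fix e :: real assume "0 < e"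
      then obtain j where "\<phi> x - e < a j x + c j" using a(3) by blast
      then have "\<phi> x \<le> F (Suc j) x + e" using F_ge[of "Suc j" "Suc j" x] by (simp add: b_def k_def)
      then have "ennreal (\<phi> x) \<le> ennreal (F (Suc j) x) + ennreal e"
        using F0 \<open>0 < e\<close> by (simp flip: ennreal_plus add: ennreal_leI)
      also have "\<dots> \<le> (SUP m. ennreal (F m x)) + ennreal e" by (intro add_right_mono SUP_upper) simp
      finally show "ennreal (\<phi> x) \<le> (SUP m. ennreal (F m x)) + ennreal e" .
    qed
  qed
  have "(\<integral>\<^sup>+ x. ennreal (g x) * ennreal (\<phi> x) \<partial>M) = (\<integral>\<^sup>+ x. (SUP m. ennreal (g x) * ennreal (F m x)) \<partial>M)"
    by (simp add: SUP_mult_left_ennreal flip: sup)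
  also have "\<dots> = (SUP m. \<integral>\<^sup>+ x. ennreal (g x) * ennreal (F m x) \<partial>M)"
    by (intro nn_integral_monotone_convergence_SUP) (auto simp: incseq_def le_fun_def intro!: mult_left_mono ennreal_leI inc)
  also have "\<dots> \<le> ennreal (\<integral>x. g x \<partial>M) * (\<integral>\<^sup>+ x. ennreal (\<phi> x) \<partial>M)"
  proof (rule SUP_least)
    fix m
    have "(\<integral>\<^sup>+ x. ennreal (g x) * ennreal (F m x) \<partial>M) \<le> ennreal (\<integral>x. g x \<partial>M) * (\<integral>\<^sup>+ x. ennreal (F m x) \<partial>M)"
      unfolding F_def using F0[of m] by (intro max_affine_correlation b g) (auto simp: F_def)
    also have "\<dots> \<le> ennreal (\<integral>x. g x \<partial>M) * (\<integral>\<^sup>+ x. ennreal (\<phi> x) \<partial>M)"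
      using F_le by (intro mult_left_mono nn_integral_mono ennreal_leI) auto
    finally show "(\<integral>\<^sup>+ x. ennreal (g x) * ennreal (F m x) \<partial>M) \<le> ennreal (\<integral>x. g x \<partial>M) * (\<integral>\<^sup>+ x. ennreal (\<phi> x) \<partial>M)" .
  qed
  finally show ?thesis .
qed

text \<open>A convex function that is only measurable for the completion need not have measurable sections.
  Averaging it by upper integrals keeps convexity at every point.\<close>

definition majorants :: "'a::real_vector measure \<Rightarrow> ('a \<Rightarrow> real) \<Rightarrow> 'a \<Rightarrow> ('a \<Rightarrow> real) set" where
  "majorants R f y = {\<psi>. integrable R \<psi> \<and> (AE z in R. f (y + z) \<le> \<psi> z)}"

definition upper_mean :: "'a::real_vector measure \<Rightarrow> ('a \<Rightarrow> real) \<Rightarrow> 'a \<Rightarrow> real" where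
  "upper_mean R f y = (INF \<psi>\<in>majorants R f y. \<integral>z. \<psi> z \<partial>R)"

lemma majorants_convex:
  assumes f: "convex_on UNIV f" and \<psi>: "\<psi> \<in> majorants R f x" "\<psi>' \<in> majorants R f y" and t: "0 \<le> t" "t \<le> 1"
  shows "(\<lambda>z. (1 - t) * \<psi> z + t * \<psi>' z) \<in> majorants R f ((1 - t) *\<^sub>R x + t *\<^sub>R y)"
proof -
  have "AE z in R. f (x + z) \<le> \<psi> z" "AE z in R. f (y + z) \<le> \<psi>' z" using \<psi> by (auto simp: majorants_def)
  then have "AE z in R. f ((1 - t) *\<^sub>R x + t *\<^sub>R y + z) \<le> (1 - t) * \<psi> z + t * \<psi>' z"
  proof eventually_elim
    case (elim z)
    have "(1 - t) *\<^sub>R x + t *\<^sub>R y + z = (1 - t) *\<^sub>R (x + z) + t *\<^sub>R (y + z)" by (simp add: algebra_simps)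
    then have "f ((1 - t) *\<^sub>R x + t *\<^sub>R y + z) \<le> (1 - t) * f (x + z) + t * f (y + z)"
      using convex_onD[OF f t, of "x + z" "y + z"] by simp
    also have "\<dots> \<le> (1 - t) * \<psi> z + t * \<psi>' z" using elim t by (intro add_mono mult_left_mono) auto
    finally show ?case .
  qed
  then show ?thesis using \<psi> by (simp add: majorants_def)
qed

lemma majorants_bdd_below:
  assumes "\<And>x. 0 \<le> f x"
  shows "bdd_below ((\<lambda>\<psi>. \<integral>z. \<psi> z \<partial>R) ` majorants R f y)" and "\<psi> \<in> majorants R f y \<Longrightarrow> 0 \<le> (\<integral>z. \<psi> z \<partial>R)"
proof -
  have *: "0 \<le> (\<integral>z. \<psi> z \<partial>R)" if "\<psi> \<in> majorants R f y" for \<psi>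
  proof (rule integral_nonneg_AE)
    have "AE z in R. f (y + z) \<le> \<psi> z" using that by (simp add: majorants_def)
    then show "AE z in R. 0 \<le> \<psi> z" by eventually_elim (rule order.trans[OF assms])
  qed
  then show "bdd_below ((\<lambda>\<psi>. \<integral>z. \<psi> z \<partial>R) ` majorants R f y)" by (intro bdd_belowI[of _ 0]) auto
  show "\<psi> \<in> majorants R f y \<Longrightarrow> 0 \<le> (\<integral>z. \<psi> z \<partial>R)" by (rule *)
qed

lemma upper_mean_nonneg:
  assumes "\<And>x. 0 \<le> f x" "majorants R f y \<noteq> {}"
  shows "0 \<le> upper_mean R f y"
  unfolding upper_mean_def using assms by (intro cINF_greatest majorants_bdd_below(2)) auto

lemma upper_mean_convex:
  assumes f: "convex_on UNIV f" "\<And>x. 0 \<le> f x" and ne: "majorants R f x \<noteq> {}" "majorants R f y \<noteq> {}" and t: "0 \<le> t" "t \<le> 1"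
  shows "upper_mean R f ((1 - t) *\<^sub>R x + t *\<^sub>R y) \<le> (1 - t) * upper_mean R f x + t * upper_mean R f y"
proof (rule field_le_epsilon)
  fix e :: real assume e: "0 < e"
  obtain \<psi> where \<psi>: "\<psi> \<in> majorants R f x" "(\<integral>z. \<psi> z \<partial>R) < upper_mean R f x + e"
    using cINF_less_iff[OF ne(1) majorants_bdd_below(1)[OF f(2)], of "upper_mean R f x + e"] e by (auto simp: upper_mean_def)
  obtain \<psi>' where \<psi>': "\<psi>' \<in> majorants R f y" "(\<integral>z. \<psi>' z \<partial>R) < upper_mean R f y + e"
    using cINF_less_iff[OF ne(2) majorants_bdd_below(1)[OF f(2)], of "upper_mean R f y + e"] e by (auto simp: upper_mean_def)
  have "upper_mean R f ((1 - t) *\<^sub>R x + t *\<^sub>R y) \<le> (\<integral>z. (1 - t) * \<psi> z + t * \<psi>' z \<partial>R)"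
    unfolding upper_mean_def by (rule cINF_lower[OF majorants_bdd_below(1)[OF f(2)] majorants_convex[OF f(1) \<psi>(1) \<psi>'(1) t]])
  also have "\<dots> = (1 - t) * (\<integral>z. \<psi> z \<partial>R) + t * (\<integral>z. \<psi>' z \<partial>R)"
    using \<psi>(1) \<psi>'(1) by (simp add: majorants_def)
  also have "\<dots> \<le> (1 - t) * (upper_mean R f x + e) + t * (upper_mean R f y + e)"
    using \<psi> \<psi>' t by (intro add_mono mult_left_mono) auto
  also have "\<dots> = (1 - t) * upper_mean R f x + t * upper_mean R f y + e" by (simp add: algebra_simps)
  finally show "upper_mean R f ((1 - t) *\<^sub>R x + t *\<^sub>R y) \<le> (1 - t) * upper_mean R f x + t * upper_mean R f y + e" .
qed

lemma upper_mean_eq_integral: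
  assumes f: "\<And>x. 0 \<le> f x" and int: "integrable R (\<lambda>z. f' (y + z))" and ae: "AE z in R. f (y + z) = f' (y + z)"
  shows "majorants R f y \<noteq> {}" "upper_mean R f y = (\<integral>z. f' (y + z) \<partial>R)"
proof -
  have mem: "(\<lambda>z. f' (y + z)) \<in> majorants R f y"
    unfolding majorants_def using int ae by (auto elim: eventually_mono)
  then show "majorants R f y \<noteq> {}" by blast
  show "upper_mean R f y = (\<integral>z. f' (y + z) \<partial>R)"
  proof (rule antisym)
    show "upper_mean R f y \<le> (\<integral>z. f' (y + z) \<partial>R)"
      unfolding upper_mean_def by (rule cINF_lower[OF majorants_bdd_below(1)[OF f] mem])
    show "(\<integral>z. f' (y + z) \<partial>R) \<le> upper_mean R f y"
      unfolding upper_mean_def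
    proof (rule cINF_greatest)
      fix \<psi> assume \<psi>: "\<psi> \<in> majorants R f y"
      then have "AE z in R. f (y + z) \<le> \<psi> z" by (simp add: majorants_def)
      then have "AE z in R. f' (y + z) \<le> \<psi> z" using ae by eventually_elim simp
      then show "(\<integral>z. f' (y + z) \<partial>R) \<le> (\<integral>z. \<psi> z \<partial>R)"
        using int \<psi> by (intro integral_mono_AE) (auto simp: majorants_def)
    qed (use mem in auto)
  qed
qed

section \<open>Averaging a convex function over the residual\<close>

context gaussian_measure
begin

lemma AE_uminus:
  assumes "AE x in M. Q x"
  shows "AE x in M. Q (- x)"
proof -
  have "AE x in distr M borel uminus. Q x" by (subst distr_uminus) (rule assms)
  then show ?thesis by (rule AE_distrD[rotated]) simp
qed

lemma cov_vector_scale: "cov_vector (\<lambda>x. r * l x) = r *\<^sub>R cov_vector l"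
  by (simp add: cov_vector_def flip: scaleR_scaleR)

lemma AE_shift_direction:
  assumes l: "bounded_linear (l :: 'a \<Rightarrow> real)" and "AE x in M. Q x"
  shows "AE x in M. Q (x + r *\<^sub>R direction l)"
  using AE_shift_cov_vector[OF bounded_linear_const_mult[OF l, of "r * inverse (\<integral>x. (l x)\<^sup>2 \<partial>M)"] assms(2)]
  by (simp add: cov_vector_scale direction_def)

context
  fixes L :: "nat \<Rightarrow> 'a \<Rightarrow> real"
  assumes L: "\<And>i. bounded_linear (L i)"
begin

definition coord :: "nat \<Rightarrow> 'a \<Rightarrow> real" where
  "coord i = (\<lambda>y. L i (residual L i y))"

lemma bounded_linear_coord: "bounded_linear (coord i)"
  unfolding coord_def by (rule bounded_linear_coordinate[OF L])

lemma removed_eq_sum: "x - residual L n x = (\<Sum>i<n. coord i x *\<^sub>R direction (coord i))"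
proof (induction n)
  case (Suc n)
  have "x - residual L (Suc n) x = (x - residual L n x) + coord n x *\<^sub>R direction (coord n)"
    by (simp add: residual.simps(2) coord_def)
  then show ?case by (simp add: Suc)
qed simp

text \<open>An identity for single vectors rather than almost surely. By uncorrelatedness every
  functional vanishes on the difference between \<open>direction (coord n)\<close> and its image
  under \<open>residual L n\<close>, so a norming functional shows that the direction is fixed; the
  next Gram-Schmidt step subtracts it with coefficient 1.\<close>

lemma residual_direction: "i < n \<Longrightarrow> residual L n (direction (coord i)) = 0"
proof (induction n)
  case (Suc n)
  let ?c = "direction (coord n)"
  have step: "residual L (Suc n) x = residual L n x - L n (residual L n x) *\<^sub>R ?c" for x
    by (simp add: residual.simps(2) coord_def)
  show ?case
  proof (cases "i = n")
    case False
    then have "residual L n (direction (coord i)) = 0" using Suc by simp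
    then show ?thesis by (simp add: step linear_simps[OF L])
  next
    case True
    show ?thesis
    proof (cases "(\<integral>x. (coord n x)\<^sup>2 \<partial>M) = 0")
      case z: True
      then have "?c = 0" by (simp add: direction_def)
      then show ?thesis using True linear_simps(3)[OF bounded_linear_residual[OF L]] by simp
    next
      case nz: False
      have P: "bounded_linear (\<lambda>x. x - residual L n x)" by (rule bounded_linear_removed[OF L])
      have zero: "b (?c - residual L n ?c) = 0" if b: "bounded_linear b" for b :: "'a \<Rightarrow> real"
      proof -
        have "b (?c - residual L n ?c) * (\<integral>x. (coord n x)\<^sup>2 \<partial>M) = (\<integral>x. coord n x * b (x - residual L n x) \<partial>M)"
          by (rule functional_direction[OF bounded_linear_coord bounded_linear_compose[OF b P]])
        also have "\<dots> = 0"
          using residual_uncorrelated[where L = L and n = n, OF L b L[of n]] by (simp add: coord_def mult.commute)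
        finally show ?thesis using nz by simp
      qed
      obtain b :: "'a \<Rightarrow> real" where b: "bounded_linear b" "b (?c - residual L n ?c) = norm (?c - residual L n ?c)"
        by (rule norming_functional)
      then have "norm (?c - residual L n ?c) = 0" using zero[OF b(1)] by linarith
      then have fixed: "residual L n ?c = ?c" by simp
      have "coord n ?c * (\<integral>x. (coord n x)\<^sup>2 \<partial>M) = (\<integral>x. (coord n x)\<^sup>2 \<partial>M)"
        using functional_direction[OF bounded_linear_coord bounded_linear_coord, of n n] by (simp add: power2_eq_square)
      then have "coord n ?c = 1" using nz by simp
      then have "L n (residual L n ?c) = 1" by (simp add: coord_def)
      then show ?thesis using True fixed by (simp add: step)
    qed
  qed
qed simp

lemma AE_shift_sum:
  assumes "AE x in M. Q x"
  shows "AE x in M. Q (x + (\<Sum>i<n. r i *\<^sub>R direction (coord i)))"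
proof (induction n)
  case (Suc n)
  from AE_shift_direction[OF bounded_linear_coord this, of "r n" n] show ?case by (simp add: add.assoc add.commute)
qed (use assms in simp)

text \<open>The candidate is the upper mean of \<open>f\<close> at the removed part
  \<open>P x\<close>. It has to be finite, convex and continuous everywhere, although
  \<open>f'\<close> controls it only almost surely. Finiteness spreads by invariance of null sets
  and convexity; continuity follows from boundedness on boxes in finitely many coordinates.\<close>

lemma convex_average:
  assumes f: "convex_on UNIV f" "\<And>x. 0 \<le> f x" and f': "integrable M f'" and ff': "AE x in M. f x = f' x"
  obtains \<phi> where "convex_on UNIV \<phi>" "continuous_on UNIV \<phi>" "\<And>x. 0 \<le> \<phi> x"
    "AE x in M. \<phi> x = (\<integral>z. f' (x - residual L n x + z) \<partial>distr M borel (residual L n))"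
proof -
  define P where "P x = x - residual L n x" for x
  define R where "R = distr M borel (residual L n)"
  define K where "K = distr M borel P"
  define c where "c i = direction (coord i)" for i
  have Pl: "bounded_linear P" unfolding P_def[abs_def] by (rule bounded_linear_removed[OF L])
  interpret KR: borel_prob_pair K R unfolding K_def R_def P_def[abs_def] by (rule borel_prob_pair_residual[OF L])
  have conv: "convolution_measure K R = M" unfolding K_def R_def P_def[abs_def] by (rule convolution_residual[OF L])
  have Psum: "P x = (\<Sum>i<n. coord i x *\<^sub>R c i)" for x unfolding P_def c_def by (rule removed_eq_sum)
  have Pfix: "P (\<Sum>i<n. r i *\<^sub>R c i) = (\<Sum>i<n. r i *\<^sub>R c i)" for r
  proof -
    interpret T: bounded_linear "residual L n" by (rule bounded_linear_residual[OF L])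
    have "residual L n (\<Sum>i<n. r i *\<^sub>R c i) = 0"
      unfolding T.sum T.scaleR c_def by (intro sum.neutral) (simp add: residual_direction)
    then show ?thesis by (simp add: P_def)
  qed
  obtain N where N: "{x \<in> space M. \<not> f x = f' x} \<subseteq> N" "emeasure M N = 0" "N \<in> sets M" using ff' by (rule AE_E)
  have Nm [measurable]: "N \<in> sets borel" using N by simp
  have "(\<integral>\<^sup>+ u. (\<integral>\<^sup>+ z. indicator N (u + z) \<partial>R) \<partial>K) = (\<integral>\<^sup>+ x. indicator N x \<partial>convolution_measure K R)"
    by (rule KR.nn_integral_convolution(2)[symmetric]) simp
  also have "\<dots> = (0 :: ennreal)" unfolding conv using N by simp
  finally have "AE u in K. (\<integral>\<^sup>+ z. indicator N (u + z) \<partial>R) = (0 :: ennreal)"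
    by (subst (asm) nn_integral_0_iff_AE) auto
  then have "AE u in K. AE z in R. f (u + z) = f' (u + z)"
  proof eventually_elim
    case (elim u)
    then have "AE z in R. indicator N (u + z) = (0 :: ennreal)" by (subst (asm) nn_integral_0_iff_AE) auto
    then show ?case by eventually_elim (use N(1) in \<open>auto simp: indicator_eq_0_iff\<close>)
  qed
  moreover have "AE u in K. integrable R (\<lambda>z. f' (u + z))"
    by (rule KR.KR.AE_integrable_fst) (rule KR.integrable_convolution(1), simp add: conv f')
  ultimately have "AE u in K. majorants R f u \<noteq> {} \<and> upper_mean R f u = (\<integral>z. f' (u + z) \<partial>R)"
    by eventually_elim (use upper_mean_eq_integral f(2) in blast)
  then have good: "AE x in M. majorants R f (P x) \<noteq> {} \<and> upper_mean R f (P x) = (\<integral>z. f' (P x + z) \<partial>R)"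
    unfolding K_def by (rule AE_distrD[rotated]) (simp add: bounded_linear_measurable[OF Pl])
  \<comment> \<open>\<open>?y\<close> is the midpoint of \<open>P x + ?y\<close> and
    \<open>P (- x) + ?y\<close>. Both admit majorants for almost every \<open>x\<close>, because
    shifts along the directions and changes of sign preserve null sets.\<close>
  have dom: "majorants R f (\<Sum>i<n. r i *\<^sub>R c i) \<noteq> {}" for r
  proof -
    let ?y = "\<Sum>i<n. r i *\<^sub>R c i"
    have "AE x in M. majorants R f (P x) \<noteq> {}" using good by eventually_elim simp
    from AE_shift_sum[OF this, where r = r and n = n] have 1: "AE x in M. majorants R f (P x + ?y) \<noteq> {}"
      unfolding c_def[symmetric] linear_simps(1)[OF Pl] Pfix .
    have "AE x in M. majorants R f (P x + ?y) \<noteq> {} \<and> majorants R f (P (- x) + ?y) \<noteq> {}"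
      using 1 AE_uminus[OF 1] by eventually_elim simp
    moreover have "ae_filter M \<noteq> bot" by (simp add: ae_filter_eq_bot_iff emeasure_space_1 del: space_M)
    ultimately obtain x where x: "majorants R f (P x + ?y) \<noteq> {}" "majorants R f (P (- x) + ?y) \<noteq> {}"
      using eventually_happens'[of "ae_filter M"] by blast
    have "(1 - 1/2) *\<^sub>R (P x + ?y) + (1/2) *\<^sub>R (P (- x) + ?y) = ?y"
      by (simp add: linear_simps[OF Pl] algebra_simps flip: scaleR_add_left)
    then show ?thesis using x majorants_convex[OF f(1), of _ R "P x + ?y" _ "P (- x) + ?y" "1/2"] by fastforce
  qed
  have domk: "majorants R f (\<Sum>i<k. r i *\<^sub>R c i) \<noteq> {}" if "k \<le> n" for k r
  proof -
    have "(\<Sum>i<n. (if i < k then r i else 0) *\<^sub>R c i) = (\<Sum>i<k. r i *\<^sub>R c i)"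
      using that by (intro sum.mono_neutral_cong_right) auto
    then show ?thesis using dom[of "\<lambda>i. if i < k then r i else 0"] by simp
  qed
  have dom1: "majorants R f (r *\<^sub>R c k) \<noteq> {}" if "k < n" for k r
  proof -
    have "(\<Sum>i<n. (if i = k then r else 0) *\<^sub>R c i) = (\<Sum>i\<in>{k}. r *\<^sub>R c i)"
      using that by (intro sum.mono_neutral_cong_right) auto
    then show ?thesis using dom[of "\<lambda>i. if i = k then r else 0"] by simp
  qed
  have half: "X \<le> b / 2 + e / 2" if "X \<le> (1/2) * U + (1/2) * V" "U \<le> b" "V \<le> e" for X U V b e :: real
    using that by simp
  \<comment> \<open>Induction on the number of coordinates: a point of the box is the midpoint of a
    point of the doubled box in the first \<open>k\<close> coordinates and a point on the doubled
    last axis. On that axis convexity reduces to the two endpoints.\<close>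
  have bound: "\<exists>b. \<forall>r. (\<forall>i<k. \<bar>r i\<bar> \<le> B) \<longrightarrow> upper_mean R f (\<Sum>i<k. r i *\<^sub>R c i) \<le> b" if "k \<le> n" for k B
    using that
  proof (induction k arbitrary: B)
    case 0 then show ?case by auto
  next
    case (Suc k)
    obtain b where b: "\<And>r. (\<forall>i<k. \<bar>r i\<bar> \<le> 2 * B) \<Longrightarrow> upper_mean R f (\<Sum>i<k. r i *\<^sub>R c i) \<le> b"
      using Suc.IH[of "2 * B"] Suc.prems by auto
    \<comment> \<open>Both endpoint values are nonnegative, so their sum bounds every convex
      combination of them.\<close>
    let ?e = "upper_mean R f ((- 2 * B) *\<^sub>R c k) + upper_mean R f ((2 * B) *\<^sub>R c k)"
    have "upper_mean R f (\<Sum>i<Suc k. r i *\<^sub>R c i) \<le> b / 2 + ?e / 2" if r: "\<forall>i<Suc k. \<bar>r i\<bar> \<le> B" for r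
    proof -
      have k: "k < n" "k \<le> n" using Suc.prems by auto
      have B0: "0 \<le> B" and rk: "\<bar>r k\<bar> \<le> B" using r by (auto intro: order.trans[OF abs_ge_zero])
      have "(\<Sum>i<Suc k. r i *\<^sub>R c i) = (1 - 1/2) *\<^sub>R (\<Sum>i<k. (2 * r i) *\<^sub>R c i) + (1/2) *\<^sub>R ((2 * r k) *\<^sub>R c k)"
        by (simp add: scaleR_sum_right)
      then have "upper_mean R f (\<Sum>i<Suc k. r i *\<^sub>R c i) \<le>
          (1/2) * upper_mean R f (\<Sum>i<k. (2 * r i) *\<^sub>R c i) + (1/2) * upper_mean R f ((2 * r k) *\<^sub>R c k)"
        using upper_mean_convex[OF f domk[OF k(2)] dom1[OF k(1)], of "1/2" "\<lambda>i. 2 * r i" "2 * r k"] by simp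
      moreover have "upper_mean R f (\<Sum>i<k. (2 * r i) *\<^sub>R c i) \<le> b"
        using r by (intro b) (auto simp: abs_mult)
      moreover have "upper_mean R f ((2 * r k) *\<^sub>R c k) \<le> ?e"
      proof (cases "B = 0")
        case True
        then have "r k = 0" using rk by simp
        then show ?thesis using True upper_mean_nonneg[OF f(2) dom1[OF k(1), of 0]] by simp
      next
        case False
        define t where "t = (r k + B) / (2 * B)"
        have t: "0 \<le> t" "t \<le> 1" using rk B0 False by (auto simp: t_def field_simps abs_le_iff)
        have "2 * r k = (1 - t) * (- 2 * B) + t * (2 * B)" using False by (simp add: t_def field_simps)
        then have "(2 * r k) *\<^sub>R c k = (1 - t) *\<^sub>R ((- 2 * B) *\<^sub>R c k) + t *\<^sub>R ((2 * B) *\<^sub>R c k)"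
          by (simp only: scaleR_scaleR scaleR_add_left[symmetric])
        then have "upper_mean R f ((2 * r k) *\<^sub>R c k) \<le>
           (1 - t) * upper_mean R f ((- 2 * B) *\<^sub>R c k) + t * upper_mean R f ((2 * B) *\<^sub>R c k)"
          using upper_mean_convex[OF f dom1[OF k(1)] dom1[OF k(1)] t] by metis
        also have "\<dots> \<le> ?e"
          by (intro add_mono mult_left_le_one_le upper_mean_nonneg f dom1 k) (use t in auto)
        finally show ?thesis .
      qed
      ultimately show ?thesis by (rule half)
    qed
    then show ?case by blast
  qed
  define \<phi> where "\<phi> x = upper_mean R f (P x)" for x
  have ne: "majorants R f (P x) \<noteq> {}" for x unfolding Psum by (rule dom)
  have \<phi>0: "0 \<le> \<phi> x" for x unfolding \<phi>_def by (rule upper_mean_nonneg[OF f(2) ne])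
  have \<phi>c: "convex_on UNIV \<phi>"
  proof (rule convex_onI)
    fix t :: real and x y assume "0 < t" "t < 1"
    then show "\<phi> ((1 - t) *\<^sub>R x + t *\<^sub>R y) \<le> (1 - t) * \<phi> x + t * \<phi> y"
      using upper_mean_convex[OF f ne ne, of t x y] by (simp add: \<phi>_def linear_simps[OF Pl])
  qed simp
  have "isCont \<phi> x" for x
  proof -
    let ?B = "ball (0 :: 'a) (norm x + 1)"
    have "\<exists>m. \<forall>y\<in>?B. \<forall>i<n. \<bar>coord i y\<bar> \<le> m"
    proof -
      have "\<exists>m. 0 < m \<and> (\<forall>y. norm (coord i y) \<le> norm y * m)" for i
        using bounded_linear.pos_bounded[OF bounded_linear_coord[of i]] by blast
      then obtain C where C: "\<And>i. 0 < C i" "\<And>i y. norm (coord i y) \<le> norm y * C i" by metis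
      have "\<bar>coord i y\<bar> \<le> (norm x + 1) * (\<Sum>i<n. C i)" if "y \<in> ?B" "i < n" for y i
      proof -
        have "C i \<le> (\<Sum>i<n. C i)" using that C(1) by (intro member_le_sum) (auto intro: less_imp_le)
        then have "norm y * C i \<le> (norm x + 1) * (\<Sum>i<n. C i)"
          using that C(1)[of i] by (intro mult_mono) (auto intro: less_imp_le)
        then show ?thesis using order.trans[OF C(2)] by simp
      qed
      then show ?thesis by blast
    qed
    then obtain B where B: "\<And>y i. y \<in> ?B \<Longrightarrow> i < n \<Longrightarrow> \<bar>coord i y\<bar> \<le> B" by blast
    obtain b where b: "\<And>r. (\<forall>i<n. \<bar>r i\<bar> \<le> B) \<Longrightarrow> upper_mean R f (\<Sum>i<n. r i *\<^sub>R c i) \<le> b"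
      using bound[of n B] by auto
    have "\<forall>y\<in>?B. \<bar>\<phi> y\<bar> \<le> b"
    proof
      fix y assume "y \<in> ?B"
      then have "\<phi> y \<le> b" unfolding \<phi>_def Psum using B by (intro b) auto
      then show "\<bar>\<phi> y\<bar> \<le> b" using \<phi>0[of y] by simp
    qed
    then have "continuous_on ?B \<phi>"
      using convex_on_subset[OF \<phi>c] by (intro convex_on_bounded_continuous) auto
    then show "isCont \<phi> x" by (simp add: continuous_on_eq_continuous_at)
  qed
  then have "continuous_on UNIV \<phi>" by (simp add: continuous_at_imp_continuous_on)
  moreover have "AE x in M. \<phi> x = (\<integral>z. f' (x - residual L n x + z) \<partial>distr M borel (residual L n))"
    using good by eventually_elim (simp add: \<phi>_def P_def R_def)
  ultimately show ?thesis using \<phi>c \<phi>0 that by blast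
qed

text \<open>Splitting the sample into its independent removed and residual parts turns the left side
  into the iterated integral of \<open>average_R_near_self\<close>.\<close>

lemma average_residual_L1:
  assumes f': "integrable M f'" and c: "cylindrical L m c" "m \<le> n" "integrable M c"
    and e: "(\<integral>\<^sup>+ x. ennreal \<bar>f' x - c x\<bar> \<partial>M) \<le> e"
  shows "(\<integral>\<^sup>+ x. ennreal \<bar>f' x - (\<integral>z. f' (x - residual L n x + z) \<partial>distr M borel (residual L n))\<bar> \<partial>M) \<le> 2 * e"
proof -
  define T where "T = residual L n"
  define P where "P x = x - T x" for x
  define R where "R = distr M borel T"
  define K where "K = distr M borel P"
  have Tl: "bounded_linear T" unfolding T_def by (rule bounded_linear_residual[OF L])
  have Pl: "bounded_linear P" unfolding P_def[abs_def] T_def by (rule bounded_linear_removed[OF L])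
  note [measurable] = bounded_linear_measurable[OF Tl] bounded_linear_measurable[OF Pl]
  interpret KR: borel_prob_pair K R unfolding K_def R_def P_def[abs_def] T_def by (rule borel_prob_pair_residual[OF L])
  have conv: "convolution_measure K R = M" unfolding K_def R_def P_def[abs_def] T_def by (rule convolution_residual[OF L])
  have f'm [measurable]: "f' \<in> borel_measurable borel" using borel_measurable_integrable[OF f'] by simp
  have av [measurable]: "(\<lambda>u. \<integral>z. f' (u + z) \<partial>R) \<in> borel_measurable borel" by (rule KR.measurable_average(2)) simp
  have law: "distr M borel (\<lambda>x. (P x, T x)) = K \<Otimes>\<^sub>M R"
    unfolding K_def R_def using residual_uncorrelated[OF L] by (intro distr_uncorrelated Pl Tl) (simp add: P_def T_def)
  have PT: "(\<lambda>x. (P x, T x)) \<in> borel_measurable M" by measurable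
  have G: "(\<lambda>p. ennreal \<bar>f' (fst p + snd p) - (\<integral>z. f' (fst p + z) \<partial>R)\<bar>) \<in> borel_measurable (borel \<Otimes>\<^sub>M borel)"
    by measurable
  have "(\<integral>\<^sup>+ x. ennreal \<bar>f' x - (\<integral>z. f' (P x + z) \<partial>R)\<bar> \<partial>M) =
      (\<integral>\<^sup>+ p. ennreal \<bar>f' (fst p + snd p) - (\<integral>z. f' (fst p + z) \<partial>R)\<bar> \<partial>distr M borel (\<lambda>x. (P x, T x)))"
    using G by (subst nn_integral_distr[OF PT]) (simp_all add: borel_prod P_def)
  also have "\<dots> = (\<integral>\<^sup>+ u. (\<integral>\<^sup>+ z. ennreal \<bar>f' (u + z) - (\<integral>w. f' (u + w) \<partial>R)\<bar> \<partial>R) \<partial>K)"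
    unfolding law using G by (subst KR.R.nn_integral_fst[symmetric])
      (simp_all add: measurable_cong_sets[OF sets_pair_measure_cong[OF KR.sets_K KR.sets_R] refl])
  also have "\<dots> \<le> 2 * e"
    using KR.average_R_near_self[of f' c e] f' c(3) e cylindrical_residual_AE[OF L c(1,2)]
    unfolding conv R_def[symmetric] T_def[symmetric] by blast
  finally show ?thesis unfolding P_def R_def T_def .
qed

end

text \<open>Replacing \<open>f'\<close> by a continuous convex \<phi> near it in L^1 costs at most
  their distance on each side, since the weight and its integral are at most 1.\<close>

theorem convex_correlation:
  assumes f: "convex_on UNIV f" "\<And>x. 0 \<le> f x" and f': "integrable M f'" "\<And>x. 0 \<le> f' x"
    and ff': "AE x in M. f x = f' x" and g: "even_log_concave g"
  shows "(\<integral>\<^sup>+ x. ennreal (g x) * ennreal (f' x) \<partial>M) \<le> ennreal (\<integral>x. g x \<partial>M) * (\<integral>\<^sup>+ x. ennreal (f' x) \<partial>M)"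
proof (rule ennreal_le_epsilon)
  have gm [measurable]: "g \<in> borel_measurable borel" and g01: "\<And>x. g x \<in> {0..1}"
    using g unfolding even_log_concave_def by blast+
  have I01: "(\<integral>x. g x \<partial>M) \<in> {0..1}" by (rule integral_unit_interval[OF gm g01])
  have [measurable]: "f' \<in> borel_measurable borel" using borel_measurable_integrable[OF f'(1)] by simp
  fix e :: real assume e: "0 < e"
  obtain L :: "nat \<Rightarrow> 'a \<Rightarrow> real" where L: "\<And>i. bounded_linear (L i)"
    and gen: "sets (borel :: 'a measure) = sigma_sets UNIV {{x. L i x \<le> r} | i r. True}"
    using functionals_generate_borel[where 'a = 'a] by blast
  \<comment> \<open>Averaging doubles the L^1 error, and the approximation is used twice; hence a
    quarter of \<open>e\<close>.\<close>
  obtain n c where c: "cylindrical L n c" "integrable M c" "(\<integral>x. \<bar>f' x - c x\<bar> \<partial>M) < e / 4"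
    using cylindrical_functions_dense[OF L gen f'(1), of "e / 4"] e by auto
  have "(\<integral>\<^sup>+ x. ennreal \<bar>f' x - c x\<bar> \<partial>M) = ennreal (\<integral>x. \<bar>f' x - c x\<bar> \<partial>M)"
    using f'(1) c by (intro nn_integral_eq_integral) auto
  also have "\<dots> \<le> ennreal (e / 4)" using c by (intro ennreal_leI) simp
  finally have c3: "(\<integral>\<^sup>+ x. ennreal \<bar>f' x - c x\<bar> \<partial>M) \<le> ennreal (e / 4)" .
  obtain \<phi> where \<phi>: "convex_on UNIV \<phi>" "continuous_on UNIV \<phi>" "\<And>x. 0 \<le> \<phi> x"
    "AE x in M. \<phi> x = (\<integral>z. f' (x - residual L n x + z) \<partial>distr M borel (residual L n))"
    by (rule convex_average[where L = L and n = n, OF L f f'(1) ff']) (rule that)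
  have [measurable]: "\<phi> \<in> borel_measurable borel" by (rule borel_measurable_continuous_onI[OF \<phi>(2)])
  have "(\<integral>\<^sup>+ x. ennreal \<bar>f' x - \<phi> x\<bar> \<partial>M) =
     (\<integral>\<^sup>+ x. ennreal \<bar>f' x - (\<integral>z. f' (x - residual L n x + z) \<partial>distr M borel (residual L n))\<bar> \<partial>M)"
    by (rule nn_integral_cong_AE[OF eventually_mono[OF \<phi>(4)]]) simp
  also have "\<dots> \<le> 2 * ennreal (e / 4)" by (rule average_residual_L1[OF L f'(1) c(1) order_refl c(2) c3])
  also have "2 * ennreal (e / 4) = ennreal (e / 2)" using ennreal_mult[of 2 "e / 4"] e by simp
  finally have d: "(\<integral>\<^sup>+ x. ennreal \<bar>f' x - \<phi> x\<bar> \<partial>M) \<le> ennreal (e / 2)" .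
  have le1: "ennreal (f' x) \<le> ennreal (\<phi> x) + ennreal \<bar>f' x - \<phi> x\<bar>" for x
    unfolding ennreal_plus[OF \<phi>(3) abs_ge_zero, symmetric] by (rule ennreal_leI) linarith
  have le2: "ennreal (\<phi> x) \<le> ennreal (f' x) + ennreal \<bar>f' x - \<phi> x\<bar>" for x
    unfolding ennreal_plus[OF f'(2) abs_ge_zero, symmetric] by (rule ennreal_leI) linarith
  have "(\<integral>\<^sup>+ x. ennreal (g x) * ennreal (f' x) \<partial>M) \<le> (\<integral>\<^sup>+ x. ennreal (g x) * ennreal (\<phi> x) + ennreal \<bar>f' x - \<phi> x\<bar> \<partial>M)"
  proof (rule nn_integral_mono)
    fix x
    have "ennreal (g x) * ennreal (f' x) \<le> ennreal (g x) * ennreal (\<phi> x) + ennreal (g x) * ennreal \<bar>f' x - \<phi> x\<bar>"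
      using mult_left_mono[OF le1, of "ennreal (g x)" x] by (simp add: distrib_left)
    also have "\<dots> \<le> ennreal (g x) * ennreal (\<phi> x) + 1 * ennreal \<bar>f' x - \<phi> x\<bar>"
      using g01[of x] by (intro add_left_mono mult_right_mono) (auto simp: ennreal_le_1)
    finally show "ennreal (g x) * ennreal (f' x) \<le> ennreal (g x) * ennreal (\<phi> x) + ennreal \<bar>f' x - \<phi> x\<bar>" by simp
  qed
  also have "\<dots> = (\<integral>\<^sup>+ x. ennreal (g x) * ennreal (\<phi> x) \<partial>M) + (\<integral>\<^sup>+ x. ennreal \<bar>f' x - \<phi> x\<bar> \<partial>M)"
    by (rule nn_integral_add) auto
  also have "\<dots> \<le> ennreal (\<integral>x. g x \<partial>M) * (\<integral>\<^sup>+ x. ennreal (\<phi> x) \<partial>M) + ennreal (e / 2)"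
    by (intro add_mono convex_continuous_correlation[OF \<phi>(1-3) g] d)
  also have "(\<integral>\<^sup>+ x. ennreal (\<phi> x) \<partial>M) \<le> (\<integral>\<^sup>+ x. ennreal (f' x) + ennreal \<bar>f' x - \<phi> x\<bar> \<partial>M)"
    by (intro nn_integral_mono le2)
  also have "\<dots> = (\<integral>\<^sup>+ x. ennreal (f' x) \<partial>M) + (\<integral>\<^sup>+ x. ennreal \<bar>f' x - \<phi> x\<bar> \<partial>M)"
    by (rule nn_integral_add) auto
  also have "\<dots> \<le> (\<integral>\<^sup>+ x. ennreal (f' x) \<partial>M) + ennreal (e / 2)" by (intro add_left_mono d)
  also have "ennreal (\<integral>x. g x \<partial>M) * ((\<integral>\<^sup>+ x. ennreal (f' x) \<partial>M) + ennreal (e / 2)) + ennreal (e / 2) \<le>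
     ennreal (\<integral>x. g x \<partial>M) * (\<integral>\<^sup>+ x. ennreal (f' x) \<partial>M) + ennreal e"
  proof -
    have "ennreal (\<integral>x. g x \<partial>M) * ennreal (e / 2) \<le> 1 * ennreal (e / 2)"
      using I01 by (intro mult_right_mono) (auto simp: ennreal_le_1)
    then have "ennreal (\<integral>x. g x \<partial>M) * ennreal (e / 2) + ennreal (e / 2) \<le> ennreal (e / 2) + ennreal (e / 2)"
      by (simp add: add_right_mono)
    also have "\<dots> = ennreal e" using e by (simp flip: ennreal_plus)
    finally show ?thesis by (simp add: distrib_left add.assoc add_left_mono)
  qed
  finally show "(\<integral>\<^sup>+ x. ennreal (g x) * ennreal (f' x) \<partial>M) \<le> ennreal (\<integral>x. g x \<partial>M) * (\<integral>\<^sup>+ x. ennreal (f' x) \<partial>M) + ennreal e"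
    by (simp add: add_mono mult_left_mono)
qed

text \<open>A symmetric Borel set inside \<open>A\<close> serves as the weight and a Borel set
  containing \<open>A\<close> as its companion; both differ from \<open>A\<close> by null sets.
  Midpoints of points of the inner set lie in \<open>A\<close>, hence in the outer one.\<close>

lemma even_log_concave_convex_set:
  assumes A: "A \<in> sets (completion M)" and sym: "symmetric_set A" and conv: "convex A"
  obtains B where "B \<in> sets borel" "even_log_concave (indicator B)" "AE x in M. x \<in> A \<longleftrightarrow> x \<in> B"
proof -
  obtain S N N' where S: "A = S \<union> N" "N \<subseteq> N'" "N' \<in> null_sets M" "S \<in> sets M"
    using A by (rule sets_completionE)
  \<comment> \<open>Adding the mirror image makes the set exactly symmetric, and symmetry of
    \<open>A\<close> keeps it inside \<open>A\<close>.\<close>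
  define B where "B = S \<union> uminus -` S"
  have Am: "- x \<in> A \<longleftrightarrow> x \<in> A" for x
    using sym unfolding symmetric_set_def by (metis (no_types, lifting) image_iff minus_minus)
  have SN: "S \<in> sets borel" "N' \<in> sets borel" using S by (auto simp: null_sets_def)
  have "uminus -` S \<in> sets borel" using measurable_sets[of uminus borel borel S] SN by simp
  then have Bm: "B \<in> sets borel" using SN by (simp add: B_def)
  have BA: "B \<subseteq> A" using S(1) Am by (auto simp: B_def)
  have N': "AE x in M. x \<notin> N'" using S(3) by (rule AE_not_in)
  have AB: "AE x in M. x \<in> A \<longleftrightarrow> x \<in> B"
    using N' by eventually_elim (use S(1,2) BA in \<open>auto simp: B_def\<close>)
  have "even_log_concave (indicator B)"
    unfolding even_log_concave_def
  proof (intro conjI exI[of _ "indicator (S \<union> N')"] allI)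
    show "indicator B (- x) = (indicator B x :: real)" for x by (auto simp: B_def indicator_def)
    show "AE x in M. indicator (S \<union> N') x = (indicator B x :: real)"
      using N' by eventually_elim (use S(1,2) BA in \<open>auto simp: B_def indicator_def\<close>)
    show "indicator B x * indicator B y \<le> (indicator (S \<union> N') ((1/2) *\<^sub>R (x + y)) :: real)\<^sup>2" for x y
    proof (cases "x \<in> B \<and> y \<in> B")
      case True
      then have "(1/2) *\<^sub>R x + (1/2) *\<^sub>R y \<in> A" using BA conv by (intro convexD) auto
      then have "(1/2) *\<^sub>R (x + y) \<in> S \<union> N'" using S(1,2) by (auto simp: scaleR_add_right)
      then show ?thesis by (simp add: indicator_def)
    qed (auto simp: indicator_def)
  qed (use Bm SN in \<open>auto simp: indicator_def\<close>)
  then show ?thesis using that Bm AB by blast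
qed

end

section \<open>Borel versions and the conditional expectation\<close>

theorem theorem2p11:
  fixes P :: "'a::{banach, second_countable_topology} measure"
    and f :: "'a \<Rightarrow> real"
    and A :: "'a set"
  assumes "wiener_space P"
    and "\<And>\<omega>. 0 \<le> f \<omega>"
    and "convex_on UNIV f"
    and "symmetric_function f"
    and "f \<in> borel_measurable P"
    and "A \<in> sets P"
    and "symmetric_set A"
    and "convex A"
    and "0 < emeasure P A"
  shows "cond_expect P f A \<le> expect P f"
proof -
  obtain M where M: "centered_gaussian_measure M" and P: "P = completion M"
    using assms(1) by (auto simp: wiener_space_def)
  interpret gaussian_measure M by (rule gaussian_measureI_centered[OF M])
  obtain h where hm: "h \<in> borel_measurable M" and fh: "AE x in M. f x = h x"
    using completion_ex_borel_measurable_real[of f M] assms(5) P by blast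
  \<comment> \<open>Truncation at 0 makes the Borel version nonnegative everywhere and changes it
    only on a null set.\<close>
  define f' where "f' x = max 0 (h x)" for x
  have f'm [measurable]: "f' \<in> borel_measurable borel" using hm unfolding f'_def[abs_def] by (simp add: borel_measurable_max)
  have f'0: "0 \<le> f' x" for x by (simp add: f'_def)
  have ff': "AE x in M. f x = f' x" using fh
  proof eventually_elim
    case (elim x) then show ?case using assms(2)[of x] by (simp add: f'_def)
  qed
  have Ef: "expect P f = (\<integral>\<^sup>+ x. ennreal (f' x) \<partial>M)"
    unfolding expect_def P nn_integral_completion by (rule nn_integral_cong_AE[OF eventually_mono[OF ff']]) simp
  obtain B where B: "B \<in> sets borel" "even_log_concave (indicator B)" "AE x in M. x \<in> A \<longleftrightarrow> x \<in> B"
    using even_log_concave_convex_set[of A] assms(6-8) P by blast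
  have PA: "emeasure P A = ennreal (\<integral>x. indicator B x \<partial>M)"
  proof -
    have "emeasure P A = (\<integral>\<^sup>+ x. indicator A x \<partial>P)" using assms(6) by simp
    also have "\<dots> = (\<integral>\<^sup>+ x. indicator B x \<partial>M)"
      unfolding P nn_integral_completion by (rule nn_integral_cong_AE[OF eventually_mono[OF B(3)]]) (simp add: indicator_def)
    also have "\<dots> = ennreal (\<integral>x. indicator B x \<partial>M)" using B(1) by (simp add: emeasure_eq_measure)
    finally show ?thesis .
  qed
  have EfA: "expect P (\<lambda>x. f x * indicator A x) = (\<integral>\<^sup>+ x. ennreal (indicator B x) * ennreal (f' x) \<partial>M)"
    unfolding expect_def P nn_integral_completion
    by (rule nn_integral_cong_AE[OF eventually_mono[OF eventually_conj[OF ff' B(3)]]]) (simp add: indicator_def)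
  show ?thesis
  \<comment> \<open>A finite expectation supplies the integrability that the L^1 approximation
    requires; if it is infinite, the bound is trivial.\<close>
  proof (cases "expect P f = \<infinity>")
    case False
    then have "integrable M f'" unfolding Ef using f'0 by (intro integrableI_nonneg) (auto simp: top.not_eq_extremum)
    from convex_correlation[OF assms(3,2) this f'0 ff' B(2)]
    have "expect P (\<lambda>x. f x * indicator A x) \<le> emeasure P A * expect P f"
      unfolding EfA Ef PA .
    then show ?thesis
      unfolding cond_expect_def using assms(9) by (intro divide_le_posI_ennreal)
  qed simp
qed

end
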